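(* Let $\mathbb{F}$ be a field of characteristic $0$, let $A$ be the free associative interchange algebra, and let $[a,b]_\circ=a\circ b-b\circ a$, $[a,b]_\bullet=a\bullet b-b\bullet a$. Every multilinear identity in degree 6 satisfied by these two Lie brackets in $A$ is a consequence of: (i) anti-commutativity and the Jacobi identity for each Lie bracket; (ii) the identity \[ \sum_{\sigma}\epsilon(\sigma)\Big\{ 2[[ab^\sigma]_\circ[a[c^\sigma[d^\sigma e^\sigma]_\circ]_\bullet]_\circ]_\bullet -2[[ab^\sigma]_\circ[c^\sigma[a[d^\sigma e^\sigma]_\circ]_\bullet]_\circ]_\bullet +2[[ab^\sigma]_\circ[c^\sigma[d^\sigma[ae^\sigma]_\circ]_\bullet]_\circ]_\bullet -[[b^\sigma c^\sigma]_\circ[a[d^\sigma[ae^\sigma]_\circ]_\bullet]_\circ]_\bullet +[[b^\sigma c^\sigma]_\circ[d^\sigma[a[ae^\sigma]_\circ]_\bullet]_\circ]_\bullet +[[ab^\sigma]_\circ[[ac^\sigma]_\circ[d^\sigma e^\sigma]_\bullet]_\circ]_\bullet +2[[ab^\sigma]_\circ[[c^\sigma d^\sigma]_\circ[ae^\sigma]_\bullet]_\circ]_\bullet +[[b^\sigma c^\sigma]_\circ[[ad^\sigma]_\circ[ae^\sigma]_\bullet]_\circ]_\bullet +[[a[ab^\sigma]_\circ]_\circ[c^\sigma[d^\sigma e^\sigma]_\bullet]_\circ]_\bullet -[[a[b^\sigma c^\sigma]_\circ]_\circ[d^\sigma[ae^\sigma]_\bullet]_\circ]_\bullet +[[b^\sigma[ac^\sigma]_\circ]_\circ[a[d^\sigma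 e^\sigma]_\bullet]_\circ]_\bullet \Big\}\equiv 0, \] where the sum is over all permutations $\sigma$ of $\{b,c,d,e\}$, $x^\sigma$ denotes the image of $x$ under $\sigma$, and $\epsilon(\sigma)$ is the sign; and (iii) the identity obtained from the identity in (ii) by interchanging $\circ$ and $\bullet$.
   Context: An associative interchange algebra is a vector space with two associative bilinear operations $\circ,\bullet$ satisfying $(a\circ b)\bullet(c\circ d)\equiv(a\bullet c)\circ(b\bullet d)$. Inside brackets, juxtaposition separates the two arguments: $[xy]_\circ=[x,y]_\circ$. An identity is a consequence of a set $S$ if it lies in the smallest subspace of the free nonassociative algebra on two anti-commutative operations containing $S$ and closed under substitution of polynomials for variables and multiplication by polynomials; in characteristic 0 a homogeneous identity is equivalent to its complete linearization. *)

theory Defs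
  imports "HOL-Library.Poly_Mapping" "HOL-Library.Multiset" "HOL-Combinatorics.Permutations"
begin

datatype oper = Circ | Bull

datatype mono = Var nat | Op oper mono mono

type_synonym 'k fpoly = "mono \<Rightarrow>\<^sub>0 'k"

definition gen :: "nat \<Rightarrow> 'k::field fpoly" where
  "gen i = Poly_Mapping.single (Var i) 1"

definition smult :: "'k::field \<Rightarrow> 'k fpoly \<Rightarrow> 'k fpoly" where
  "smult c p = Poly_Mapping.map (\<lambda>x. c * x) p"

definition pmult :: "oper \<Rightarrow> 'k::field fpoly \<Rightarrow> 'k fpoly \<Rightarrow> 'k fpoly" where
  "pmult w p q = (\<Sum>s\<in>Poly_Mapping.keys p. \<Sum>t\<in>Poly_Mapping.keys q.
       Poly_Mapping.single (Op w s t) (Poly_Mapping.lookup p s * Poly_Mapping.lookup q t))"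

definition pbrack :: "oper \<Rightarrow> 'k::field fpoly \<Rightarrow> 'k fpoly \<Rightarrow> 'k fpoly" where
  "pbrack w p q = pmult w p q - pmult w q p"

fun eval_mono :: "(oper \<Rightarrow> 'k::field fpoly \<Rightarrow> 'k fpoly \<Rightarrow> 'k fpoly) \<Rightarrow> (nat \<Rightarrow> 'k fpoly)
    \<Rightarrow> mono \<Rightarrow> 'k fpoly" where
  "eval_mono m phi (Var i) = phi i"
| "eval_mono m phi (Op w s t) = m w (eval_mono m phi s) (eval_mono m phi t)"

definition eval_poly :: "(oper \<Rightarrow> 'k::field fpoly \<Rightarrow> 'k fpoly \<Rightarrow> 'k fpoly) \<Rightarrow> (nat \<Rightarrow> 'k fpoly)
    \<Rightarrow> 'k fpoly \<Rightarrow> 'k fpoly" where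
  "eval_poly m phi p = (\<Sum>s\<in>Poly_Mapping.keys p. smult (Poly_Mapping.lookup p s) (eval_mono m phi s))"

definition subst :: "(nat \<Rightarrow> 'k::field fpoly) \<Rightarrow> 'k fpoly \<Rightarrow> 'k fpoly" where
  "subst phi p = eval_poly pmult phi p"

inductive_set consequences :: "'k::field fpoly set \<Rightarrow> 'k fpoly set" for S where
  base: "f \<in> S \<Longrightarrow> f \<in> consequences S"
| zero: "0 \<in> consequences S"
| add: "f \<in> consequences S \<Longrightarrow> g \<in> consequences S \<Longrightarrow> f + g \<in> consequences S"
| scal: "f \<in> consequences S \<Longrightarrow> smult c f \<in> consequences S"
| sub: "f \<in> consequences S \<Longrightarrow> subst phi f \<in> consequences S"
| multl: "f \<in> consequences S \<Longrightarrow> pmult w g f \<in> consequences S"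
| multr: "f \<in> consequences S \<Longrightarrow> pmult w f g \<in> consequences S"

definition aia_relations :: "'k::field fpoly set" where
  "aia_relations =
     {pmult w (pmult w (gen 0) (gen 1)) (gen 2) - pmult w (gen 0) (pmult w (gen 1) (gen 2)) | w. True}
     \<union> {pmult Bull (pmult Circ (gen 0) (gen 1)) (pmult Circ (gen 2) (gen 3))
         - pmult Circ (pmult Bull (gen 0) (gen 2)) (pmult Bull (gen 1) (gen 3))}"

text \<open>The free associative interchange algebra A is the free nonassociative algebra
  (on countably many generators) modulo the T-ideal aia_ideal.  An element p represents
  zero in A iff p is in aia_ideal.\<close>
definition aia_ideal :: "'k::field fpoly set" where
  "aia_ideal = consequences aia_relations"

text \<open>A polynomial identity f (whose formal operations are read as the two Lie brackets)
  is satisfied by the two Lie brackets in A iff for every assignment of elements of A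
  (represented by polynomials) to the variables, the bracket evaluation is zero in A.\<close>
definition bracket_identity_in_AIA :: "'k::field fpoly \<Rightarrow> bool" where
  "bracket_identity_in_AIA f \<longleftrightarrow> (\<forall>phi. eval_poly pbrack phi f \<in> aia_ideal)"

fun leaves :: "mono \<Rightarrow> nat multiset" where
  "leaves (Var i) = {#i#}"
| "leaves (Op w s t) = leaves s + leaves t"

definition multilinear_deg :: "nat \<Rightarrow> 'k::field fpoly \<Rightarrow> bool" where
  "multilinear_deg n f \<longleftrightarrow>
     (\<exists>V. finite V \<and> card V = n \<and> (\<forall>s\<in>Poly_Mapping.keys f. leaves s = mset_set V))"

definition anticomm_id :: "oper \<Rightarrow> 'k::field fpoly" where
  "anticomm_id w = pmult w (gen 0) (gen 1) + pmult w (gen 1) (gen 0)"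

definition jacobi_id :: "oper \<Rightarrow> 'k::field fpoly" where
  "jacobi_id w = pmult w (pmult w (gen 0) (gen 1)) (gen 2)
               + pmult w (pmult w (gen 1) (gen 2)) (gen 0)
               + pmult w (pmult w (gen 2) (gen 0)) (gen 1)"

definition id6_terms :: "oper \<Rightarrow> oper \<Rightarrow> nat \<Rightarrow> nat \<Rightarrow> nat \<Rightarrow> nat \<Rightarrow> 'k::field fpoly" where
  "id6_terms w u b c d e =
    (let x = pmult w; y = pmult u; A = gen 0; B = gen b; C = gen c; D = gen d; E = gen e in
       smult 2 (y (x A B) (x A (y C (x D E))))
     - smult 2 (y (x A B) (x C (y A (x D E))))
     + smult 2 (y (x A B) (x C (y D (x A E))))
     - y (x B C) (x A (y D (x A E)))
     + y (x B C) (x D (y A (x A E)))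
     + y (x A B) (x (x A C) (y D E))
     + smult 2 (y (x A B) (x (x C D) (y A E)))
     + y (x B C) (x (x A D) (y A E))
     + y (x A (x A B)) (x C (y D E))
     - y (x A (x B C)) (x D (y A E))
     + y (x B (x A C)) (x A (y D E)))"

definition id6 :: "oper \<Rightarrow> oper \<Rightarrow> 'k::field fpoly" where
  "id6 w u = (\<Sum>\<sigma> | \<sigma> permutes {1,2,3,4::nat}.
      smult (of_int (sign \<sigma>)) (id6_terms w u (\<sigma> 1) (\<sigma> 2) (\<sigma> 3) (\<sigma> 4)))"

definition thm43_generators :: "'k::field fpoly set" where
  "thm43_generators =
     {anticomm_id Circ, anticomm_id Bull, jacobi_id Circ, jacobi_id Bull,
      id6 Circ Bull, id6 Bull Circ}"

end

theory Submission
  imports Defs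
begin

text \<open>
  Modulo anticommutativity and the Jacobi identity a bracket polynomial is determined by the coefficients of
  its associative expansion: a product of brackets is rewritten with right-normed brackets whose last factor
  contains the largest label, and these are dual to the corresponding associative monomials. Evaluating in
  the free associative interchange algebra only identifies associative monomials related by the interchange law, so an
  identity is a function on these monomials that satisfies the shuffle relations at every product and
  has sum 0 over every interchange class.

  Reversing the order of one of the two products preserves the interchange law. This splits every class sum according to
  the parity of the number of those products, and most monomials of degree 6 are then alone in their part.
  The remaining class sums involve few shapes. Playing their permutation symmetries against each other kills all of these except
  three shapes for each choice of the outer operation, on which the coefficients form a space of dimension 5
  (the sign representation twisted by the functions on the labels with sum 0). This space is spanned by the
  linearisations of the given identity in which the repeated variable becomes a pair of labels containing a fixed
  label z, so subtracting a combination of these leaves a polynomial all of whose coefficients vanish.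
\<close>

section \<open>Linear functionals on polynomials\<close>

text \<open>The obstacle is that interchange classes have no evident normal form: in degree 6 one
  class mixes several shapes and both outer operations. Parity helps as much as it does because an
  interchange trades two products of one kind and one of the other for one and two. It thus flips
  the parity of the number of \<open>Circ\<close> products, so neighbouring monomials always lie in
  different parts, and a class of two monomials already falls apart into single ones.

  The space of dimension 5 can be made explicit. A linearisation with repeated variable split into x
  and z is symmetric in x and z. Because of the sign twist its function p must change sign when x
  and z are exchanged, so it is a multiple of the function with value 1 at x, - 1 at z and 0
  elsewhere. The five pairs with z fixed give a basis of the functions with sum 0. The corrections
  for the two outer operations do not disturb each other, since they live on different shapes.

  What remains is finite and is evaluated: closure of the listed classes, the enumeration of all
  shapes, and coefficients of the given identity.\<close>

abbreviation lookup :: "('a \<Rightarrow>\<^sub>0 'b::zero) \<Rightarrow> 'a \<Rightarrow> 'b" where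
  "lookup \<equiv> Poly_Mapping.lookup"

abbreviation keys :: "('a \<Rightarrow>\<^sub>0 'b::zero) \<Rightarrow> 'a set" where
  "keys \<equiv> Poly_Mapping.keys"

lemma lookup_smult [simp]: "lookup (smult c p) s = c * lookup p s"
  unfolding smult_def by (simp add: Poly_Mapping.map.rep_eq when_def)

lemma smult_zero [simp]: "smult c 0 = 0" "smult 0 p = 0"
  by (auto intro: poly_mapping_eqI)

lemma smult_one [simp]: "smult 1 p = p"
  by (auto intro: poly_mapping_eqI)

lemma smult_smult [simp]: "smult a (smult b p) = smult (a * b) p"
  by (auto intro: poly_mapping_eqI)

lemma smult_add: "smult c (p + q) = smult c p + smult c q"
  by (rule poly_mapping_eqI) (simp add: lookup_add algebra_simps)

lemma smult_diff: "smult c (p - q) = smult c p - smult c q"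
  by (rule poly_mapping_eqI) (simp add: lookup_minus algebra_simps)

lemma smult_minus_one: "smult (- 1) p = - p"
  by (rule poly_mapping_eqI) simp

text \<open>Coefficients, expansions and class sums below are all functionals of this form, which
  turns identities between polynomials into exchanges of finite sums.\<close>

definition lf :: "(mono \<Rightarrow> 'k) \<Rightarrow> 'k::field fpoly \<Rightarrow> 'k" where
  "lf \<chi> p = (\<Sum>s\<in>keys p. lookup p s * \<chi> s)"

lemma lf_superset:
  assumes "finite A" "keys p \<subseteq> A"
  shows "lf \<chi> p = (\<Sum>s\<in>A. lookup p s * \<chi> s)"
  unfolding lf_def
  by (rule sum.mono_neutral_left) (use assms in \<open>auto simp: in_keys_iff\<close>)

lemma lf_add: "lf \<chi> (p + q) = lf \<chi> p + lf \<chi> q"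
proof -
  let ?A = "keys p \<union> keys q"
  have "lf \<chi> (p + q) = (\<Sum>s\<in>?A. lookup (p + q) s * \<chi> s)"
    by (rule lf_superset) (use keys_add[of p q] in auto)
  also have "\<dots> = (\<Sum>s\<in>?A. lookup p s * \<chi> s) + (\<Sum>s\<in>?A. lookup q s * \<chi> s)"
    by (simp add: lookup_add algebra_simps sum.distrib)
  also have "\<dots> = lf \<chi> p + lf \<chi> q"
    by (simp add: lf_superset[of ?A])
  finally show ?thesis .
qed

lemma lf_zero [simp]: "lf \<chi> 0 = 0"
  by (simp add: lf_def)

lemma lf_smult: "lf \<chi> (smult c p) = c * lf \<chi> p"
proof -
  have "lf \<chi> (smult c p) = (\<Sum>s\<in>keys p. lookup (smult c p) s * \<chi> s)"
    by (rule lf_superset) (auto simp: in_keys_iff)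
  then show ?thesis by (simp add: lf_def sum_distrib_left algebra_simps)
qed

lemma lf_minus: "lf \<chi> (- p) = - lf \<chi> p"
  using lf_smult[of \<chi> "-1" p] by (simp add: smult_minus_one)

lemma lf_diff: "lf \<chi> (p - q) = lf \<chi> p - lf \<chi> q"
  using lf_add[of \<chi> p "- q"] by (simp add: lf_minus)

lemma lf_sum: "lf \<chi> (sum f A) = (\<Sum>x\<in>A. lf \<chi> (f x))"
  by (induction A rule: infinite_finite_induct) (auto simp: lf_add)

lemma lf_single [simp]: "lf \<chi> (Poly_Mapping.single m c) = c * \<chi> m"
  by (cases "c = 0") (auto simp: lf_def)

lemma lf_const_sum: "lf (\<lambda>m. \<Sum>i\<in>A. g i m) p = (\<Sum>i\<in>A. lf (g i) p)"
  unfolding lf_def by (simp add: sum_distrib_left sum.swap[of _ A])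

lemma lf_swap: "lf (\<lambda>s. lf (F s) q) p = lf (\<lambda>t. lf (\<lambda>s. F s t) p) q"
  by (simp add: lf_def sum_distrib_left sum.swap[of _ "keys q"] mult_ac)

lemma lf_pmult: "lf \<chi> (pmult w p q) = lf (\<lambda>s. lf (\<lambda>t. \<chi> (Op w s t)) q) p"
  by (simp add: pmult_def lf_sum lf_def[of _ p] lf_def[of _ q] sum_distrib_left mult.assoc)

lemma lf_pmult': "lf \<chi> (pmult w p q) = lf (\<lambda>t. lf (\<lambda>s. \<chi> (Op w s t)) p) q"
  unfolding lf_pmult by (rule lf_swap)

lemma lf_cong: "(\<And>s. s \<in> keys p \<Longrightarrow> \<chi> s = \<psi> s) \<Longrightarrow> lf \<chi> p = lf \<psi> p"
  by (simp add: lf_def)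

lemma lf_scale: "lf (\<lambda>s. c * \<chi> s) p = c * lf \<chi> p"
  unfolding lf_def sum_distrib_left by (simp add: mult_ac)

lemma lf_scale_right: "lf (\<lambda>s. \<chi> s * c) p = lf \<chi> p * c"
  unfolding lf_def sum_distrib_right by (simp add: mult_ac)

lemma lookup_eq_lf: "lookup p m = lf (\<lambda>s. if s = m then 1 else 0) p"
  by (auto simp: lf_def if_distrib sum.delta in_keys_iff cong: if_cong)

text \<open>The functionals \<^term>\<open>lf\<close> separate points, so identities between polynomials may be checked under them.\<close>
lemma fpoly_eqI_lf: "(\<And>\<chi>. lf \<chi> p = lf \<chi> q) \<Longrightarrow> p = q"
  by (rule poly_mapping_eqI) (simp add: lookup_eq_lf)

lemma lf_eval_poly: "lf \<chi> (eval_poly m \<phi> p) = lf (\<lambda>s. lf \<chi> (eval_mono m \<phi> s)) p"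
  by (simp add: eval_poly_def lf_sum lf_smult lf_def[of _ p])

lemma pmult_add_left: "pmult w (p + q) r = pmult w p r + pmult w q r"
  by (rule fpoly_eqI_lf) (simp add: lf_pmult lf_add)

lemma pmult_add_right: "pmult w r (p + q) = pmult w r p + pmult w r q"
  by (rule fpoly_eqI_lf) (simp add: lf_pmult' lf_add)

lemma pmult_diff_left: "pmult w (p - q) r = pmult w p r - pmult w q r"
  by (rule fpoly_eqI_lf) (simp add: lf_pmult lf_diff)

lemma pmult_diff_right: "pmult w r (p - q) = pmult w r p - pmult w r q"
  by (rule fpoly_eqI_lf) (simp add: lf_pmult' lf_diff)

lemma pmult_smult_left: "pmult w (smult c p) r = smult c (pmult w p r)"
  by (rule fpoly_eqI_lf) (simp add: lf_pmult lf_smult)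

lemma pmult_smult_right: "pmult w r (smult c p) = smult c (pmult w r p)"
  by (rule fpoly_eqI_lf) (simp add: lf_pmult' lf_smult)

lemma pmult_zero [simp]: "pmult w 0 r = 0" "pmult w r 0 = 0"
  by (simp_all add: pmult_def)

abbreviation mon :: "mono \<Rightarrow> 'k::field fpoly" where
  "mon m \<equiv> Poly_Mapping.single m 1"

lemma pmult_mon [simp]: "pmult w (mon s) (mon t) = mon (Op w s t)"
  by (rule fpoly_eqI_lf) (simp add: lf_pmult)

lemma fpoly_expand: "p = (\<Sum>s\<in>keys p. smult (lookup p s) (mon s))"
  by (rule fpoly_eqI_lf) (simp add: lf_sum lf_smult, simp add: lf_def)

lemma lf_subst: "lf \<chi> (subst \<phi> p) = lf (\<lambda>s. lf \<chi> (eval_mono pmult \<phi> s)) p"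
  by (simp add: subst_def lf_eval_poly)

lemma subst_add: "subst \<phi> (p + q) = subst \<phi> p + subst \<phi> q"
  by (rule fpoly_eqI_lf) (simp add: lf_subst lf_add)

lemma subst_pmult: "subst \<phi> (pmult w p q) = pmult w (subst \<phi> p) (subst \<phi> q)"
  by (rule fpoly_eqI_lf)
     (simp add: lf_subst lf_pmult lf_swap[of _ "eval_mono pmult \<phi> _" q])

lemma subst_gen [simp]: "subst \<phi> (gen i) = \<phi> i"
  by (rule fpoly_eqI_lf) (simp add: lf_subst gen_def)

section \<open>Normal forms modulo the Lie identities\<close>

fun root_is :: "oper \<Rightarrow> mono \<Rightarrow> bool" where
  "root_is w (Var i) = False"
| "root_is w (Op w' s t) = (w = w')"

text \<open>Modulo associativity every monomial is a right comb at each operation; \<^term>\<open>app w\<close> is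
  the product of such normal forms.\<close>
fun app :: "oper \<Rightarrow> mono \<Rightarrow> mono \<Rightarrow> mono" where
  "app w (Var i) t = Op w (Var i) t"
| "app w (Op w' x y) t = (if w' = w then Op w x (app w y t) else Op w (Op w' x y) t)"

fun flat :: "mono \<Rightarrow> mono" where
  "flat (Var i) = Var i"
| "flat (Op w s t) = app w (flat s) (flat t)"

fun right_comb :: "mono \<Rightarrow> bool" where
  "right_comb (Var i) = True"
| "right_comb (Op w s t) = (\<not> root_is w s \<and> right_comb s \<and> right_comb t)"

lemma app_assoc: "app w (app w s t) u = app w s (app w t u)"
  by (induction s) auto

lemma root_is_app [simp]: "root_is w' (app w s t) = (w' = w)"
  by (cases s) auto

lemma app_not_root: "\<not> root_is w s \<Longrightarrow> app w s t = Op w s t"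
  by (cases s) auto

lemma leaves_app [simp]: "leaves (app w s t) = leaves s + leaves t"
  by (induction s) auto

lemma leaves_flat [simp]: "leaves (flat s) = leaves s"
  by (induction s) auto

lemma right_comb_app: "right_comb s \<Longrightarrow> right_comb t \<Longrightarrow> right_comb (app w s t)"
  by (induction s) auto

lemma right_comb_flat [simp]: "right_comb (flat s)"
  by (induction s) (auto intro: right_comb_app)

section \<open>Associative expansions of bracket monomials\<close>

fun expansion :: "mono \<Rightarrow> (int \<times> mono) list" where
  "expansion (Var i) = [(1, Var i)]"
| "expansion (Op w s t) =
    concat (map (\<lambda>(c, a). concat (map (\<lambda>(d, b). [(c * d, Op w a b), (- (c * d), Op w b a)]) (expansion t))) (expansion s))"

lemma leaves_expansion: "(c, t) \<in> set (expansion s) \<Longrightarrow> leaves t = leaves s"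
  by (induction s arbitrary: c t) (fastforce simp: union_ac)+

lemma root_expansion: "(c, t) \<in> set (expansion s) \<Longrightarrow> root_is w t = root_is w s"
  by (cases s) auto

lemma root_flat: "root_is w (flat s) = root_is w s"
  by (cases s) auto

definition sumL :: "(mono \<Rightarrow> 'k::field fpoly) \<Rightarrow> (int \<times> mono) list \<Rightarrow> 'k fpoly" where
  "sumL F xs = (\<Sum>(c, t)\<leftarrow>xs. smult (of_int c) (F t))"

lemma sumL_simps [simp]:
  "sumL F [] = 0" "sumL F ((c, t) # xs) = smult (of_int c) (F t) + sumL F xs"
  by (simp_all add: sumL_def)

lemma sumL_append [simp]: "sumL F (xs @ ys) = sumL F xs + sumL F ys"
  by (simp add: sumL_def)

lemma sumL_cong:
  "(\<And>c t. (c, t) \<in> set xs \<Longrightarrow> F t = G t) \<Longrightarrow> sumL F xs = sumL G xs"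
  unfolding sumL_def by (intro arg_cong[of _ _ sum_list] map_cong) auto

lemma sumL_diff: "sumL (\<lambda>t. F t - G t) xs = sumL F xs - sumL G xs"
  by (induction xs) (auto simp: smult_diff)

lemma sumL_zero [simp]: "sumL (\<lambda>t. 0) xs = 0"
  by (induction xs) auto

lemma sumL_swap: "sumL (\<lambda>s. sumL (F s) ys) xs = sumL (\<lambda>t. sumL (\<lambda>s. F s t) xs) ys"
proof (induction xs)
  case (Cons x xs)
  have "sumL (\<lambda>t. sumL (\<lambda>s. F s t) (x # xs)) ys
      = smult (of_int (fst x)) (sumL (F (snd x)) ys) + sumL (\<lambda>t. sumL (\<lambda>s. F s t) xs) ys"
    by (cases x, induction ys) (auto simp: smult_add mult.commute algebra_simps)
  then show ?case using Cons by (cases x) simp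
qed simp

lemma sumL_expansion_Op:
  "sumL F (expansion (Op w s t)) = sumL (\<lambda>a. sumL (\<lambda>b. F (Op w a b) - F (Op w b a)) (expansion t)) (expansion s)"
proof -
  have *: "sumL F (concat (map (\<lambda>(d, b). [(c * d, Op w a b), (- (c * d), Op w b a)]) ys))
      = smult (of_int c) (sumL (\<lambda>b. F (Op w a b) - F (Op w b a)) ys)" for c a ys
    by (induction ys) (auto simp: smult_add smult_diff smult_minus_one smult_smult[symmetric] simp del: smult_smult
        intro!: poly_mapping_eqI simp: lookup_add lookup_minus algebra_simps)
  have "sumL F (concat (map (\<lambda>(c, a). concat (map (\<lambda>(d, b). [(c * d, Op w a b), (- (c * d), Op w b a)]) (expansion t))) xs))
      = sumL (\<lambda>a. sumL (\<lambda>b. F (Op w a b) - F (Op w b a)) (expansion t)) xs" for xs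
    by (induction xs) (auto simp: *)
  then show ?thesis by simp
qed

fun max_label :: "mono \<Rightarrow> nat" where
  "max_label (Var i) = i"
| "max_label (Op w s t) = max (max_label s) (max_label t)"

lemma max_label_app [simp]: "max_label (app w s t) = max (max_label s) (max_label t)"
  by (induction s) (auto simp: max.assoc)

lemma max_label_flat [simp]: "max_label (flat s) = max_label s"
  by (induction s) auto

lemma leaves_ne [simp]: "leaves s \<noteq> {#}"
  by (induction s) auto

lemma max_label_leaves: "max_label s = Max (set_mset (leaves s))"
  by (induction s) (auto simp: Max_Un)

lemma max_label_in_leaves: "max_label s \<in># leaves s"
  by (induction s) (auto simp: max_def)

lemma max_label_expansion: "(c, t) \<in> set (expansion s) \<Longrightarrow> max_label t = max_label s"
  by (simp add: max_label_leaves leaves_expansion)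

text \<open>The right combs in which the last factor of every product contains the largest label of that
  product. Read as right-normed brackets they span the bracket monomials, and the coefficient of
  such a bracket is the coefficient of the same monomial in the associative expansion.\<close>
fun special :: "mono \<Rightarrow> bool" where
  "special (Var i) = True"
| "special (Op w x y) = (special x \<and> special y \<and> max_label x < max_label y)"

text \<open>The condition on a left factor \<open>s\<close> of a product at \<open>w\<close> whose
  largest label lies further right: the factors of \<open>s\<close> at \<open>w\<close> must be
  special one by one, while the comparisons along the product are settled by that label.\<close>

fun special_factors :: "oper \<Rightarrow> mono \<Rightarrow> bool" where
  "special_factors w (Var i) = True"
| "special_factors w (Op w' x y) = (if w' = w then special x \<and> special_factors w y else special (Op w' x y))"

lemma special_factors_app: "special_factors w (app w s t) = (special_factors w s \<and> special_factors w t)"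
  by (induction s) auto

lemma special_factors_not_root: "\<not> root_is w s \<Longrightarrow> special_factors w s = special s"
  by (cases s) auto

text \<open>A largest label in \<open>t\<close> makes every comparison along the factors of
  \<open>s\<close> true. Together with \<open>not_special_app\<close> this shows that of the two
  orders in a commutator only the one with the larger maximum on the right contributes special
  combs.\<close>

lemma special_app: "max_label s < max_label t \<Longrightarrow> special (app w s t) = (special_factors w s \<and> special t)"
  by (induction s) auto

lemma not_special_app: "max_label t < max_label s \<Longrightarrow> \<not> special (app w s t)"
  by (induction s) (auto simp: less_max_iff_disj)

lemma consequences_minus: "p \<in> consequences S \<Longrightarrow> - p \<in> consequences S"
  using consequences.scal[of p S "-1"] by (simp add: smult_minus_one)

lemma consequences_diff: "p \<in> consequences S \<Longrightarrow> q \<in> consequences S \<Longrightarrow> p - q \<in> consequences S"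
  using consequences.add[of p S "- q"] by (simp add: consequences_minus)

section \<open>Rewriting modulo anticommutativity and the Jacobi identity\<close>

locale lie_identities =
  fixes S :: "'k::field fpoly set"
  assumes anticomm_in: "anticomm_id w \<in> S" and jacobi_in: "jacobi_id w \<in> S"
begin

definition eqv :: "'k fpoly \<Rightarrow> 'k fpoly \<Rightarrow> bool" where
  "eqv p q \<longleftrightarrow> p - q \<in> consequences S"

lemma eqv_refl [simp]: "eqv p p"
  by (simp add: eqv_def consequences.zero)

lemma eqv_trans [trans]: "eqv p q \<Longrightarrow> eqv q r \<Longrightarrow> eqv p r"
  unfolding eqv_def using consequences.add[of "p - q" S "q - r"] by simp

lemma eqv_add: "eqv p q \<Longrightarrow> eqv p' q' \<Longrightarrow> eqv (p + p') (q + q')"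
  unfolding eqv_def using consequences.add[of "p - q" S "p' - q'"] by (simp add: algebra_simps)

lemma eqv_smult: "eqv p q \<Longrightarrow> eqv (smult c p) (smult c q)"
  unfolding eqv_def using consequences.scal[of "p - q" S c] by (simp add: smult_diff)

lemma eqv_minus: "eqv p q \<Longrightarrow> eqv (- p) (- q)"
  using eqv_smult[of p q "-1"] by (simp add: smult_minus_one)

lemma eqv_diff: "eqv p q \<Longrightarrow> eqv p' q' \<Longrightarrow> eqv (p - p') (q - q')"
  using eqv_add[of p q "- p'" "- q'"] eqv_minus[of p' q'] by simp

lemma eqv_pmult_left: "eqv p q \<Longrightarrow> eqv (pmult w p r) (pmult w q r)"
  unfolding eqv_def using consequences.multr[of "p - q" S w r] by (simp add: pmult_diff_left)

lemma eqv_pmult_right: "eqv p q \<Longrightarrow> eqv (pmult w r p) (pmult w r q)"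
  unfolding eqv_def using consequences.multl[of "p - q" S w r] by (simp add: pmult_diff_right)

lemma eqv_sumL:
  "(\<And>c t. (c, t) \<in> set xs \<Longrightarrow> eqv (F t) (G t)) \<Longrightarrow> eqv (sumL F xs) (sumL G xs)"
proof (induction xs)
  case (Cons x xs)
  obtain c t where x: "x = (c, t)" by (cases x)
  have "eqv (F t) (G t)" by (rule Cons.prems[of c]) (simp add: x)
  moreover have "eqv (sumL F xs) (sumL G xs)" by (rule Cons.IH) (use Cons.prems in auto)
  ultimately show ?case by (simp add: x eqv_add eqv_smult)
qed simp

lemma eqv_sum: "(\<And>x. x \<in> A \<Longrightarrow> eqv (f x) (g x)) \<Longrightarrow> eqv (sum f A) (sum g A)"
  by (induction A rule: infinite_finite_induct) (auto intro: eqv_add)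

lemma pmult_sumL_left: "pmult w (sumL F xs) r = sumL (\<lambda>t. pmult w (F t) r) xs"
  by (induction xs) (auto simp: pmult_add_left pmult_smult_left)

lemma pmult_sumL_right: "pmult w r (sumL F xs) = sumL (\<lambda>t. pmult w r (F t)) xs"
  by (induction xs) (auto simp: pmult_add_right pmult_smult_right)

lemma anticomm: "eqv (pmult w p q) (- pmult w q p)"
proof -
  have "subst (\<lambda>i. if i = 0 then p else q) (anticomm_id w) \<in> consequences S"
    by (intro consequences.sub consequences.base anticomm_in)
  then show ?thesis by (simp add: eqv_def anticomm_id_def subst_add subst_pmult)
qed

lemma jacobi:
  "eqv (pmult w (pmult w p q) r) (pmult w p (pmult w q r) - pmult w q (pmult w p r))"
proof -
  have "subst (\<lambda>i. if i = 0 then p else if i = 1 then q else r) (jacobi_id w) \<in> consequences S"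
    by (intro consequences.sub consequences.base jacobi_in)
  then have "eqv (pmult w (pmult w p q) r + pmult w (pmult w q r) p + pmult w (pmult w r p) q) 0"
    by (simp add: eqv_def jacobi_id_def subst_add subst_pmult)
  from eqv_diff[OF this eqv_add[OF anticomm[of w "pmult w q r" p] anticomm[of w "pmult w r p" q]]]
  have "eqv (pmult w (pmult w p q) r) (pmult w p (pmult w q r) + pmult w q (pmult w r p))"
    by (simp add: algebra_simps)
  also have "eqv \<dots> (pmult w p (pmult w q r) + pmult w q (- pmult w p r))"
    by (intro eqv_add eqv_refl eqv_pmult_right anticomm)
  finally show ?thesis
    using pmult_diff_right[of w q 0 "pmult w p r"] by simp
qed

definition nf :: "mono \<Rightarrow> 'k fpoly" where
  "nf s = sumL (\<lambda>t. if special (flat t) then mon (flat t) else 0) (expansion s)"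

text \<open>By the Jacobi identity ad sends brackets to commutators of operators. Hence the bracket
  of \<open>s\<close> with any \<open>m\<close> arises by letting the factors at \<open>w\<close> of
  each term in the expansion of \<open>s\<close> act on \<open>m\<close> one after the other; the
  factors with the other outer operation are normalised as in \<open>nf\<close>.\<close>

definition ad_expansion :: "oper \<Rightarrow> mono \<Rightarrow> mono \<Rightarrow> 'k fpoly" where
  "ad_expansion w s m = sumL (\<lambda>t. if special_factors w (flat t) then mon (app w (flat t) m) else 0) (expansion s)"

text \<open>The smaller maximum lies in \<open>s1\<close>, so only terms with \<open>s1\<close> on
  the left survive in the commutator, and these are the adjoint action of \<open>s1\<close> on the
  normal form of \<open>s2\<close>.\<close>

lemma normal_form_Op:
  assumes IH1: "\<And>w m. eqv (mon (Op w s1 m)) (ad_expansion w s1 m)"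
    and IH2: "eqv (mon s2) (nf s2)" and less: "max_label s1 < max_label s2"
  shows "eqv (mon (Op w s1 s2)) (nf (Op w s1 s2))"
proof -
  have "eqv (mon (Op w s1 s2)) (pmult w (mon s1) (nf s2))"
    using eqv_pmult_right[OF IH2, of w "mon s1"] by simp
  also have "pmult w (mon s1) (nf s2)
      = sumL (\<lambda>t. if special (flat t) then mon (Op w s1 (flat t)) else 0) (expansion s2)"
    by (simp add: nf_def pmult_sumL_right if_distrib cong: if_cong)
  also have "eqv \<dots> (sumL (\<lambda>t. if special (flat t) then ad_expansion w s1 (flat t) else 0) (expansion s2))"
    by (rule eqv_sumL) (auto intro: IH1)
  also have "\<dots> = sumL (\<lambda>b. sumL (\<lambda>a. (if special_factors w (flat a) \<and> special (flat b) then mon (app w (flat a) (flat b)) else 0)) (expansion s1)) (expansion s2)"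
    by (rule sumL_cong) (auto simp: ad_expansion_def intro!: sumL_cong)
  also have "\<dots> = nf (Op w s1 s2)"
    unfolding nf_def sumL_expansion_Op
    by (subst sumL_swap) (intro sumL_cong, auto simp: special_app not_special_app max_label_expansion less)
  finally show ?thesis .
qed

lemma nf_swap: "nf (Op w s t) = - nf (Op w t s)"
proof -
  have "nf (Op w s t) = sumL (\<lambda>b. sumL (\<lambda>a. (if special (flat (Op w a b)) then mon (flat (Op w a b)) else 0)
      - (if special (flat (Op w b a)) then mon (flat (Op w b a)) else 0)) (expansion s)) (expansion t)"
    unfolding nf_def sumL_expansion_Op by (rule sumL_swap)
  also have "\<dots> = - nf (Op w t s)"
    unfolding nf_def sumL_expansion_Op by (simp add: sumL_diff)
  finally show ?thesis .
qed

text \<open>Both claims go through one induction: the normal form of a bracket uses the adjoint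
  expansion of the factor with the smaller maximum, and the adjoint expansion at the other operation
  uses the normal form. Distinct labels ensure that the two maxima differ.\<close>

lemma normal_form:
  assumes "\<forall>x. count (leaves s) x \<le> 1"
  shows "eqv (mon s) (nf s)" "eqv (mon (Op w s m)) (ad_expansion w s m)"
proof -
  have "eqv (mon s) (nf s) \<and> (\<forall>w m. eqv (mon (Op w s m)) (ad_expansion w s m))"
    using assms
  proof (induction s)
    case (Var i)
    then show ?case by (simp add: nf_def ad_expansion_def)
  next
    case (Op v s1 s2)
    have d: "\<forall>x. count (leaves s1) x \<le> 1" "\<forall>x. count (leaves s2) x \<le> 1"
      using Op.prems by (metis add_leD1 add_leD2 count_union leaves.simps(2))+
    note IH = Op.IH(1)[OF d(1)] Op.IH(2)[OF d(2)]
    have "max_label s1 \<noteq> max_label s2"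
    proof
      assume "max_label s1 = max_label s2"
      then have "count (leaves s1) (max_label s1) \<ge> 1" "count (leaves s2) (max_label s1) \<ge> 1"
        using max_label_in_leaves[of s1] max_label_in_leaves[of s2] by (auto simp: Suc_le_eq)
      moreover have "count (leaves s1) (max_label s1) + count (leaves s2) (max_label s1) \<le> 1"
        using Op.prems by simp
      ultimately show False by linarith
    qed
    then consider "max_label s1 < max_label s2" | "max_label s2 < max_label s1" by linarith
    then have b: "eqv (mon (Op v s1 s2)) (nf (Op v s1 s2))"
    proof cases
      case 1
      then show ?thesis using IH by (intro normal_form_Op) auto
    next
      case 2
      then have "eqv (mon (Op v s2 s1)) (nf (Op v s2 s1))"
        using IH by (intro normal_form_Op) auto
      then have "eqv (- mon (Op v s2 s1)) (nf (Op v s1 s2))"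
        by (subst nf_swap) (rule eqv_minus)
      then show ?thesis
        using eqv_trans[OF anticomm[of v "mon s1" "mon s2"]] by simp
    qed
    moreover have "eqv (mon (Op w (Op v s1 s2) m)) (ad_expansion w (Op v s1 s2) m)" for w m
    proof (cases "v = w")
      case False
      have "eqv (mon (Op w (Op v s1 s2) m)) (pmult w (nf (Op v s1 s2)) (mon m))"
        using eqv_pmult_left[OF b, of w "mon m"] by simp
      also have "\<dots> = ad_expansion w (Op v s1 s2) m"
        unfolding nf_def ad_expansion_def pmult_sumL_left
        using False by (intro sumL_cong) (auto simp: special_factors_not_root app_not_root root_expansion root_flat)
      finally show ?thesis .
    next
      case True
      \<comment> \<open>Two successive adjoint actions. By associativity of \<open>app\<close> the
        commutator of the two orders is the expansion of the bracket of \<open>s1\<close> and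
        \<open>s2\<close>.\<close>
      have nest: "eqv (mon (Op w a (Op w b m)))
          (sumL (\<lambda>t. sumL (\<lambda>t'. if special_factors w (flat t') \<and> special_factors w (flat t) then mon (app w (flat t') (app w (flat t) m)) else 0) (expansion a)) (expansion b))"
        if "\<And>w m. eqv (mon (Op w a m)) (ad_expansion w a m)" "\<And>w m. eqv (mon (Op w b m)) (ad_expansion w b m)" for a b
      proof -
        have "eqv (mon (Op w a (Op w b m))) (pmult w (mon a) (ad_expansion w b m))"
          using eqv_pmult_right[OF that(2), of w "mon a" w m] by simp
        also have "\<dots> = sumL (\<lambda>t. if special_factors w (flat t) then mon (Op w a (app w (flat t) m)) else 0) (expansion b)"
          by (simp add: ad_expansion_def pmult_sumL_right if_distrib cong: if_cong)
        also have "eqv \<dots> (sumL (\<lambda>t. if special_factors w (flat t) then ad_expansion w a (app w (flat t) m) else 0) (expansion b))"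
          by (rule eqv_sumL) (auto intro: that)
        also have "\<dots> = sumL (\<lambda>t. sumL (\<lambda>t'. if special_factors w (flat t') \<and> special_factors w (flat t) then mon (app w (flat t') (app w (flat t) m)) else 0) (expansion a)) (expansion b)"
          by (rule sumL_cong) (auto simp: ad_expansion_def intro!: sumL_cong)
        finally show ?thesis .
      qed
      have "eqv (mon (Op w (Op w s1 s2) m)) (mon (Op w s1 (Op w s2 m)) - mon (Op w s2 (Op w s1 m)))"
        using jacobi[of w "mon s1" "mon s2" "mon m"] by simp
      also have "eqv \<dots> (ad_expansion w (Op w s1 s2) m)"
        unfolding ad_expansion_def sumL_expansion_Op
        apply (rule eqv_trans[OF eqv_diff[OF nest nest]])
            apply (use IH in auto)[4]
        apply (subst sumL_swap)
        apply (simp add: sumL_diff[symmetric] special_factors_app app_assoc)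
        apply (simp add: conj_commute app_assoc cong: if_cong)
        done
      finally show ?thesis using True by simp
    qed
    ultimately show ?case by blast
  qed
  then show "eqv (mon s) (nf s)" "eqv (mon (Op w s m)) (ad_expansion w s m)" by auto
qed

end

section \<open>Coefficients of expansions, computed by cutting products into two factors\<close>

fun splits :: "oper \<Rightarrow> mono \<Rightarrow> (mono \<times> mono) list" where
  "splits w (Var i) = []"
| "splits w (Op w' x y) = (if w' = w then (x, y) # map (\<lambda>(a, b). (Op w x a, b)) (splits w y) else [])"

lemma splits_app: "(s, t) \<in> set (splits w (app w s t))"
proof (induction s)
  case (Op w' x y)
  then show ?case by (cases "w' = w") (auto intro: rev_image_eqI)
qed simp

lemma splits_sound:
  "right_comb t \<Longrightarrow> (a, b) \<in> set (splits w t) \<Longrightarrow> app w a b = t \<and> right_comb a \<and> right_comb b"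
proof (induction t arbitrary: a b)
  case (Op w' x y)
  from Op.prems(2) have w: "w' = w" by (auto split: if_splits)
  from Op.prems(2) consider "a = x" "b = y" | a' where "a = Op w x a'" "(a', b) \<in> set (splits w y)"
    by (auto simp: w)
  then show ?case
  proof cases
    case 1
    then show ?thesis using Op.prems(1) by (simp add: w app_not_root)
  next
    case 2
    then show ?thesis using Op.IH(2)[OF _ 2(2)] Op.prems(1) by (simp add: w)
  qed
qed simp

lemma splits_iff:
  "right_comb t \<Longrightarrow> (a, b) \<in> set (splits w t) \<longleftrightarrow> app w a b = t"
  using splits_sound splits_app by blast

lemma distinct_splits: "distinct (splits w t)"
proof (induction t)
  case (Op w' x y)
  have "Op w x a \<noteq> x" for a
    by (rule size_neq_size_imp_neq) simp
  then show ?case using Op by (auto simp: distinct_map inj_on_def)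
qed simp

text \<open>The coefficient of a right comb in the associative expansion of a bracket monomial.\<close>
fun ec :: "mono \<Rightarrow> mono \<Rightarrow> int" where
  "ec (Var i) t = (if t = Var i then 1 else 0)"
| "ec (Op w s1 s2) t = (\<Sum>(a, b)\<leftarrow>splits w t. ec s1 a * ec s2 b - ec s1 b * ec s2 a)"

definition sumI :: "(mono \<Rightarrow> 'k::comm_ring_1) \<Rightarrow> (int \<times> mono) list \<Rightarrow> 'k" where
  "sumI h xs = (\<Sum>(c, m)\<leftarrow>xs. of_int c * h m)"

lemma sumI_simps [simp]:
  "sumI h [] = 0" "sumI h ((c, m) # xs) = of_int c * h m + sumI h xs"
  by (simp_all add: sumI_def)

lemma sumI_append [simp]: "sumI h (xs @ ys) = sumI h xs + sumI h ys"
  by (simp add: sumI_def)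

lemma sumI_cong:
  "(\<And>c t. (c, t) \<in> set xs \<Longrightarrow> h t = g t) \<Longrightarrow> sumI h xs = sumI g xs"
  unfolding sumI_def by (intro arg_cong[of _ _ sum_list] map_cong) auto

lemma sumI_diff: "sumI (\<lambda>t. h t - g t) xs = sumI h xs - sumI g xs"
  by (induction xs) (auto simp: algebra_simps)

lemma sumI_add: "sumI (\<lambda>t. h t + g t) xs = sumI h xs + sumI g xs"
  by (induction xs) (auto simp: algebra_simps)

lemma sumI_zero [simp]: "sumI (\<lambda>t. 0) xs = 0"
  by (induction xs) auto

lemma sumI_scale: "sumI (\<lambda>t. c * h t) xs = c * sumI h xs"
  by (induction xs) (auto simp: algebra_simps)

lemma sumI_scale_right: "sumI (\<lambda>t. h t * c) xs = sumI h xs * c"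
  by (induction xs) (auto simp: algebra_simps)

lemma sumI_sum_list: "sumI (\<lambda>m. \<Sum>x\<leftarrow>ys. g x m) xs = (\<Sum>x\<leftarrow>ys. sumI (g x) xs)"
  by (induction ys) (auto simp: sumI_add)

lemma sumI_expansion_Op:
  "sumI h (expansion (Op w s t)) = sumI (\<lambda>a. sumI (\<lambda>b. h (Op w a b) - h (Op w b a)) (expansion t)) (expansion s)"
proof -
  have *: "sumI h (concat (map (\<lambda>(d, b). [(c * d, Op w a b), (- (c * d), Op w b a)]) ys))
      = of_int c * (sumI (\<lambda>b. h (Op w a b) - h (Op w b a)) ys)" for c a ys
    by (induction ys) (auto simp: algebra_simps)
  have "sumI h (concat (map (\<lambda>(c, a). concat (map (\<lambda>(d, b). [(c * d, Op w a b), (- (c * d), Op w b a)]) (expansion t))) xs))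
      = sumI (\<lambda>a. sumI (\<lambda>b. h (Op w a b) - h (Op w b a)) (expansion t)) xs" for xs
    by (induction xs) (auto simp: *)
  then show ?thesis by simp
qed

lemma lf_fun_diff: "lf (\<lambda>s. g s - h s) p = lf g p - lf h p"
  by (simp add: lf_def algebra_simps sum_subtractf)

lemma lf_bracket: "lf \<chi> (eval_mono pbrack gen s) = sumI \<chi> (expansion s)"
proof (induction s arbitrary: \<chi>)
  case (Var i)
  then show ?case by (simp add: gen_def)
next
  case (Op w s t)
  let ?p = "eval_mono pbrack gen s" and ?q = "eval_mono pbrack gen t"
  have "lf \<chi> (eval_mono pbrack gen (Op w s t))
      = lf (\<lambda>a. lf (\<lambda>b. \<chi> (Op w a b)) ?q) ?p - lf (\<lambda>a. lf (\<lambda>b. \<chi> (Op w b a)) ?q) ?p"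
    by (simp add: pbrack_def lf_diff lf_pmult[of _ _ ?p] lf_pmult'[of _ _ ?q])
  also have "\<dots> = lf (\<lambda>a. lf (\<lambda>b. \<chi> (Op w a b) - \<chi> (Op w b a)) ?q) ?p"
    by (simp add: lf_fun_diff)
  finally show ?case unfolding sumI_expansion_Op by (simp only: Op)
qed

text \<open>The delta function at \<open>t\<close>, pulled back along the product, is a sum over the
  cuts of \<open>t\<close> of products of delta functions. This turns the expansion of a bracket
  into the recursion of \<open>ec\<close>.\<close>

lemma of_bool_app_eq:
  assumes "right_comb t"
  shows "of_bool (app w a b = t) = (\<Sum>(x, y)\<leftarrow>splits w t. of_bool (a = x) * of_bool (b = y) :: 'k::comm_ring_1)"
proof -
  have "(\<Sum>(x, y)\<leftarrow>splits w t. of_bool (a = x) * of_bool (b = y))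
      = (\<Sum>z\<in>set (splits w t). if z = (a, b) then 1 else 0 :: 'k)"
    unfolding sum_list_distinct_conv_sum_set[OF distinct_splits]
    by (rule sum.cong) (auto split: if_splits simp: of_bool_def)
  also have "\<dots> = of_bool (app w a b = t)"
    by (simp add: splits_iff[OF assms])
  finally show ?thesis by simp
qed

lemma of_int_sum_list: "of_int (sum_list xs) = sum_list (map of_int xs)"
  by (induction xs) auto

lemma ec_eq_sumI:
  "right_comb t \<Longrightarrow> of_int (ec s t) = sumI (\<lambda>m. of_bool (flat m = t) :: 'k::comm_ring_1) (expansion s)"
proof (induction s arbitrary: t)
  case (Var i)
  then show ?case by auto
next
  case (Op w s1 s2)
  have "sumI (\<lambda>m. of_bool (flat m = t)) (expansion (Op w s1 s2)) = 
      sumI (\<lambda>a. sumI (\<lambda>b. \<Sum>z\<leftarrow>splits w t. of_bool (flat a = fst z) * of_bool (flat b = snd z)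
         - of_bool (flat b = fst z) * of_bool (flat a = snd z)) (expansion s2)) (expansion s1)"
    unfolding sumI_expansion_Op by (simp add: of_bool_app_eq[OF Op.prems] sum_list_subtractf case_prod_unfold)
  also have "\<dots> = (\<Sum>z\<leftarrow>splits w t. sumI (\<lambda>a. of_bool (flat a = fst z) :: 'k) (expansion s1) * sumI (\<lambda>b. of_bool (flat b = snd z)) (expansion s2)
        - sumI (\<lambda>a. of_bool (flat a = snd z)) (expansion s1) * sumI (\<lambda>b. of_bool (flat b = fst z)) (expansion s2))"
    by (simp add: sumI_sum_list sumI_diff sumI_scale sumI_scale_right mult.commute)
  also have "\<dots> = (\<Sum>z\<leftarrow>splits w t. of_int (ec s1 (fst z)) * of_int (ec s2 (snd z)) - of_int (ec s1 (snd z)) * of_int (ec s2 (fst z)))"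
    using splits_sound[OF Op.prems]
    by (intro arg_cong[of _ _ sum_list] map_cong refl) (auto simp: Op.IH[symmetric])
  also have "\<dots> = of_int (ec (Op w s1 s2) t)"
    by (simp add: case_prod_unfold of_int_sum_list o_def)
  finally show ?case by simp
qed

text \<open>Such an F cannot see the difference between a bracket monomial and the terms of its expansion.\<close>
lemma ec_invariant:
  fixes F :: "mono \<Rightarrow> 'b"
  assumes F: "\<And>w s t. F (Op w s t) = g w (F s) (F t)"
    and comm: "\<And>w x y. g w x y = g w y x" and assoc: "\<And>w x y z. g w (g w x y) z = g w x (g w y z)"
    and nz: "ec s t \<noteq> 0"
  shows "F s = F t"
  using nz
proof (induction s arbitrary: t)
  case (Op w s1 s2)
  have sF: "(a, b) \<in> set (splits w t) \<Longrightarrow> F t = g w (F a) (F b)" for a b t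
    by (induction t arbitrary: a b) (auto simp: F assoc split: if_splits)
  have "\<exists>(a, b) \<in> set (splits w t). ec s1 a * ec s2 b - ec s1 b * ec s2 a \<noteq> 0"
  proof (rule ccontr)
    assume "\<not> ?thesis"
    then have "map (\<lambda>(a, b). ec s1 a * ec s2 b - ec s1 b * ec s2 a) (splits w t) = map (\<lambda>_. 0) (splits w t)"
      by (intro map_cong) auto
    then show False using Op.prems by (simp add: map_replicate_const sum_list_replicate)
  qed
  then obtain a b where ab: "(a, b) \<in> set (splits w t)" "ec s1 a * ec s2 b - ec s1 b * ec s2 a \<noteq> 0"
    by auto
  then have "ec s1 a \<noteq> 0 \<and> ec s2 b \<noteq> 0 \<or> ec s1 b \<noteq> 0 \<and> ec s2 a \<noteq> 0" by auto
  then show ?case using Op.IH sF[OF ab(1)] comm by (metis F)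
qed (auto split: if_splits)

lemma ec_leaves: "ec s t \<noteq> 0 \<Longrightarrow> leaves s = leaves t"
  by (rule ec_invariant[of leaves "\<lambda>_. (+)"]) (auto simp: union_ac)

text \<open>For a right comb \<open>t\<close> this is, by \<open>ec_eq_sumI\<close>, the coefficient
  of \<open>t\<close> after the brackets of \<open>f\<close> are expanded and associativity is
  applied.\<close>

definition coef :: "mono \<Rightarrow> 'k::field fpoly \<Rightarrow> 'k" where
  "coef t f = lf (\<lambda>s. of_int (ec s t)) f"

lemma lookup_sumL: "lookup (sumL F xs) t = sumI (\<lambda>m. lookup (F m) t) xs"
  by (induction xs) (auto simp: lookup_add)

context lie_identities
begin

lemma lookup_nf:
  "lookup (nf s) t = (if right_comb t \<and> special t then of_int (ec s t) else 0)"
proof (cases "right_comb t \<and> special t")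
  case True
  then show ?thesis
    by (auto simp: nf_def lookup_sumL ec_eq_sumI lookup_single when_def intro!: sumI_cong)
next
  case False
  have "lookup (nf s) t = sumI (\<lambda>m. 0) (expansion s)"
    unfolding nf_def lookup_sumL using False
    by (intro sumI_cong) (auto simp: lookup_single when_def)
  then show ?thesis using False by auto
qed

text \<open>The coefficients of the normal form of \<open>f\<close> are the numbers
  \<open>coef t f\<close> at special right combs, so the normal form vanishes. In effect multilinear
  bracket polynomials modulo the Lie identities embed into associative expansions.\<close>

lemma consequence_if_coef_zero:
  assumes ml: "\<And>s. s \<in> keys f \<Longrightarrow> leaves s = mset_set V"
    and zero: "\<And>t. right_comb t \<Longrightarrow> leaves t = mset_set V \<Longrightarrow> coef t f = 0"
  shows "f \<in> consequences S"
proof -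
  let ?P = "\<Sum>s\<in>keys f. smult (lookup f s) (nf s)"
  have "\<forall>x. count (leaves s) x \<le> 1" if "s \<in> keys f" for s
    using ml[OF that] by (simp add: count_mset_set')
  then have "eqv f ?P"
    by (subst fpoly_expand[of f]) (auto intro!: eqv_sum eqv_smult normal_form)
  moreover have "?P = 0"
  proof (rule poly_mapping_eqI)
    fix t
    have "lookup ?P t = (if right_comb t \<and> special t then coef t f else 0)"
      by (cases "right_comb t \<and> special t") (auto simp: Poly_Mapping.lookup_sum lookup_nf coef_def lf_def)
    also have "\<dots> = 0"
    proof (cases "leaves t = mset_set V")
      case False
      then have "ec s t = 0" if "s \<in> keys f" for s
        using ec_leaves[of s t] ml[OF that] by auto
      then show ?thesis by (simp add: coef_def lf_def)
    qed (simp add: zero)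
    finally show "lookup ?P t = lookup 0 t" by simp
  qed
  ultimately show ?thesis by (simp add: eqv_def)
qed

end

section \<open>Interchange classes\<close>

inductive cong :: "mono \<Rightarrow> mono \<Rightarrow> bool" where
  refl: "cong s s"
| sym: "cong s t \<Longrightarrow> cong t s"
| trans: "cong s t \<Longrightarrow> cong t u \<Longrightarrow> cong s u"
| left: "cong s s' \<Longrightarrow> cong (Op w s t) (Op w s' t)"
| right: "cong t t' \<Longrightarrow> cong (Op w s t) (Op w s t')"
| assoc: "cong (Op w (Op w a b) c) (Op w a (Op w b c))"
| inter: "cong (Op Bull (Op Circ a b) (Op Circ c d)) (Op Circ (Op Bull a c) (Op Bull b d))"

text \<open>With the contents of the other slots fixed, \<open>\<chi>\<close> is again a class
  function of the remaining slot, and this carries congruences through substitution.\<close>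

lemma cong_eval:
  assumes "cong s s'" "\<And>a b. cong a b \<Longrightarrow> \<chi> a = \<chi> b"
  shows "lf \<chi> (eval_mono pmult \<phi> s) = lf \<chi> (eval_mono pmult \<phi> s')"
  using assms
proof (induction arbitrary: \<chi>)
  case (left s s' w t)
  have "lf (\<lambda>s. \<chi> (Op w s y)) (eval_mono pmult \<phi> s) = lf (\<lambda>s. \<chi> (Op w s y)) (eval_mono pmult \<phi> s')" for y
    by (rule left.IH) (auto intro: left.prems cong.left)
  then show ?case by (simp add: lf_pmult')
next
  case (right t t' w s)
  have "lf (\<lambda>t. \<chi> (Op w y t)) (eval_mono pmult \<phi> t) = lf (\<lambda>t. \<chi> (Op w y t)) (eval_mono pmult \<phi> t')" for y
    by (rule right.IH) (auto intro: right.prems cong.right)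
  then show ?case by (simp add: lf_pmult)
next
  case (assoc w a b c)
  have "\<chi> (Op w (Op w x y) z) = \<chi> (Op w x (Op w y z))" for x y z
    by (rule assoc) (rule cong.assoc)
  then show ?case by (simp add: lf_pmult)
next
  case (inter a b c d)
  have *: "\<chi> (Op Bull (Op Circ x y) (Op Circ z t)) = \<chi> (Op Circ (Op Bull x z) (Op Bull y t))" for x y z t
    by (rule inter) (rule cong.inter)
  \<comment> \<open>The interchange law exchanges its second and third arguments, hence the exchange
    of two summations.\<close>
  have "lf (\<lambda>x. lf (\<lambda>y. lf (\<lambda>z. lf (\<lambda>t. \<chi> (Op Circ (Op Bull x z) (Op Bull y t))) (eval_mono pmult \<phi> d)) (eval_mono pmult \<phi> c)) (eval_mono pmult \<phi> b)) (eval_mono pmult \<phi> a)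
      = lf (\<lambda>x. lf (\<lambda>z. lf (\<lambda>y. lf (\<lambda>t. \<chi> (Op Circ (Op Bull x z) (Op Bull y t))) (eval_mono pmult \<phi> d)) (eval_mono pmult \<phi> b)) (eval_mono pmult \<phi> c)) (eval_mono pmult \<phi> a)"
    by (rule lf_cong) (rule lf_swap)
  then show ?case by (simp add: lf_pmult *)
next
  case (trans s t u)
  show ?case using trans.IH(1)[OF trans.prems] trans.IH(2)[OF trans.prems] by simp
next
  case (sym s t)
  show ?case using sym.IH[OF sym.prems] by simp
qed simp

text \<open>A class function on monomials extends to a linear functional that factors through the
  algebra A, so it annihilates whatever represents zero there.\<close>

lemma aia_ideal_lf:
  assumes "p \<in> aia_ideal" "\<And>s t. cong s t \<Longrightarrow> \<chi> s = \<chi> t"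
  shows "lf \<chi> p = 0"
  using assms unfolding aia_ideal_def
proof (induction arbitrary: \<chi>)
  case (base f)
  have "\<chi> (Op w (Op w a b) c) = \<chi> (Op w a (Op w b c))" for w a b c
    by (rule base.prems) (rule cong.assoc)
  moreover have "\<chi> (Op Bull (Op Circ a b) (Op Circ c d)) = \<chi> (Op Circ (Op Bull a c) (Op Bull b d))" for a b c d
    by (rule base.prems) (rule cong.inter)
  ultimately show ?case using base.hyps by (auto simp: aia_relations_def gen_def lf_diff)
next
  case (sub f \<phi>)
  show ?case unfolding lf_subst
    by (rule sub.IH) (auto intro: cong_eval sub.prems)
next
  case (multl f w g)
  have "lf (\<lambda>t. \<chi> (Op w s t)) f = 0" for s
    by (rule multl.IH) (auto intro: multl.prems cong.right)
  then show ?case by (simp add: lf_pmult) (simp add: lf_def)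
next
  case (multr f w g)
  have "lf (\<lambda>s. \<chi> (Op w s t)) f = 0" for t
    by (rule multr.IH) (auto intro: multr.prems cong.left)
  then show ?case by (simp add: lf_pmult') (simp add: lf_def)
qed (auto simp: lf_add lf_smult)

fun reverse_circ :: "mono \<Rightarrow> mono" where
  "reverse_circ (Var i) = Var i"
| "reverse_circ (Op w s t) = (if w = Circ then Op w (reverse_circ t) (reverse_circ s) else Op w (reverse_circ s) (reverse_circ t))"

fun circ_count :: "mono \<Rightarrow> nat" where
  "circ_count (Var i) = 0"
| "circ_count (Op w s t) = (if w = Circ then 1 else 0) + circ_count s + circ_count t"

text \<open>Reversal reads associativity of \<open>Circ\<close> backwards, and it turns the
  interchange law for a, b, c, d into the one for b, a, d, c.\<close>

lemma cong_reverse_circ: "cong s t \<Longrightarrow> cong (reverse_circ s) (reverse_circ t)"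
proof (induction rule: cong.induct)
  case (assoc w a b c)
  then show ?case by (auto intro: cong.assoc cong.sym[OF cong.assoc])
next
  case (trans s t u)
  then show ?case by (blast intro: cong.trans)
next
  case (sym s t)
  then show ?case by (blast intro: cong.sym)
next
  case (inter a b c d)
  show ?case by (simp add: cong.inter)
qed (auto intro: cong.refl cong.left cong.right)

lemma sumI_reverse_circ: "sumI (\<lambda>m. \<chi> (reverse_circ m)) (expansion s) = (- 1) ^ circ_count s * sumI \<chi> (expansion s)"
proof (induction s arbitrary: \<chi>)
  case (Op w s t)
  define e :: 'a where "e = (if w = Circ then - 1 else 1)"
  have "sumI (\<lambda>m. \<chi> (reverse_circ m)) (expansion (Op w s t))
      = e * sumI (\<lambda>a. sumI (\<lambda>b. \<chi> (Op w (reverse_circ a) (reverse_circ b)) - \<chi> (Op w (reverse_circ b) (reverse_circ a))) (expansion t)) (expansion s)"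
    unfolding sumI_expansion_Op by (simp add: e_def sumI_diff)
  also have "\<dots> = e * sumI (\<lambda>a. (- 1) ^ circ_count t * sumI (\<lambda>b. \<chi> (Op w (reverse_circ a) b) - \<chi> (Op w b (reverse_circ a))) (expansion t)) (expansion s)"
    by (subst Op.IH(2)[of "\<lambda>b. \<chi> (Op w (reverse_circ _) b) - \<chi> (Op w b (reverse_circ _))"]) (rule HOL.refl)
  also have "\<dots> = e * (- 1) ^ circ_count t * (- 1) ^ circ_count s * sumI (\<lambda>a. sumI (\<lambda>b. \<chi> (Op w a b) - \<chi> (Op w b a)) (expansion t)) (expansion s)"
    unfolding sumI_scale
    by (subst Op.IH(1)[of "\<lambda>a. sumI (\<lambda>b. \<chi> (Op w a b) - \<chi> (Op w b a)) (expansion t)"]) (simp add: mult_ac)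
  also have "e * (- 1) ^ circ_count t * (- 1) ^ circ_count s = (- 1 :: 'a) ^ circ_count (Op w s t)"
    by (simp add: e_def power_add)
  finally show ?case unfolding sumI_expansion_Op by simp
qed simp

lemma ec_circ_count: "ec s t \<noteq> 0 \<Longrightarrow> circ_count s = circ_count t"
  by (rule ec_invariant[of circ_count "\<lambda>w x y. (if w = Circ then 1 else 0) + x + y"]) auto

text \<open>Reversing only the products \<^const>\<open>Circ\<close> is an automorphism of the relations which acts on a
  bracket monomial by a sign. Hence an identity splits by the parity of the number of these products.\<close>
lemma bracket_identity_parity:
  fixes f :: "'k::field_char_0 fpoly"
  assumes f: "bracket_identity_in_AIA f" and \<chi>: "\<And>s t. cong s t \<Longrightarrow> \<chi> s = \<chi> t"
  shows "lf (\<lambda>s. if even (circ_count s) = \<beta> then sumI \<chi> (expansion s) else 0) f = 0"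
proof -
  have 0: "lf (\<lambda>s. sumI \<psi> (expansion s)) f = 0" if "\<And>s t. cong s t \<Longrightarrow> \<psi> s = \<psi> t" for \<psi>
    using aia_ideal_lf[of "eval_poly pbrack gen f" \<psi>] f that
    by (simp add: bracket_identity_in_AIA_def lf_eval_poly lf_bracket)
  have 1: "lf (\<lambda>s. sumI \<chi> (expansion s)) f = 0"
    by (rule 0) (rule \<chi>)
  have 2: "lf (\<lambda>s. (- 1) ^ circ_count s * sumI \<chi> (expansion s)) f = 0"
    unfolding sumI_reverse_circ[symmetric] by (rule 0) (auto intro: \<chi> cong_reverse_circ)
  have "2 * lf (\<lambda>s. if even (circ_count s) = \<beta> then sumI \<chi> (expansion s) else 0) f
      = lf (\<lambda>s. 2 * (if even (circ_count s) = \<beta> then sumI \<chi> (expansion s) else 0)) f"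
    by (simp add: lf_scale)
  also have "\<dots> = lf (\<lambda>s. sumI \<chi> (expansion s) - (if \<beta> then - 1 else 1) * ((- 1) ^ circ_count s * sumI \<chi> (expansion s))) f"
    by (rule lf_cong) (cases \<beta>, auto)
  also have "\<dots> = 0"
    by (simp add: lf_fun_diff lf_scale 1 2)
  finally show ?thesis by simp
qed

section \<open>Interchange moves on right combs and finite sets closed under them\<close>

inductive fstep :: "mono \<Rightarrow> mono \<Rightarrow> bool" where
  base: "w \<noteq> u \<Longrightarrow> fstep (app w (app u a b) (app u c d)) (app u (app w a c) (app w b d))"
| left: "fstep s s' \<Longrightarrow> fstep (app w s t) (app w s' t)"
| right: "fstep t t' \<Longrightarrow> fstep (app w s t) (app w s t')"

lemma fstep_sym: "fstep s t \<Longrightarrow> fstep t s"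
  by (induction rule: fstep.induct) (auto intro: fstep.intros)

lemma cong_flat: "cong s t \<Longrightarrow> fstep\<^sup>*\<^sup>* (flat s) (flat t)"
proof (induction rule: cong.induct)
  case (sym s t)
  then show ?case
    by (metis conversep_iff fstep_sym predicate2I rtranclp_conversep rtranclp_mono rev_predicate2D)
next
  case (left s s' w t)
  have "fstep\<^sup>*\<^sup>* (app w (flat s) (flat t)) (app w (flat s') (flat t))"
    using left.IH by (induction rule: rtranclp_induct) (auto intro: fstep.left rtranclp.rtrancl_into_rtrancl)
  then show ?case by simp
next
  case (right t t' w s)
  have "fstep\<^sup>*\<^sup>* (app w (flat s) (flat t)) (app w (flat s) (flat t'))"
    using right.IH by (induction rule: rtranclp_induct) (auto intro: fstep.right rtranclp.rtrancl_into_rtrancl)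
  then show ?case by simp
next
  case (inter a b c d)
  then show ?case by (auto intro!: r_into_rtranclp fstep.base)
qed (auto simp: app_assoc)

fun other :: "oper \<Rightarrow> oper" where
  "other Circ = Bull" | "other Bull = Circ"

lemma other_neq: "w \<noteq> u \<longleftrightarrow> u = other w"
  by (cases w; cases u) auto

definition interchanges :: "oper \<Rightarrow> mono \<Rightarrow> mono \<Rightarrow> mono list" where
  "interchanges w a b = concat (map (\<lambda>(p, q). map (\<lambda>(r, s). app (other w) (app w p r) (app w q s))
     (splits (other w) b)) (splits (other w) a))"

text \<open>All right combs reached by one interchange at any cut of any product. Each descent into
  a factor lowers the number of labels, so fuel equal to the degree suffices.\<close>

fun nbrs :: "nat \<Rightarrow> mono \<Rightarrow> mono list" where
  "nbrs 0 t = []"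
| "nbrs (Suc n) (Var i) = []"
| "nbrs (Suc n) (Op w x y) = concat (map (\<lambda>(a, b). map (\<lambda>a'. app w a' b) (nbrs n a) @
     map (app w a) (nbrs n b) @ interchanges w a b) (splits w (Op w x y)))"

lemma in_concat_map: "(a, b) \<in> set xs \<Longrightarrow> y \<in> set (f a b) \<Longrightarrow> y \<in> set (concat (map (\<lambda>(a, b). f a b) xs))"
  by auto

lemma in_map: "(a, b) \<in> set xs \<Longrightarrow> f a b \<in> set (map (\<lambda>(a, b). f a b) xs)"
  by force

lemma interchanges_app:
  "app (other w) (app w p r) (app w q s) \<in> set (interchanges w (app (other w) p q) (app (other w) r s))"
proof -
  show ?thesis unfolding interchanges_def
    by (intro in_concat_map[OF splits_app] in_map[OF splits_app])
qed

lemma nbrs_app: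
  "set (nbrs (Suc n) (app w s t)) \<supseteq>
    (\<lambda>a'. app w a' t) ` set (nbrs n s) \<union> app w s ` set (nbrs n t) \<union> set (interchanges w s t)"
proof -
  obtain x y where xy: "app w s t = Op w x y"
    using root_is_app[of w w s t] by (cases "app w s t") auto
  have "(s, t) \<in> set (splits w (Op w x y))"
    using splits_app[of s t w] by (simp add: xy)
  then have "set (map (\<lambda>a'. app w a' t) (nbrs n s) @ map (app w s) (nbrs n t) @ interchanges w s t)
      \<subseteq> set (nbrs (Suc n) (Op w x y))"
    unfolding nbrs.simps by (intro subsetI in_concat_map)
  then show ?thesis unfolding xy by simp
qed

lemma fstep_nbrs: "fstep t t' \<Longrightarrow> size (leaves t) \<le> n \<Longrightarrow> t' \<in> set (nbrs n t)"
proof (induction arbitrary: n rule: fstep.induct)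
  case (base w u a b c d)
  then obtain m where n: "n = Suc m" by (cases n) auto
  have u: "u = other w" using base by (simp add: other_neq)
  show ?case unfolding n u using nbrs_app interchanges_app by (intro subsetD[OF nbrs_app] UnI2)
next
  case (left s s' w t)
  then obtain m where n: "n = Suc m" by (cases n) auto
  have "size (leaves t) > 0" by (simp add: nonempty_has_size[symmetric])
  then have "s' \<in> set (nbrs m s)" using left n by auto
  then show ?case unfolding n using nbrs_app[where w=w and s=s and t=t and n=m] by blast
next
  case (right t t' w s)
  then obtain m where n: "n = Suc m" by (cases n) auto
  have "size (leaves s) > 0" by (simp add: nonempty_has_size[symmetric])
  then have "t' \<in> set (nbrs m t)" using right n by auto
  then show ?case unfolding n using nbrs_app[where w=w and s=s and t=t and n=m] by blast
qed

fun relabel :: "(nat \<Rightarrow> nat) \<Rightarrow> mono \<Rightarrow> mono" where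
  "relabel \<pi> (Var i) = Var (\<pi> i)"
| "relabel \<pi> (Op w s t) = Op w (relabel \<pi> s) (relabel \<pi> t)"

lemma relabel_app: "relabel \<pi> (app w s t) = app w (relabel \<pi> s) (relabel \<pi> t)"
  by (induction s) auto

lemma root_is_relabel [simp]: "root_is w (relabel \<pi> t) = root_is w t"
  by (cases t) auto

lemma right_comb_relabel [simp]: "right_comb (relabel \<pi> t) = right_comb t"
  by (induction t) auto

lemma circ_count_relabel [simp]: "circ_count (relabel \<pi> t) = circ_count t"
  by (induction t) auto

lemma leaves_relabel: "leaves (relabel \<pi> t) = image_mset \<pi> (leaves t)"
  by (induction t) auto

lemma splits_relabel: "splits w (relabel \<pi> t) = map (\<lambda>(a, b). (relabel \<pi> a, relabel \<pi> b)) (splits w t)"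
  by (induction t) auto

text \<open>Interchanges see only the shape, so a list checked for the labels 0 to 5 serves for
  every choice of six distinct labels.\<close>

lemma nbrs_relabel: "nbrs n (relabel \<pi> t) = map (relabel \<pi>) (nbrs n t)"
proof (induction n t rule: nbrs.induct)
  case (3 n w x y)
  have int: "interchanges w (relabel \<pi> a) (relabel \<pi> b) = map (relabel \<pi>) (interchanges w a b)" for a b
    by (simp add: interchanges_def splits_relabel relabel_app map_concat o_def case_prod_unfold)
  show ?case
    unfolding relabel.simps nbrs.simps splits_relabel[of _ _ "Op w x y", unfolded relabel.simps] map_concat map_map
    by (intro arg_cong[of _ _ concat] map_cong HOL.refl)
       (auto simp: 3 relabel_app int o_def simp del: splits.simps)
qed auto

lemma relabel_inj: "inj_on \<pi> A \<Longrightarrow> set_mset (leaves s) \<subseteq> A \<Longrightarrow> set_mset (leaves t) \<subseteq> A \<Longrightarrow> relabel \<pi> s = relabel \<pi> t \<Longrightarrow> s = t"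
proof (induction s arbitrary: t)
  case (Var i)
  then show ?case by (cases t) (auto dest: inj_onD)
next
  case (Op w s1 s2)
  then show ?case by (cases t) auto
qed

fun labels_lt :: "nat \<Rightarrow> mono \<Rightarrow> bool" where
  "labels_lt n (Var i) = (i < n)"
| "labels_lt n (Op w s t) = (labels_lt n s \<and> labels_lt n t)"

lemma labels_lt: "labels_lt n t \<longleftrightarrow> set_mset (leaves t) \<subseteq> {..<n}"
  by (induction t) auto

fun deg :: "mono \<Rightarrow> nat" where
  "deg (Var i) = 1"
| "deg (Op w s t) = deg s + deg t"

lemma size_leaves: "size (leaves t) = deg t"
  by (induction t) auto

text \<open>Closure under interchange is tested, so such a list is a union of classes. The bound on
  the degree makes the fuel 6 sufficient, and labels below 6 admit relabelling by any function
  injective there.\<close>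

definition is_class :: "mono list \<Rightarrow> bool" where
  "is_class C \<longleftrightarrow> distinct C \<and>
     list_all (\<lambda>t. right_comb t \<and> labels_lt 6 t \<and> deg t \<le> 6 \<and> list_all (\<lambda>t'. t' \<in> set C) (nbrs 6 t)) C"

lemma sumI_sum: "sumI (\<lambda>m. \<Sum>x\<in>A. g x m) xs = (\<Sum>x\<in>A. sumI (g x) xs)"
  by (induction A rule: infinite_finite_induct) (auto simp: sumI_add)

text \<open>The indicator function of the relabelled list is constant on congruence classes, hence a
  functional on A. Its value on the identity is the sum of the coefficients over the list, and
  \<open>bracket_identity_parity\<close> restricts that sum to one parity.\<close>

lemma class_sum:
  fixes f :: "'k::field_char_0 fpoly"
  assumes f: "bracket_identity_in_AIA f" and C: "is_class C" and \<pi>: "inj_on \<pi> {..<6}"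
  shows "(\<Sum>t\<leftarrow>filter (\<lambda>t. even (circ_count t) = \<beta>) C. coef (relabel \<pi> t) f) = 0"
proof -
  have C': "distinct C" "\<And>t. t \<in> set C \<Longrightarrow> right_comb t" "\<And>t. t \<in> set C \<Longrightarrow> set_mset (leaves t) \<subseteq> {..<6}"
    "\<And>t. t \<in> set C \<Longrightarrow> size (leaves t) \<le> 6" "\<And>t t'. t \<in> set C \<Longrightarrow> t' \<in> set (nbrs 6 t) \<Longrightarrow> t' \<in> set C"
    using C by (auto simp: is_class_def list_all_iff labels_lt size_leaves)
  have inj: "inj_on (relabel \<pi>) (set C)"
    using relabel_inj[OF \<pi>] C'(3) by (auto intro!: inj_onI)
  let ?D = "relabel \<pi> ` set C"
  define \<chi> :: "mono \<Rightarrow> 'k" where "\<chi> = (\<lambda>m. \<Sum>t\<in>?D. of_bool (flat m = t))"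
  have step: "t' \<in> ?D" if "t \<in> ?D" "fstep t t'" for t t'
  proof -
    from that(1) obtain s where s: "s \<in> set C" "t = relabel \<pi> s" by auto
    then have "t' \<in> set (nbrs 6 t)"
      using fstep_nbrs[OF that(2), of 6] C'(4)[OF s(1)] by (simp add: leaves_relabel)
    then show ?thesis using C'(5)[OF s(1)] by (auto simp: s(2) nbrs_relabel)
  qed
  have steps: "t' \<in> ?D" if "fstep\<^sup>*\<^sup>* t t'" "t \<in> ?D" for t t'
    using that by (induction rule: rtranclp_induct) (auto intro: step)
  have \<chi>: "\<chi> s = \<chi> t" if "cong s t" for s t
  proof -
    have "flat s \<in> ?D \<longleftrightarrow> flat t \<in> ?D"
      using steps cong_flat[OF that] cong_flat[OF cong.sym[OF that]] by blast
    then show ?thesis by (simp add: \<chi>_def of_bool_def)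
  qed
  have "sumI \<chi> (expansion s) = (\<Sum>t\<in>?D. of_int (ec s t))" for s
  proof -
    have "sumI \<chi> (expansion s) = (\<Sum>t\<in>?D. sumI (\<lambda>m. of_bool (flat m = t)) (expansion s))"
      unfolding \<chi>_def by (rule sumI_sum)
    also have "\<dots> = (\<Sum>t\<in>?D. of_int (ec s t))"
      by (rule sum.cong) (auto simp: ec_eq_sumI C'(2))
    finally show ?thesis .
  qed
  then have "0 = lf (\<lambda>s. if even (circ_count s) = \<beta> then \<Sum>t\<in>?D. of_int (ec s t) else 0) f"
    using bracket_identity_parity[OF f, of \<chi> \<beta>] \<chi> by (simp cong: if_cong)
  also have "\<dots> = lf (\<lambda>s. \<Sum>t\<in>?D. if even (circ_count t) = \<beta> then of_int (ec s t) else 0) f"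
  proof (rule lf_cong)
    fix s
    \<comment> \<open>All combs in the expansion of \<open>s\<close> have as many
      \<open>Circ\<close> products as \<open>s\<close>, so the parity condition moves from the
      bracket to the comb.\<close>
    have *: "(if even (circ_count s) = \<beta> then of_int (ec s t) else 0 :: 'k) = (if even (circ_count t) = \<beta> then of_int (ec s t) else 0)" for t
      using ec_circ_count[of s t] by (cases "ec s t = 0") auto
    have "(if even (circ_count s) = \<beta> then \<Sum>t\<in>?D. of_int (ec s t) else 0 :: 'k)
        = (\<Sum>t\<in>?D. if even (circ_count s) = \<beta> then of_int (ec s t) else 0)" by simp
    then show "(if even (circ_count s) = \<beta> then \<Sum>t\<in>?D. of_int (ec s t) else 0 :: 'k)
        = (\<Sum>t\<in>?D. if even (circ_count t) = \<beta> then of_int (ec s t) else 0)"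
      unfolding * .
  qed
  also have "\<dots> = (\<Sum>t\<in>?D. if even (circ_count t) = \<beta> then coef t f else 0)"
    unfolding lf_const_sum by (rule sum.cong) (auto simp: lf_def coef_def)
  also have "\<dots> = (\<Sum>t\<in>set C. if even (circ_count t) = \<beta> then coef (relabel \<pi> t) f else 0)"
    by (simp add: sum.reindex[OF inj])
  also have "\<dots> = (\<Sum>t\<in>{t\<in>set C. even (circ_count t) = \<beta>}. coef (relabel \<pi> t) f)"
    by (simp add: sum.inter_filter)
  also have "\<dots> = (\<Sum>t\<leftarrow>filter (\<lambda>t. even (circ_count t) = \<beta>) C. coef (relabel \<pi> t) f)"
    using C'(1) by (simp add: sum_list_distinct_conv_sum_set)
  finally show ?thesis by simp
qed

section \<open>Shuffle relations and shapes\<close>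

definition eqc :: "int \<Rightarrow> mono \<Rightarrow> mono \<Rightarrow> bool" where
  "eqc c t t' \<longleftrightarrow> (\<forall>s. ec s t = c * ec s t')"

lemma coef_eqc: "eqc c t t' \<Longrightarrow> coef t f = of_int c * coef t' f"
  by (simp add: coef_def eqc_def lf_scale)

lemma eqc_refl: "eqc 1 t t"
  by (simp add: eqc_def)

lemma eqc_trans: "eqc c s t \<Longrightarrow> eqc d t u \<Longrightarrow> eqc (c * d) s u"
  by (simp add: eqc_def)

lemma splits_not_root [simp]: "\<not> root_is w t \<Longrightarrow> splits w t = []"
  by (cases t) auto

lemma ec_2:
  assumes "\<not> root_is w x" "\<not> root_is w y"
  shows "ec (Op v s1 s2) (Op w x y) = (if v = w then ec s1 x * ec s2 y - ec s1 y * ec s2 x else 0)"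
  using assms by auto

lemma ec_3:
  assumes "\<not> root_is w x" "\<not> root_is w y" "\<not> root_is w z"
  shows "ec (Op v s1 s2) (Op w x (Op w y z)) = (if v = w then ec s1 x * ec s2 (Op w y z) - ec s1 (Op w y z) * ec s2 x
     + ec s1 (Op w x y) * ec s2 z - ec s1 z * ec s2 (Op w x y) else 0)"
  using assms by auto

lemma eqc_swap: "\<not> root_is w x \<Longrightarrow> \<not> root_is w y \<Longrightarrow> eqc (- 1) (Op w x y) (Op w y x)"
  unfolding eqc_def
proof
  fix s show "\<not> root_is w x \<Longrightarrow> \<not> root_is w y \<Longrightarrow> ec s (Op w x y) = - 1 * ec s (Op w y x)"
    by (cases s) (auto simp: ec_2 simp del: splits.simps ec.simps(2))
qed

lemma ec_swap: "\<not> root_is w x \<Longrightarrow> \<not> root_is w y \<Longrightarrow> ec s (Op w x y) = - ec s (Op w y x)"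
  using eqc_swap[of w x y] by (simp add: eqc_def)

text \<open>Reversing a word of n factors multiplies its coefficient in a Lie element by (- 1)^(n -
  1); n is 3 here and 2 in \<open>eqc_swap\<close>.\<close>

lemma eqc_rev3:
  assumes "\<not> root_is w x" "\<not> root_is w y" "\<not> root_is w z"
  shows "eqc 1 (Op w x (Op w y z)) (Op w z (Op w y x))"
  unfolding eqc_def
proof
  fix s show "ec s (Op w x (Op w y z)) = 1 * ec s (Op w z (Op w y x))"
    using assms ec_swap[of w y x] ec_swap[of w z y]
    by (cases s) (auto simp: ec_3 simp del: splits.simps ec.simps(2))
qed

text \<open>Lie elements are orthogonal to shuffles of nonempty words. The sum runs over the shuffle
  of the letter \<open>x\<close> with the word formed by \<open>y\<close> and
  \<open>z\<close>.\<close>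

lemma ec_shuffle:
  assumes "\<not> root_is w x" "\<not> root_is w y" "\<not> root_is w z"
  shows "ec s (Op w x (Op w y z)) + ec s (Op w y (Op w x z)) + ec s (Op w y (Op w z x)) = 0"
  using assms ec_swap[of w y x] ec_swap[of w z x]
  by (cases s) (auto simp: ec_3 algebra_simps simp del: splits.simps ec.simps(2))

lemma eqc_2:
  assumes "\<not> root_is w x" "\<not> root_is w y" "\<not> root_is w x'" "\<not> root_is w y'" "eqc c x x'" "eqc d y y'"
  shows "eqc (c * d) (Op w x y) (Op w x' y')"
  unfolding eqc_def
proof
  fix s show "ec s (Op w x y) = c * d * ec s (Op w x' y')"
    using assms by (cases s) (auto simp: ec_2 eqc_def algebra_simps simp del: splits.simps ec.simps(2))
qed

lemma eqc_3:
  assumes "\<not> root_is w x" "\<not> root_is w y" "\<not> root_is w z" "\<not> root_is w x'" "\<not> root_is w y'" "\<not> root_is w z'"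
    and "eqc c x x'" "eqc d y y'" "eqc e z z'"
  shows "eqc (c * d * e) (Op w x (Op w y z)) (Op w x' (Op w y' z'))"
  unfolding eqc_def
proof
  have "ec s (Op w y z) = d * e * ec s (Op w y' z')" "ec s (Op w x y) = c * d * ec s (Op w x' y')" for s
    using eqc_2[of w y z y' z' d e] eqc_2[of w x y x' y' c d] assms by (auto simp: eqc_def)
  then show "ec s (Op w x (Op w y z)) = c * d * e * ec s (Op w x' (Op w y' z'))" for s
    using assms by (cases s) (auto simp: ec_3 eqc_def algebra_simps simp del: splits.simps ec.simps(2))
qed

definition ec_sum3 :: "mono \<Rightarrow> mono \<Rightarrow> mono \<Rightarrow> bool" where
  "ec_sum3 t1 t2 t3 \<longleftrightarrow> (\<forall>s. ec s t1 + ec s t2 + ec s t3 = 0)"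

lemma ec_sum3_shuffle:
  "\<not> root_is w x \<Longrightarrow> \<not> root_is w y \<Longrightarrow> \<not> root_is w z \<Longrightarrow>
    ec_sum3 (Op w x (Op w y z)) (Op w y (Op w x z)) (Op w y (Op w z x))"
  by (simp only: ec_sum3_def ec_shuffle not_False_eq_True simp_thms)

lemma ec_sum3_context:
  assumes "\<not> root_is w x" "\<not> root_is w t1" "\<not> root_is w t2" "\<not> root_is w t3" "ec_sum3 t1 t2 t3"
  shows "ec_sum3 (Op w x t1) (Op w x t2) (Op w x t3)"
  unfolding ec_sum3_def
proof
  fix s
  show "ec s (Op w x t1) + ec s (Op w x t2) + ec s (Op w x t3) = 0"
  proof (cases s)
    case (Op v s1 s2)
    have *: "ec s t1 = - ec s t2 - ec s t3" for s
      using assms(5) by (auto simp: ec_sum3_def algebra_simps eq_neg_iff_add_eq_0)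
    show ?thesis using assms(1-4)
      by (simp add: Op ec_2 * algebra_simps del: splits.simps ec.simps(2))
  qed simp
qed

lemma coef_sum3: "ec_sum3 t1 t2 t3 \<Longrightarrow> coef t1 f + coef t2 f + coef t3 f = 0"
proof -
  assume *: "ec_sum3 t1 t2 t3"
  have "coef t1 f + coef t2 f + coef t3 f = lf (\<lambda>s. of_int (ec s t1 + ec s t2 + ec s t3)) f"
    by (simp add: coef_def lf_def sum.distrib algebra_simps)
  also have "\<dots> = 0"
    unfolding *[unfolded ec_sum3_def, rule_format] by (simp add: lf_def)
  finally show ?thesis .
qed

text \<open>The variants of a right comb obtained by reversing products with two or three factors.\<close>
fun revs :: "mono \<Rightarrow> mono list" where
  "revs (Var i) = [Var i]"
| "revs (Op w x (Var i)) = concat (map (\<lambda>x'. [Op w x' (Var i), Op w (Var i) x']) (revs x))"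
| "revs (Op w x (Op v y z)) =
    (if v = w then if root_is w z then [Op w x (Op v y z)]
       else concat (map (\<lambda>x'. concat (map (\<lambda>y'. concat (map (\<lambda>z'.
         [Op w x' (Op w y' z'), Op w z' (Op w y' x')]) (revs z))) (revs y))) (revs x))
     else concat (map (\<lambda>x'. concat (map (\<lambda>y'. [Op w x' y', Op w y' x']) (revs (Op v y z)))) (revs x)))"

lemma root_revs: "t' \<in> set (revs t) \<Longrightarrow> root_is w t' = root_is w t"
  by (induction t rule: revs.induct) (auto split: if_splits)

lemma revs_eqc: "right_comb t \<Longrightarrow> t' \<in> set (revs t) \<Longrightarrow> eqc 1 t t' \<or> eqc (- 1) t t'"
proof (induction t arbitrary: t' rule: revs.induct)
  case (1 i)
  then show ?case by (simp add: eqc_refl)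
next
  case (2 w x i)
  then obtain x' where x': "x' \<in> set (revs x)" "t' = Op w x' (Var i) \<or> t' = Op w (Var i) x'" by auto
  have r: "\<not> root_is w x'" "\<not> root_is w x" using 2 root_revs[OF x'(1)] by auto
  obtain c where c: "eqc c x x'" "c = 1 \<or> c = -1" using 2 x'(1) by auto
  have a: "eqc c (Op w x (Var i)) (Op w x' (Var i))"
    using eqc_2[OF r(2) _ r(1) _ c(1) eqc_refl[of "Var i"]] by simp
  have b: "eqc (- c) (Op w x (Var i)) (Op w (Var i) x')"
    using eqc_trans[OF a eqc_swap[OF r(1)]] by simp
  show ?case using a b c x' by auto
next
  case (3 w x v y z)
  show ?case
  proof (cases "v = w")
    case v: True
    show ?thesis
    proof (cases "root_is w z")
      case True
      then show ?thesis using 3 v by (auto simp: eqc_refl)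
    next
      case False
      then obtain x' y' z' where m: "x' \<in> set (revs x)" "y' \<in> set (revs y)" "z' \<in> set (revs z)"
        and t': "t' = Op w x' (Op w y' z') \<or> t' = Op w z' (Op w y' x')" using 3(7) v by auto
      have r: "\<not> root_is w x" "\<not> root_is w y" "\<not> root_is w z" "\<not> root_is w x'" "\<not> root_is w y'" "\<not> root_is w z'"
        using 3(6) v False root_revs m by auto
      obtain c where c: "eqc c x x'" "c = 1 \<or> c = -1" using 3(1)[OF v False _ m(1)] 3(6) by auto
      obtain d where d: "eqc d y y'" "d = 1 \<or> d = -1" using 3(2)[OF v False m(1) _ m(2)] 3(6) by auto
      obtain e where e: "eqc e z z'" "e = 1 \<or> e = -1" using 3(3)[OF v False m(1,2) _ m(3)] 3(6) by auto
      have a: "eqc (c * d * e) (Op w x (Op w y z)) (Op w x' (Op w y' z'))"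
        by (rule eqc_3[OF r c(1) d(1) e(1)])
      have b: "eqc (c * d * e) (Op w x (Op w y z)) (Op w z' (Op w y' x'))"
        using eqc_trans[OF a eqc_rev3[OF r(4-6)]] by simp
      show ?thesis using a b c(2) d(2) e(2) t' v by auto
    qed
  next
    case False
    then obtain x' y' where m: "x' \<in> set (revs x)" "y' \<in> set (revs (Op v y z))"
      and t': "t' = Op w x' y' \<or> t' = Op w y' x'" using 3(7) False by auto
    have r: "\<not> root_is w x" "\<not> root_is w (Op v y z)" "\<not> root_is w x'" "\<not> root_is w y'"
      using 3(6) False root_revs[OF m(1)] root_revs[OF m(2)] by auto
    obtain c where c: "eqc c x x'" "c = 1 \<or> c = -1" using 3(4)[OF False _ m(1)] 3(6) by auto
    obtain d where d: "eqc d (Op v y z) y'" "d = 1 \<or> d = -1" using 3(5)[OF False m(1) _ m(2)] 3(6) by auto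
    have a: "eqc (c * d) (Op w x (Op v y z)) (Op w x' y')"
      by (rule eqc_2[OF r c(1) d(1)])
    have b: "eqc (- (c * d)) (Op w x (Op v y z)) (Op w y' x')"
      using eqc_trans[OF a eqc_swap[OF r(3,4)]] by simp
    show ?thesis using a b c(2) d(2) t' by auto
  qed
qed

lemma coef_revs: "right_comb t \<Longrightarrow> t' \<in> set (revs t) \<Longrightarrow> coef t' f = 0 \<Longrightarrow> coef t f = 0"
  using revs_eqc[of t t'] coef_eqc[of _ t t' f] by auto

section \<open>Shapes of right combs and their enumeration\<close>

fun labels :: "mono \<Rightarrow> nat list" where
  "labels (Var i) = [i]"
| "labels (Op w s t) = labels s @ labels t"

lemma mset_labels: "mset (labels t) = leaves t"
  by (induction t) auto

lemma length_labels: "length (labels t) = deg t"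
  by (induction t) auto

abbreviation skel :: "mono \<Rightarrow> mono" where
  "skel \<equiv> relabel (\<lambda>_. 0)"

lemma relabel_relabel [simp]: "relabel \<pi> (relabel \<rho> t) = relabel (\<lambda>i. \<pi> (\<rho> i)) t"
  by (induction t) auto

lemma labels_relabel [simp]: "labels (relabel \<pi> t) = map \<pi> (labels t)"
  by (induction t) auto

lemma skel_eq_labels_eq: "skel s = skel t \<Longrightarrow> labels s = labels t \<Longrightarrow> s = t"
proof (induction s arbitrary: t)
  case (Op w s1 s2)
  then obtain t1 t2 where t: "t = Op w t1 t2" "skel s1 = skel t1" "skel s2 = skel t2"
    by (cases t) auto
  have "length (labels s1) = length (labels t1)"
    using arg_cong[OF t(2), of "\<lambda>t. length (labels t)"] by simp
  then show ?case using Op.IH t Op.prems(2) by simp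
next
  case (Var i)
  then show ?case by (cases t) auto
qed

lemma skel_relabel:
  assumes "skel s = skel t" "labels t = [0..<n]"
  shows "s = relabel (\<lambda>i. labels s ! i) t"
proof -
  have "length (labels s) = length (labels t)"
    using arg_cong[OF assms(1), of "\<lambda>t. length (labels t)"] by simp
  then have "labels (relabel (\<lambda>i. labels s ! i) t) = labels s"
    using map_nth[of "labels s"] by (simp add: assms(2))
  then have l: "labels s = labels (relabel (\<lambda>i. labels s ! i) t)" by (rule HOL.sym)
  have k: "skel s = skel (relabel (\<lambda>i. labels s ! i) t)" unfolding relabel_relabel by (rule assms(1))
  show ?thesis by (rule skel_eq_labels_eq[OF k l])
qed

text \<open>One right comb for each shape with \<open>n\<close> labels, numbered consecutively from
  \<open>k\<close> left to right; \<open>m\<close> bounds the recursion depth.\<close>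

fun combs :: "nat \<Rightarrow> nat \<Rightarrow> nat \<Rightarrow> mono list" where
  "combs 0 k n = []"
| "combs (Suc m) k n = (if n = 1 then [Var k] else
    concat (map (\<lambda>w. concat (map (\<lambda>i. concat (map (\<lambda>x. map (Op w x) (combs m (k + i) (n - i)))
      (filter (\<lambda>x. \<not> root_is w x) (combs m k i)))) [1..<n])) [Circ, Bull]))"

lemma deg_pos: "deg t > 0"
  by (induction t) auto

lemma combs_complete:
  "right_comb t \<Longrightarrow> deg t \<le> m \<Longrightarrow> \<exists>s \<in> set (combs m k (deg t)). labels s = [k..<k + deg t] \<and> skel s = skel t"
proof (induction t arbitrary: m k)
  case (Var i)
  then obtain m' where "m = Suc m'" by (cases m) auto
  then show ?case by simp
next
  case (Op w x y)
  note pos = deg_pos[of x] deg_pos[of y]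
  obtain m' where m: "m = Suc m'" using Op.prems pos by (cases m) auto
  obtain x' where x': "x' \<in> set (combs m' k (deg x))" "labels x' = [k..<k + deg x]" "skel x' = skel x"
    using Op.IH(1)[of m' k] Op.prems m pos by auto
  obtain y' where y': "y' \<in> set (combs m' (k + deg x) (deg y))" "labels y' = [k + deg x..<k + deg x + deg y]" "skel y' = skel y"
    using Op.IH(2)[of m' "k + deg x"] Op.prems m pos by auto
  have "root_is w (skel x') = root_is w (skel x)" by (simp only: x')
  then have "\<not> root_is w x'" using Op.prems by simp
  then have "Op w x' y' \<in> set (combs m k (deg x + deg y))"
    using x'(1) y'(1) pos by (cases w) (auto simp: m intro!: bexI[of _ "deg x"])
  moreover have "labels (Op w x' y') = [k..<k + deg (Op w x y)]"
    using x'(2) y'(2) upt_add_eq_append[of k "k + deg x" "deg y"] by (simp add: add.assoc)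
  ultimately show ?case using x'(3) y'(3) by (intro bexI[of _ "Op w x' y'"]) auto
qed

text \<open>The number of steps 50 is large enough for degree 6; \<^const>\<open>is_class\<close> in \<open>isolated\<close> checks that
  the closure is complete.\<close>
fun class_closure :: "nat \<Rightarrow> mono list \<Rightarrow> mono list \<Rightarrow> mono list" where
  "class_closure 0 seen ts = seen"
| "class_closure (Suc n) seen [] = seen"
| "class_closure (Suc n) seen (t # ts) =
    (if t \<in> set seen then class_closure n seen ts else class_closure n (seen @ [t]) (nbrs 6 t @ ts))"

text \<open>For such a comb the class sum in its parity part is a single coefficient, which
  therefore vanishes in every identity.\<close>

definition isolated :: "mono \<Rightarrow> bool" where
  "isolated t \<longleftrightarrow> (let C = class_closure 50 [] [t] in is_class C \<and> filter (\<lambda>s. even (circ_count s) = even (circ_count t)) C = [t])"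

lemma isolated_coef:
  fixes f :: "'k::field_char_0 fpoly"
  assumes "bracket_identity_in_AIA f" "isolated t" "inj_on \<pi> {..<6}"
  shows "coef (relabel \<pi> t) f = 0"
  using class_sum[OF assms(1) _ assms(3), of "class_closure 50 [] [t]" "even (circ_count t)"] assms(2)
  by (auto simp: isolated_def Let_def)

section \<open>Class sums in degree 6\<close>

lemma inj_on_nth6: "distinct [a, b, c, d, e, f] \<Longrightarrow> inj_on ((!) [a, b, c, d, e, f]) {..<6}"
  by (rule inj_on_nth) auto

lemmas class_sum6 = class_sum[OF _ _ inj_on_nth6]

text \<open>In this and the following lemmas \<open>?C\<close> lists combs closed under interchange,
  with the labels 0 to 5 standing for \<open>a\<close> to \<open>f\<close>. Here the stated sum runs
  over the members with three products \<open>w\<close>; the other members have two.\<close>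

lemma class_E3:
  assumes "bracket_identity_in_AIA P" "w \<noteq> u" "distinct [a, b, c, d, e, f]"
  shows "coef (Op u (Op w (Var a) (Var d)) (Op w (Var b) (Op w (Var c) (Op u (Var e) (Var f))))) P + coef (Op u (Op w (Var a) (Op u (Var d) (Var e))) (Op w (Var b) (Op w (Var c) (Var f)))) P + coef (Op u (Op w (Var a) (Var d)) (Op w (Var b) (Op u (Var e) (Op w (Var c) (Var f))))) P = (0 :: 'k::field_char_0)"
proof -
  let ?C = "\<lambda>w u. [(Op u (Op w (Var 0) (Var 3)) (Op w (Var 1) (Op w (Var 2) (Op u (Var 4) (Var 5))))),
    (Op w (Op u (Var 0) (Op w (Var 1) (Var 2))) (Op u (Var 3) (Op u (Var 4) (Var 5)))),
    (Op w (Op u (Var 0) (Var 1)) (Op u (Var 3) (Op w (Var 2) (Op u (Var 4) (Var 5))))),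
    (Op w (Op u (Var 0) (Var 1)) (Op u (Var 3) (Op u (Var 4) (Op w (Var 2) (Var 5))))),
    (Op u (Op w (Var 0) (Op u (Var 3) (Var 4))) (Op w (Var 1) (Op w (Var 2) (Var 5)))),
    (Op u (Op w (Var 0) (Var 3)) (Op w (Var 1) (Op u (Var 4) (Op w (Var 2) (Var 5)))))]"
  have "is_class (?C Circ Bull)" "is_class (?C Bull Circ)" by code_simp+
  \<comment> \<open>Both parities are taken: the part with three products \<open>w\<close> has an
    odd number of \<open>Circ\<close> if \<open>w\<close> is \<open>Circ\<close>, and two of them if
    \<open>w\<close> is \<open>Bull\<close>.\<close>
  note this[THEN class_sum6[OF assms(1) _ assms(3)], of True]
    this[THEN class_sum6[OF assms(1) _ assms(3)], of False]
  then show ?thesis using assms(2) by (cases w; cases u) (simp_all add: add_ac)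
qed

text \<open>The comb is alone in its parity part. It occurs as one term of a shuffle in
  \<open>g2_34\<close>, whose antisymmetry depends on its vanishing.\<close>

lemma class_mid:
  assumes "bracket_identity_in_AIA P" "w \<noteq> u" "distinct [a, b, c, d, e, f]"
  shows "coef (Op u (Op w (Var a) (Var b)) (Op w (Var c) (Op w (Op u (Var d) (Var e)) (Var f)))) P = (0 :: 'k::field_char_0)"
proof -
  let ?C = "\<lambda>w u. [(Op u (Op w (Var 0) (Var 1)) (Op w (Var 2) (Op w (Op u (Var 3) (Var 4)) (Var 5)))),
    (Op w (Op u (Var 0) (Op w (Var 2) (Op u (Var 3) (Var 4)))) (Op u (Var 1) (Var 5))),
    (Op w (Op u (Var 0) (Var 2)) (Op u (Var 1) (Op w (Op u (Var 3) (Var 4)) (Var 5))))]"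
  have "is_class (?C Circ Bull)" "is_class (?C Bull Circ)" by code_simp+
  note this[THEN class_sum6[OF assms(1) _ assms(3)], of True]
    this[THEN class_sum6[OF assms(1) _ assms(3)], of False]
  then show ?thesis using assms(2) by (cases w; cases u) (simp_all add: add_ac)
qed

lemma class_E2:
  assumes "bracket_identity_in_AIA P" "w \<noteq> u" "distinct [a, b, c, d, e, f]"
  shows "coef (Op u (Op w (Var a) (Var c)) (Op w (Var b) (Op u (Var d) (Op u (Var e) (Var f))))) P + coef (Op u (Op w (Var a) (Op u (Var c) (Var d))) (Op w (Var b) (Op u (Var e) (Var f)))) P + coef (Op u (Op w (Var a) (Op u (Var c) (Op u (Var d) (Var e)))) (Op w (Var b) (Var f))) P = (0 :: 'k::field_char_0)"
proof -
  let ?C = "\<lambda>w u. [(Op u (Op w (Var 0) (Var 2)) (Op w (Var 1) (Op u (Var 3) (Op u (Var 4) (Var 5))))),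
    (Op w (Op u (Var 0) (Var 1)) (Op u (Var 2) (Op u (Var 3) (Op u (Var 4) (Var 5))))),
    (Op u (Op w (Var 0) (Op u (Var 2) (Var 3))) (Op w (Var 1) (Op u (Var 4) (Var 5)))),
    (Op u (Op w (Var 0) (Op u (Var 2) (Op u (Var 3) (Var 4)))) (Op w (Var 1) (Var 5)))]"
  have "is_class (?C Circ Bull)" "is_class (?C Bull Circ)" by code_simp+
  note this[THEN class_sum6[OF assms(1) _ assms(3)], of True]
    this[THEN class_sum6[OF assms(1) _ assms(3)], of False]
  then show ?thesis using assms(2) by (cases w; cases u) (simp_all add: add_ac)
qed

lemma class_E4:
  assumes "bracket_identity_in_AIA P" "w \<noteq> u" "distinct [a, b, c, d, e, f]"
  shows "coef (Op u (Op w (Var a) (Var c)) (Op w (Var b) (Op u (Op w (Var d) (Var e)) (Var f)))) P + coef (Op u (Op w (Var a) (Op u (Var c) (Op w (Var d) (Var e)))) (Op w (Var b) (Var f))) P = (0 :: 'k::field_char_0)"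
proof -
  let ?C = "\<lambda>w u. [(Op u (Op w (Var 0) (Var 2)) (Op w (Var 1) (Op u (Op w (Var 3) (Var 4)) (Var 5)))),
    (Op w (Op u (Var 0) (Var 1)) (Op u (Var 2) (Op u (Op w (Var 3) (Var 4)) (Var 5)))),
    (Op u (Op w (Var 0) (Op u (Var 2) (Op w (Var 3) (Var 4)))) (Op w (Var 1) (Var 5)))]"
  have "is_class (?C Circ Bull)" "is_class (?C Bull Circ)" by code_simp+
  note this[THEN class_sum6[OF assms(1) _ assms(3)], of True]
    this[THEN class_sum6[OF assms(1) _ assms(3)], of False]
  then show ?thesis using assms(2) by (cases w; cases u) (simp_all add: add_ac)
qed

lemma class_E10:
  assumes "bracket_identity_in_AIA P" "w \<noteq> u" "distinct [a, b, c, d, e, f]"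
  shows "coef (Op u (Op w (Var a) (Var d)) (Op w (Op u (Var b) (Var c)) (Op u (Var e) (Var f)))) P + coef (Op u (Op w (Op u (Var a) (Var b)) (Op u (Var d) (Var e))) (Op w (Var c) (Var f))) P + coef (Op u (Op w (Op u (Var a) (Var b)) (Var d)) (Op w (Var c) (Op u (Var e) (Var f)))) P + coef (Op u (Op w (Var a) (Op u (Var d) (Var e))) (Op w (Op u (Var b) (Var c)) (Var f))) P = (0 :: 'k::field_char_0)"
proof -
  let ?C = "\<lambda>w u. [(Op u (Op w (Var 0) (Var 3)) (Op w (Op u (Var 1) (Var 2)) (Op u (Var 4) (Var 5)))),
    (Op w (Op u (Var 0) (Op u (Var 1) (Var 2))) (Op u (Var 3) (Op u (Var 4) (Var 5)))),
    (Op u (Op w (Op u (Var 0) (Var 1)) (Op u (Var 3) (Var 4))) (Op w (Var 2) (Var 5))),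
    (Op u (Op w (Op u (Var 0) (Var 1)) (Var 3)) (Op w (Var 2) (Op u (Var 4) (Var 5)))),
    (Op u (Op w (Var 0) (Op u (Var 3) (Var 4))) (Op w (Op u (Var 1) (Var 2)) (Var 5))),
    (Op u (Op w (Var 0) (Var 3)) (Op u (Op w (Var 1) (Var 4)) (Op w (Var 2) (Var 5))))]"
  have "is_class (?C Circ Bull)" "is_class (?C Bull Circ)" by code_simp+
  note this[THEN class_sum6[OF assms(1) _ assms(3)], of True]
    this[THEN class_sum6[OF assms(1) _ assms(3)], of False]
  then show ?thesis using assms(2) by (cases w; cases u) (simp_all add: add_ac)
qed

lemma class_E1:
  assumes "bracket_identity_in_AIA P" "w \<noteq> u" "distinct [a, b, c, d, e, f]"
  shows "coef (Op u (Op w (Var a) (Op w (Var b) (Var e))) (Op w (Var c) (Op w (Var d) (Var f)))) P + coef (Op w (Op u (Var a) (Var c)) (Op w (Op u (Var b) (Var d)) (Op u (Var e) (Var f)))) P = (0 :: 'k::field_char_0)"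
proof -
  let ?C = "\<lambda>w u. [(Op u (Op w (Var 0) (Op w (Var 1) (Var 4))) (Op w (Var 2) (Op w (Var 3) (Var 5)))),
    (Op w (Op u (Op w (Var 0) (Var 1)) (Op w (Var 2) (Var 3))) (Op u (Var 4) (Var 5))),
    (Op w (Op u (Op w (Var 0) (Var 1)) (Var 2)) (Op u (Var 4) (Op w (Var 3) (Var 5)))),
    (Op w (Op u (Var 0) (Op w (Var 2) (Var 3))) (Op u (Op w (Var 1) (Var 4)) (Var 5))),
    (Op w (Op u (Var 0) (Var 2)) (Op u (Op w (Var 1) (Var 4)) (Op w (Var 3) (Var 5)))),
    (Op w (Op u (Var 0) (Var 2)) (Op w (Op u (Var 1) (Var 3)) (Op u (Var 4) (Var 5))))]"
  have "is_class (?C Circ Bull)" "is_class (?C Bull Circ)" by code_simp+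
  note this[THEN class_sum6[OF assms(1) _ assms(3)], of True]
    this[THEN class_sum6[OF assms(1) _ assms(3)], of False]
  then show ?thesis using assms(2) by (cases w; cases u) (simp_all add: add_ac)
qed

lemma class_r1:
  assumes "bracket_identity_in_AIA P" "w \<noteq> u" "distinct [a, b, c, d, e, f]"
  shows "coef (Op w (Var a) (Op w (Op u (Var b) (Op w (Var c) (Var e))) (Op u (Var d) (Var f)))) P + coef (Op w (Var a) (Op w (Op u (Var b) (Var c)) (Op u (Var d) (Op w (Var e) (Var f))))) P = (0 :: 'k::field_char_0)"
proof -
  let ?C = "\<lambda>w u. [(Op w (Var 0) (Op w (Op u (Var 1) (Op w (Var 2) (Var 4))) (Op u (Var 3) (Var 5)))),
    (Op w (Var 0) (Op u (Op w (Var 1) (Var 3)) (Op w (Var 2) (Op w (Var 4) (Var 5))))),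
    (Op w (Var 0) (Op w (Op u (Var 1) (Var 2)) (Op u (Var 3) (Op w (Var 4) (Var 5)))))]"
  have "is_class (?C Circ Bull)" "is_class (?C Bull Circ)" by code_simp+
  note this[THEN class_sum6[OF assms(1) _ assms(3)], of True]
    this[THEN class_sum6[OF assms(1) _ assms(3)], of False]
  then show ?thesis using assms(2) by (cases w; cases u) (simp_all add: add_ac)
qed

text \<open>No interchange applies to this comb, so its coefficient is a class sum by itself. It is
  the extra term of the shuffle in \<open>r_zero\<close>.\<close>

lemma class_r3:
  assumes "bracket_identity_in_AIA P" "w \<noteq> u" "distinct [a, b, c, d, e, f]"
  shows "coef (Op w (Op u (Var b) (Var c)) (Op w (Var a) (Op u (Var d) (Op w (Var e) (Var f))))) P = (0 :: 'k::field_char_0)"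
proof -
  let ?C = "\<lambda>w u. [(Op w (Op u (Var 1) (Var 2)) (Op w (Var 0) (Op u (Var 3) (Op w (Var 4) (Var 5)))))]"
  have "is_class (?C Circ Bull)" "is_class (?C Bull Circ)" by code_simp+
  note this[THEN class_sum6[OF assms(1) _ assms(3)], of True]
    this[THEN class_sum6[OF assms(1) _ assms(3)], of False]
  then show ?thesis using assms(2) by (cases w; cases u) (simp_all add: add_ac)
qed

lemma class_q1:
  assumes "bracket_identity_in_AIA P" "w \<noteq> u" "distinct [a, b, c, d, e, f]"
  shows "coef (Op u (Var a) (Op w (Op u (Var b) (Op w (Var c) (Var e))) (Op u (Var d) (Var f)))) P + coef (Op u (Var a) (Op w (Op u (Var b) (Var c)) (Op u (Var d) (Op w (Var e) (Var f))))) P = (0 :: 'k::field_char_0)"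
proof -
  let ?C = "\<lambda>w u. [(Op u (Var 0) (Op w (Op u (Var 1) (Op w (Var 2) (Var 4))) (Op u (Var 3) (Var 5)))),
    (Op u (Var 0) (Op w (Op u (Var 1) (Var 2)) (Op u (Var 3) (Op w (Var 4) (Var 5))))),
    (Op u (Var 0) (Op u (Op w (Var 1) (Var 3)) (Op w (Var 2) (Op w (Var 4) (Var 5)))))]"
  have "is_class (?C Circ Bull)" "is_class (?C Bull Circ)" by code_simp+
  note this[THEN class_sum6[OF assms(1) _ assms(3)], of True]
    this[THEN class_sum6[OF assms(1) _ assms(3)], of False]
  then show ?thesis using assms(2) by (cases w; cases u) (simp_all add: add_ac)
qed

text \<open>Supplies the simplifier with each disequality in both orientations.\<close>

lemma distinct_rev6: "distinct [a, b, c, d, e, f] \<Longrightarrow> distinct [f, e, d, c, b, a]"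
  by auto

lemma eqc_L: "\<not> root_is w x \<Longrightarrow> \<not> root_is w x' \<Longrightarrow> \<not> root_is w y \<Longrightarrow> eqc c x x' \<Longrightarrow> eqc c (Op w x y) (Op w x' y)"
  using eqc_2[of w x y x' y c 1] by (simp add: eqc_refl)

lemma eqc_R: "\<not> root_is w x \<Longrightarrow> \<not> root_is w y \<Longrightarrow> \<not> root_is w y' \<Longrightarrow> eqc c y y' \<Longrightarrow> eqc c (Op w x y) (Op w x y')"
  using eqc_2[of w x y x y' 1 c] by (simp add: eqc_refl)

lemma eqc_3a: "\<not> root_is w x \<Longrightarrow> \<not> root_is w x' \<Longrightarrow> \<not> root_is w y \<Longrightarrow> \<not> root_is w z \<Longrightarrow> eqc c x x' \<Longrightarrow>
    eqc c (Op w x (Op w y z)) (Op w x' (Op w y z))"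
  using eqc_3[of w x y z x' y z c 1 1] by (simp add: eqc_refl)

lemma eqc_3b: "\<not> root_is w x \<Longrightarrow> \<not> root_is w y \<Longrightarrow> \<not> root_is w y' \<Longrightarrow> \<not> root_is w z \<Longrightarrow> eqc c y y' \<Longrightarrow>
    eqc c (Op w x (Op w y z)) (Op w x (Op w y' z))"
  using eqc_3[of w x y z x y' z 1 c 1] by (simp add: eqc_refl)

lemma eqc_3c: "\<not> root_is w x \<Longrightarrow> \<not> root_is w y \<Longrightarrow> \<not> root_is w z \<Longrightarrow> \<not> root_is w z' \<Longrightarrow> eqc c z z' \<Longrightarrow>
    eqc c (Op w x (Op w y z)) (Op w x (Op w y z'))"
  using eqc_3[of w x y z x y z' 1 1 c] by (simp add: eqc_refl)

lemma coef_minus: "eqc (- 1) t t' \<Longrightarrow> coef t f = - coef t' f"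
  using coef_eqc[of "- 1"] by simp

lemma coef_plus: "eqc 1 t t' \<Longrightarrow> coef t f = coef t' f"
  using coef_eqc[of 1] by simp

text \<open>The relations proved here hold for the coefficients of any bracket polynomial, whereas
  \<open>bracket_identity\<close> adds those that come from class sums. The separation matters
  later, when the symmetries are applied to the difference of an identity and a combination of
  linearisations.\<close>

locale two_operations =
  fixes P :: "'k::field_char_0 fpoly" and w u :: oper
  assumes wu: "w \<noteq> u"
begin

abbreviation co :: "mono \<Rightarrow> 'k" where "co t \<equiv> coef t P"

text \<open>The right combs of degree 6 that are not determined by parity alone. With w as juxtaposition and u as *,
  the first eight have the forms ab*(cd(e*f)), ab*(c*d)(e*f), ab*c(d*e*f), ab*c(d*(ef)), abc*def, abc*d(e*f), a(b*c)*d(e*f) and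
  (a*b)(c*d)(e*f); the remaining ones interchange only in a part of degree 5.\<close>
definition "g2 a b c d e f = co (Op u (Op w (Var a) (Var b)) (Op w (Var c) (Op w (Var d) (Op u (Var e) (Var f)))))"
definition "g3 a b c d e f = co (Op u (Op w (Var a) (Var b)) (Op w (Op u (Var c) (Var d)) (Op u (Var e) (Var f))))"
definition "g4 a b c d e f = co (Op u (Op w (Var a) (Var b)) (Op w (Var c) (Op u (Var d) (Op u (Var e) (Var f)))))"
definition "g5 a b c d e f = co (Op u (Op w (Var a) (Var b)) (Op w (Var c) (Op u (Var d) (Op w (Var e) (Var f)))))"
definition "g6 a b c d e f = co (Op u (Op w (Var a) (Op w (Var b) (Var c))) (Op w (Var d) (Op w (Var e) (Var f))))"
definition "g7 a b c d e f = co (Op u (Op w (Var a) (Op w (Var b) (Var c))) (Op w (Var d) (Op u (Var e) (Var f))))"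
definition "g8 a b c d e f = co (Op u (Op w (Var a) (Op u (Var b) (Var c))) (Op w (Var d) (Op u (Var e) (Var f))))"
definition "g9 a b c d e f = co (Op w (Op u (Var a) (Var b)) (Op w (Op u (Var c) (Var d)) (Op u (Var e) (Var f))))"
definition "q a b c d e f = co (Op u (Var a) (Op w (Op u (Var b) (Var c)) (Op u (Var d) (Op w (Var e) (Var f)))))"
definition "r a b c d e f = co (Op w (Var a) (Op w (Op u (Var b) (Var c)) (Op u (Var d) (Op w (Var e) (Var f)))))"
definition "r' a b c d e f = co (Op w (Var a) (Op w (Op u (Var b) (Op w (Var c) (Var d))) (Op u (Var e) (Var f))))"

lemma g2_12: "g2 a b c d e f = - g2 b a c d e f"
  unfolding g2_def by (rule coef_minus, rule eqc_L[OF _ _ _ eqc_swap]) (use wu in auto)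

lemma g2_56: "g2 a b c d e f = - g2 a b c d f e"
  unfolding g2_def by (rule coef_minus, rule eqc_R[OF _ _ _ eqc_3c[OF _ _ _ _ eqc_swap]]) (use wu in auto)

lemma g3_12: "g3 a b c d e f = - g3 b a c d e f"
  unfolding g3_def by (rule coef_minus, rule eqc_L[OF _ _ _ eqc_swap]) (use wu in auto)

lemma g3_swap: "g3 a b c d e f = - g3 a b e f c d"
  unfolding g3_def by (rule coef_minus, rule eqc_R[OF _ _ _ eqc_swap]) (use wu in auto)

lemma g4_12: "g4 a b c d e f = - g4 b a c d e f"
  unfolding g4_def by (rule coef_minus, rule eqc_L[OF _ _ _ eqc_swap]) (use wu in auto)

lemma g4_46: "g4 a b c d e f = g4 a b c f e d"
  unfolding g4_def by (rule coef_plus, rule eqc_R[OF _ _ _ eqc_R[OF _ _ _ eqc_rev3]]) (use wu in auto)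

lemma g5_12: "g5 a b c d e f = - g5 b a c d e f"
  unfolding g5_def by (rule coef_minus, rule eqc_L[OF _ _ _ eqc_swap]) (use wu in auto)

lemma g5_56: "g5 a b c d e f = - g5 a b c d f e"
  unfolding g5_def by (rule coef_minus, rule eqc_R[OF _ _ _ eqc_R[OF _ _ _ eqc_R[OF _ _ _ eqc_swap]]]) (use wu in auto)

lemma g6_13: "g6 a b c d e f = g6 c b a d e f"
  unfolding g6_def by (rule coef_plus, rule eqc_L[OF _ _ _ eqc_rev3]) (use wu in auto)

lemma g7_13: "g7 a b c d e f = g7 c b a d e f"
  unfolding g7_def by (rule coef_plus, rule eqc_L[OF _ _ _ eqc_rev3]) (use wu in auto)

lemma g7_56: "g7 a b c d e f = - g7 a b c d f e"
  unfolding g7_def by (rule coef_minus, rule eqc_R[OF _ _ _ eqc_R[OF _ _ _ eqc_swap]]) (use wu in auto)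

lemma g8_23: "g8 a b c d e f = - g8 a c b d e f"
  unfolding g8_def by (rule coef_minus, rule eqc_L[OF _ _ _ eqc_R[OF _ _ _ eqc_swap]]) (use wu in auto)

lemma g9_12: "g9 a b c d e f = - g9 b a c d e f"
  unfolding g9_def by (rule coef_minus, rule eqc_3a[OF _ _ _ _ eqc_swap]) (use wu in auto)

lemma q_23: "q a b c d e f = - q a c b d e f"
  unfolding q_def by (rule coef_minus, rule eqc_R[OF _ _ _ eqc_L[OF _ _ _ eqc_swap]]) (use wu in auto)

lemma r_23: "r a b c d e f = - r a c b d e f"
  unfolding r_def by (rule coef_minus, rule eqc_3b[OF _ _ _ _ eqc_swap]) (use wu in auto)

lemma r_56: "r a b c d e f = - r a b c d f e"
  unfolding r_def by (rule coef_minus, rule eqc_3c[OF _ _ _ _ eqc_R[OF _ _ _ eqc_swap]]) (use wu in auto)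

lemma r'_34: "r' a b c d e f = - r' a b d c e f"
  unfolding r'_def by (rule coef_minus, rule eqc_3b[OF _ _ _ _ eqc_R[OF _ _ _ eqc_swap]]) (use wu in auto)

lemma r'_56: "r' a b c d e f = - r' a b c d f e"
  unfolding r'_def by (rule coef_minus, rule eqc_3c[OF _ _ _ _ eqc_swap]) (use wu in auto)

lemma g4_shuffle: "g4 a b c d e f + g4 a b c e d f + g4 a b c e f d = 0"
  unfolding g4_def
  by (intro coef_sum3 ec_sum3_context[of u "Op w _ _"] ec_sum3_context[of w "Var _"] ec_sum3_shuffle) (use wu in auto)

lemma g7_shuffle: "g7 a b c d e f + g7 b a c d e f + g7 b c a d e f = 0"
proof -
  have *: "g7 a b c d e f = - co (Op u (Op w (Var d) (Op u (Var e) (Var f))) (Op w (Var a) (Op w (Var b) (Var c))))" for a b c d e f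
    unfolding g7_def by (rule coef_minus, rule eqc_swap) (use wu in auto)
  have "co (Op u (Op w (Var d) (Op u (Var e) (Var f))) (Op w (Var a) (Op w (Var b) (Var c))))
     + co (Op u (Op w (Var d) (Op u (Var e) (Var f))) (Op w (Var b) (Op w (Var a) (Var c))))
     + co (Op u (Op w (Var d) (Op u (Var e) (Var f))) (Op w (Var b) (Op w (Var c) (Var a)))) = 0"
    by (intro coef_sum3 ec_sum3_context ec_sum3_shuffle) (use wu in auto)
  then show ?thesis unfolding * by algebra
qed

end

locale bracket_identity = two_operations +
  assumes P: "bracket_identity_in_AIA P"
begin

lemma rel_E3:
  assumes dist: "distinct [a, b, c, d, e, f]"
  shows "g2 a d b c e f - g7 b c f a d e + g5 a d b e c f = 0"
proof -
  have s0: "co (Op u (Op w (Var a) (Op u (Var d) (Var e))) (Op w (Var b) (Op w (Var c) (Var f)))) = - co (Op u (Op w (Var b) (Op w (Var c) (Var f))) (Op w (Var a) (Op u (Var d) (Var e))))"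
    by (rule coef_minus, rule eqc_swap) (use wu in auto)
  show ?thesis
    using class_E3[OF P wu dist] s0 
    unfolding g2_def g5_def g7_def by algebra
qed

lemma rel_E2:
  assumes dist: "distinct [a, b, c, d, e, f]"
  shows "g4 a c b d e f + g8 a c d b e f - g4 b f a c d e = 0"
proof -
  have s0: "co (Op u (Op w (Var a) (Op u (Var c) (Op u (Var d) (Var e)))) (Op w (Var b) (Var f))) = - co (Op u (Op w (Var b) (Var f)) (Op w (Var a) (Op u (Var c) (Op u (Var d) (Var e)))))"
    by (rule coef_minus, rule eqc_swap) (use wu in auto)
  show ?thesis
    using class_E2[OF P wu dist] s0 
    unfolding g4_def g8_def by algebra
qed

lemma rel_E4:
  assumes dist: "distinct [a, b, c, d, e, f]"
  shows "g5 a c b f d e = - g5 b f a c d e"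
proof -
  have s0: "co (Op u (Op w (Var a) (Var c)) (Op w (Var b) (Op u (Op w (Var d) (Var e)) (Var f)))) = - co (Op u (Op w (Var a) (Var c)) (Op w (Var b) (Op u (Var f) (Op w (Var d) (Var e)))))"
    by (rule coef_minus, rule eqc_R[OF _ _ _ eqc_R[OF _ _ _ eqc_swap]]) (use wu in auto)
  have s1: "co (Op u (Op w (Var a) (Op u (Var c) (Op w (Var d) (Var e)))) (Op w (Var b) (Var f))) = - co (Op u (Op w (Var b) (Var f)) (Op w (Var a) (Op u (Var c) (Op w (Var d) (Var e)))))"
    by (rule coef_minus, rule eqc_swap) (use wu in auto)
  show ?thesis
    using class_E4[OF P wu dist] s0 s1 
    unfolding g5_def by algebra
qed

lemma rel_E10:
  assumes dist: "distinct [a, b, c, d, e, f]"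
  shows "g3 a d b c e f - g8 a d e f b c - g8 d a b c e f - g3 c f a b d e = 0"
proof -
  have s0: "co (Op u (Op w (Op u (Var a) (Var b)) (Op u (Var d) (Var e))) (Op w (Var c) (Var f))) = - co (Op u (Op w (Var c) (Var f)) (Op w (Op u (Var a) (Var b)) (Op u (Var d) (Var e))))"
    by (rule coef_minus, rule eqc_swap) (use wu in auto)
  have s1: "co (Op u (Op w (Op u (Var a) (Var b)) (Var d)) (Op w (Var c) (Op u (Var e) (Var f)))) = - co (Op u (Op w (Var d) (Op u (Var a) (Var b))) (Op w (Var c) (Op u (Var e) (Var f))))"
    by (rule coef_minus, rule eqc_L[OF _ _ _ eqc_swap]) (use wu in auto)
  have s2: "co (Op u (Op w (Var a) (Op u (Var d) (Var e))) (Op w (Op u (Var b) (Var c)) (Var f))) = - co (Op u (Op w (Var a) (Op u (Var d) (Var e))) (Op w (Var f) (Op u (Var b) (Var c))))"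
    by (rule coef_minus, rule eqc_R[OF _ _ _ eqc_swap]) (use wu in auto)
  show ?thesis
    using class_E10[OF P wu dist] s0 s1 s2 
    unfolding g3_def g8_def by algebra
qed

lemma rel_E1:
  assumes dist: "distinct [a, b, c, d, e, f]"
  shows "g6 a b e c d f + g9 a c b d e f = 0"
proof -
  show ?thesis
    using class_E1[OF P wu dist] 
    unfolding g6_def g9_def by simp
qed

lemma rel_r1:
  assumes dist: "distinct [a, b, c, d, e, f]"
  shows "r' a b c e d f = - r a b c d e f"
proof -
  show ?thesis
    using class_r1[OF P wu dist] 
    unfolding r_def r'_def by algebra
qed

lemma rel_q1:
  assumes dist: "distinct [a, b, c, d, e, f]"
  shows "q a b c d e f = q a d f b c e"
proof -
  have s0: "co (Op u (Var a) (Op w (Op u (Var b) (Op w (Var c) (Var e))) (Op u (Var d) (Var f)))) = - co (Op u (Var a) (Op w (Op u (Var d) (Var f)) (Op u (Var b) (Op w (Var c) (Var e)))))"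
    by (rule coef_minus, rule eqc_R[OF _ _ _ eqc_swap]) (use wu in auto)
  show ?thesis
    using class_q1[OF P wu dist] s0 
    unfolding q_def by algebra
qed

text \<open>In the shuffle of the factor \<open>c\<close> with the word formed by \<open>d\<close>
  and \<open>e * f\<close>, the term with \<open>e * f\<close> in the middle vanishes by
  \<open>class_mid\<close>.\<close>

lemma g2_34:
  assumes dist: "distinct [a, b, c, d, e, f]"
  shows "g2 a b c d e f = - g2 a b d c e f"
proof -
  let ?X = "Op u (Var e) (Var f)"
  have "co (Op u (Op w (Var a) (Var b)) (Op w (Var c) (Op w (Var d) ?X))) + co (Op u (Op w (Var a) (Var b)) (Op w (Var d) (Op w (Var c) ?X)))
      + co (Op u (Op w (Var a) (Var b)) (Op w (Var d) (Op w ?X (Var c)))) = 0"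
    by (intro coef_sum3 ec_sum3_context ec_sum3_shuffle) (use wu in auto)
  moreover have "co (Op u (Op w (Var a) (Var b)) (Op w (Var d) (Op w ?X (Var c)))) = 0"
    using class_mid[OF P wu, of a b d e f c] dist distinct_rev6[OF dist] by simp
  ultimately show ?thesis by (simp add: g2_def eq_neg_iff_add_eq_0)
qed

text \<open>Reversal in \<open>g6\<close> makes \<open>g9\<close> invariant under exchange of its
  first and fifth arguments, while exchange of the first two changes its sign. The two
  transpositions are conjugate, so no nonzero function can have both properties; the chain of
  equations is a closed walk with three sign changes.\<close>

lemma g9_zero:
  assumes dist: "distinct [a, b, c, d, e, f]"
  shows "g9 a b c d e f = 0"
proof -
  note dd = dist distinct_rev6[OF dist]
  have swap: "g9 a b c d e f = g9 e b c d a f" if "distinct [a, b, c, d, e, f]" for a b c d e f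
    using rel_E1[of a c b d e f] rel_E1[of e c b d a f] g6_13[of a c e b d f] that distinct_rev6[OF that]
    by (simp add: eq_neg_iff_add_eq_0[symmetric] add_eq_0_iff)
  have e0: "g9 a b c d e f = - g9 b a c d e f" using g9_12[of a b c d e f] dd by simp
  have e1: "g9 a b c d e f = - g9 e a c d b f" using e0 swap[of b a c d e f] dd by simp
  have e2: "g9 a b c d e f = g9 a e c d b f" using e1 g9_12[of e a c d b f] dd by simp
  have e3: "g9 a b c d e f = g9 b e c d a f" using e2 swap[of a e c d b f] dd by simp
  have e4: "g9 a b c d e f = - g9 e b c d a f" using e3 g9_12[of b e c d a f] dd by simp
  have m: "g9 e b c d a f = g9 a b c d e f" using swap[of e b c d a f] dd by simp
  have e5: "g9 a b c d e f = - g9 a b c d e f" using e4 m by algebra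
  then show ?thesis by simp
qed

lemma g6_zero:
  assumes dist: "distinct [a, b, c, d, e, f]"
  shows "g6 a b c d e f = 0"
  using rel_E1[of a b d e c f] g9_zero[of a d b e c f] dist distinct_rev6[OF dist] by simp

lemma g4_zero:
  assumes dist: "distinct [a, b, c, d, e, f]"
  shows "g4 a b c d e f = 0"
proof -
  note dd = dist distinct_rev6[OF dist]
  \<comment> \<open>Adding \<open>rel_E2\<close> and its copy with \<open>c\<close> and
    \<open>d\<close> exchanged cancels the \<open>g8\<close> terms by antisymmetry; the shuffle
    relation and reversal merge the last two \<open>g4\<close> terms into one.\<close>
  have star: "g4 a c b d e f + g4 a d b c e f + g4 b f a c e d = 0" if "distinct [a, b, c, d, e, f]" for a b c d e f
  proof -
    have "g4 a c b d e f + g8 a c d b e f - g4 b f a c d e = 0" "g4 a d b c e f + g8 a d c b e f - g4 b f a d c e = 0"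
      using rel_E2[of a b c d e f] rel_E2[of a b d c e f] that distinct_rev6[OF that] by auto
    moreover have "g8 a c d b e f = - g8 a d c b e f" by (rule g8_23)
    moreover have "g4 b f a c d e + g4 b f a d c e + g4 b f a d e c = 0" by (rule g4_shuffle)
    moreover have "g4 b f a c e d = g4 b f a d e c" by (rule g4_46)
    ultimately show ?thesis by algebra
  qed
  \<comment> \<open>The first two instances of \<open>star\<close> minus the other two. The
    resulting symmetry in the first and third arguments clashes with antisymmetry in the first two,
    as for \<open>g9\<close>.\<close>
  have sym: "g4 a c b d e f = g4 b c a d e f" if "distinct [a, b, c, d, e, f]" for a b c d e f
  proof -
    have "g4 a c b d e f + g4 a d b c e f + g4 b f a c e d = 0" "g4 a c b f e d + g4 a f b c e d + g4 b d a c e f = 0"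
      "g4 a d b f e c + g4 a f b d e c + g4 b c a d e f = 0" "g4 b d a f e c + g4 b f a d e c + g4 a c b d e f = 0"
      using star[of a b c d e f] star[of a b c f e d] star[of a b d f e c] star[of b a d f e c] that distinct_rev6[OF that] by auto
    moreover have "g4 a c b f e d = g4 a c b d e f" "g4 a d b f e c = g4 a d b c e f" "g4 a f b d e c = g4 a f b c e d"
      "g4 b d a f e c = g4 b d a c e f" "g4 b f a d e c = g4 b f a c e d"
      by (rule g4_46)+
    ultimately have "2 * g4 a c b d e f = 2 * g4 b c a d e f" by algebra
    then show ?thesis by simp
  qed
  have e0: "g4 a b c d e f = - g4 b a c d e f" using g4_12[of a b c d e f] dd by simp
  have e1: "g4 a b c d e f = - g4 c a b d e f" using e0 sym[of b c a d e f] dd by simp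
  have e2: "g4 a b c d e f = g4 a c b d e f" using e1 g4_12[of c a b d e f] dd by simp
  have e3: "g4 a b c d e f = g4 b c a d e f" using e2 sym[of a b c d e f] dd by simp
  have e4: "g4 a b c d e f = - g4 c b a d e f" using e3 g4_12[of b c a d e f] dd by simp
  have m: "g4 c b a d e f = g4 a b c d e f" using sym[of c a b d e f] dd by simp
  have e5: "g4 a b c d e f = - g4 a b c d e f" using e4 m by algebra
  then show ?thesis by simp
qed

lemma g8_zero:
  assumes dist: "distinct [a, b, c, d, e, f]"
  shows "g8 a b c d e f = 0"
  using rel_E2[of a d b c e f] g4_zero[of a b d c e f] g4_zero[of d f a b c e] dist distinct_rev6[OF dist] by simp

text \<open>As \<open>g8\<close> vanishes, \<open>rel_E10\<close> equates values along a permutation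
  of all six labels. The closed walk combines it with \<open>g3_12\<close> and
  \<open>g3_swap\<close> and meets three sign changes.\<close>

lemma g3_zero:
  assumes dist: "distinct [a, b, c, d, e, f]"
  shows "g3 a b c d e f = 0"
proof -
  note dd = dist distinct_rev6[OF dist]
  have rot: "g3 a d b c e f = g3 c f a b d e" if "distinct [a, b, c, d, e, f]" for a b c d e f
    using rel_E10[of a b c d e f] g8_zero[of a d e f b c] g8_zero[of d a b c e f] that distinct_rev6[OF that] by simp
  have e0: "g3 a b c d e f = - g3 b a c d e f" using g3_12[of a b c d e f] dd by simp
  have e1: "g3 a b c d e f = - g3 d f b c a e" using e0 rot[of b c d a e f] dd by simp
  have e2: "g3 a b c d e f = g3 f d b c a e" using e1 g3_12[of d f b c a e] dd by simp
  have e3: "g3 a b c d e f = g3 c e f b d a" using e2 rot[of f b c d a e] dd by simp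
  have e4: "g3 a b c d e f = - g3 c e d a f b" using e3 g3_swap[of c e f b d a] dd by simp
  have m: "g3 c e d a f b = g3 a b c d e f" using rot[of c d a e f b] dd by simp
  have e5: "g3 a b c d e f = - g3 a b c d e f" using e4 m by algebra
  then show ?thesis by simp
qed

text \<open>The composite of the permutations in \<open>q_23\<close> and \<open>rel_q1\<close> has
  order 5 and carries the sign - 1, so five rounds lead back to the start with the sign
  reversed.\<close>

lemma q_zero:
  assumes dist: "distinct [a, b, c, d, e, f]"
  shows "q a b c d e f = 0"
proof -
  note dd = dist distinct_rev6[OF dist]
  have e0: "q a b c d e f = - q a c b d e f" using q_23[of a b c d e f] dd by simp
  have e1: "q a b c d e f = - q a d f c b e" using e0 rel_q1[of a c b d e f] dd by simp
  have e2: "q a b c d e f = q a f d c b e" using e1 q_23[of a d f c b e] dd by simp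
  have e3: "q a b c d e f = q a c e f d b" using e2 rel_q1[of a f d c b e] dd by simp
  have e4: "q a b c d e f = - q a e c f d b" using e3 q_23[of a c e f d b] dd by simp
  have e5: "q a b c d e f = - q a f b e c d" using e4 rel_q1[of a e c f d b] dd by simp
  have e6: "q a b c d e f = q a b f e c d" using e5 q_23[of a f b e c d] dd by simp
  have e7: "q a b c d e f = q a e d b f c" using e6 rel_q1[of a b f e c d] dd by simp
  have e8: "q a b c d e f = - q a d e b f c" using e7 q_23[of a e d b f c] dd by simp
  have m: "q a d e b f c = q a b c d e f" using rel_q1[of a d e b f c] dd by simp
  have e9: "q a b c d e f = - q a b c d e f" using e8 m by algebra
  then show ?thesis by simp
qed

text \<open>The symmetries that \<open>r\<close> inherits from \<open>r'\<close> through
  \<open>rel_r1\<close> lead to a value of \<open>r'\<close> equal to the given value of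
  \<open>r\<close>. The shuffle whose remaining term is killed by \<open>class_r3\<close> makes the
  same two values opposite.\<close>

lemma r_zero:
  assumes dist: "distinct [a, b, c, d, e, f]"
  shows "r a b c d e f = 0"
proof -
  note dd = dist distinct_rev6[OF dist]
  have r_46: "r a b c d e f = - r a b c f e d" if "distinct [a, b, c, d, e, f]" for a b c d e f
    using rel_r1[of a b c d e f] rel_r1[of a b c f e d] r'_56[of a b c e d f] that distinct_rev6[OF that] by simp
  have r_35: "r a b c d e f = - r a b e d c f" if "distinct [a, b, c, d, e, f]" for a b c d e f
    using rel_r1[of a b c d e f] rel_r1[of a b e d c f] r'_34[of a b c e d f] that distinct_rev6[OF that] by simp
  have e0: "r a b c d e f = - r a c b d e f" using r_23[of a b c d e f] dd by simp
  have e1: "r a b c d e f = r a c b f e d" using e0 r_46[of a c b d e f] dd by simp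
  have e2: "r a b c d e f = - r a c b f d e" using e1 r_56[of a c b f e d] dd by simp
  have e3: "r a b c d e f = r a c d f b e" using e2 r_35[of a c b f d e] dd by simp
  have e4: "r a b c d e f = - r a d c f b e" using e3 r_23[of a c d f b e] dd by simp
  have e5: "r a b c d e f = r a d c f e b" using e4 r_56[of a d c f b e] dd by simp
  have e6: "r a b c d e f = - r a d c b e f" using e5 r_46[of a d c f e b] dd by simp
  have e7: "r a b c d e f = r a d e b c f" using e6 r_35[of a d c b e f] dd by simp
  have e8: "r a b c d e f = - r a d e b f c" using e7 r_56[of a d e b c f] dd by simp
  then have "r a b c d e f = r' a d e f b c"
    using rel_r1[of a d e b f c] dd by simp
  moreover have "r a b c d e f + r' a d e f b c = 0"
    using coef_sum3[OF ec_sum3_shuffle[of w "Op u (Var b) (Var c)" "Var a" "Op u (Var d) (Op w (Var e) (Var f))"], of P]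
      class_r3[OF P wu dist] wu by (simp add: r_def r'_def)
  ultimately show ?thesis by simp
qed

lemma r'_zero:
  assumes dist: "distinct [a, b, c, d, e, f]"
  shows "r' a b c d e f = 0"
  using rel_r1[of a b c e d f] r_zero[of a b c e d f] dist distinct_rev6[OF dist] by simp

end

text \<open>The relations satisfied by the coefficients of an identity on the right combs of the shapes that occur
  in the identity of degree 6. Their solutions are the functions sgn * (linear in p), where p is a function
  on the labels with sum 0; for instance g7 a b c d e f is the sign times p a - p c.\<close>
locale alternating_relations =
  fixes V :: "nat set" and g2 g5 g7 :: "nat \<Rightarrow> nat \<Rightarrow> nat \<Rightarrow> nat \<Rightarrow> nat \<Rightarrow> nat \<Rightarrow> 'k::field_char_0"
  assumes g2_12: "g2 a b c d e f = - g2 b a c d e f"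
    and g2_34: "distinct [a, b, c, d, e, f] \<Longrightarrow> {a, b, c, d, e, f} \<subseteq> V \<Longrightarrow> g2 a b c d e f = - g2 a b d c e f"
    and g2_56: "g2 a b c d e f = - g2 a b c d f e"
    and g5_12: "g5 a b c d e f = - g5 b a c d e f"
    and g5_swap: "distinct [a, b, c, d, e, f] \<Longrightarrow> {a, b, c, d, e, f} \<subseteq> V \<Longrightarrow> g5 a b c d e f = - g5 c d a b e f"
    and g5_56: "g5 a b c d e f = - g5 a b c d f e"
    and g7_13: "g7 a b c d e f = g7 c b a d e f"
    and g7_56: "g7 a b c d e f = - g7 a b c d f e"
    and g7_shuffle: "g7 a b c d e f + g7 b a c d e f + g7 b c a d e f = 0"
    and E3: "distinct [a, b, c, d, e, f] \<Longrightarrow> {a, b, c, d, e, f} \<subseteq> V \<Longrightarrow>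
      g2 a d b c e f - g7 b c f a d e + g5 a d b e c f = 0"
begin

section \<open>Solving the alternating relations\<close>

lemma g5_34:
  assumes dist: "distinct [a, b, c, d, e, f]" "{a, b, c, d, e, f} \<subseteq> V"
  shows "g5 a b c d e f = - g5 a b d c e f"
  using g5_swap[of a b c d e f] g5_swap[of a b d c e f] g5_12[of c d a b e f] dist
    distinct_rev6[OF dist(1)] by simp

text \<open>For solutions in terms of \<open>p\<close> the left side is the sign times
  \<open>p b - p f\<close>, and the claim is clear. Its derivation from the relations is an explicit
  linear certificate: the equations \<open>t\<close> bring values to common representatives under
  the sign symmetries, and \<open>r0\<close> to \<open>r19\<close> are instances of
  \<open>E3\<close> and of the shuffle relation in these representatives.\<close>

lemma g7_24:
  assumes dist: "distinct [a, b, c, d, e, f]" "{a, b, c, d, e, f} \<subseteq> V"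
  shows "g7 b c f a d e = - g7 b a f c d e"
proof -
  note dd = dist distinct_rev6[OF dist(1)]
  have t0: "g7 c f b a d e = g7 b f c a d e"
    using g7_13[of c f b a d e] dd by simp
  have "g7 b c f a d e + g7 c b f a d e + g7 c f b a d e = 0"
    using g7_shuffle[of b c f a d e] dd by simp
  then have r0: "g7 b c f a d e + g7 c b f a d e + g7 b f c a d e = 0" using t0 by algebra
  have t1: "g2 c e b f d a = - g2 c e b f a d"
    using g2_56[of c e b f d a] dd by simp
  have t2: "g7 b f a c e d = - g7 a f b c d e"
    using g7_56[of b f a c e d] g7_13[of b f a c d e] dd by simp
  have t3: "g5 c e b d f a = g5 b d c e a f"
    using g5_56[of c e b d f a] g5_swap[of c e b d a f] dd by simp
  have "g2 c e b f d a - g7 b f a c e d + g5 c e b d f a = 0"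
    using E3[of c b f e d a] dd by simp
  then have r1: "- g2 c e b f a d + g7 a f b c d e + g5 b d c e a f = 0" using t1 t2 t3 by algebra
  have t4: "g2 e c f b d a = - g2 c e b f a d"
    using g2_12[of e c f b d a] g2_34[of c e f b d a] g2_56[of c e b f d a] dd by simp
  have t5: "g7 f b a e c d = g7 a b f e c d"
    using g7_13[of f b a e c d] dd by simp
  have t6: "g5 e c f d b a = - g5 c e d f a b"
    using g5_12[of e c f d b a] g5_34[of c e f d b a] g5_56[of c e d f b a] dd by simp
  have "g2 e c f b d a - g7 f b a e c d + g5 e c f d b a = 0"
    using E3[of e f b c d a] dd by simp
  then have r2: "- g2 c e b f a d - g7 a b f e c d - g5 c e d f a b = 0" using t4 t5 t6 by algebra
  have t7: "g2 e c a b d f = - g2 c e a b d f"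
    using g2_12[of e c a b d f] dd by simp
  have t8: "g5 e c a d b f = g5 a d c e b f"
    using g5_12[of e c a d b f] g5_swap[of c e a d b f] dd by simp
  have "g2 e c a b d f - g7 a b f e c d + g5 e c a d b f = 0"
    using E3[of e a b c d f] dd by simp
  then have r3: "- g2 c e a b d f - g7 a b f e c d + g5 a d c e b f = 0" using t7 t8 by algebra
  have t9: "g2 d c a b f e = g2 c d a b e f"
    using g2_12[of d c a b f e] g2_56[of c d a b f e] dd by simp
  have t10: "g5 d c a f b e = g5 a f c d b e"
    using g5_12[of d c a f b e] g5_swap[of c d a f b e] dd by simp
  have "g2 d c a b f e - g7 a b e d c f + g5 d c a f b e = 0"
    using E3[of d a b c f e] dd by simp
  then have r4: "g2 c d a b e f - g7 a b e d c f + g5 a f c d b e = 0" using t9 t10 by algebra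
  have t11: "g2 d f e b c a = g2 d f b e a c"
    using g2_34[of d f e b c a] g2_56[of d f b e c a] dd by simp
  have t12: "g7 e b a d f c = - g7 a b e d c f"
    using g7_56[of e b a d f c] g7_13[of e b a d c f] dd by simp
  have t13: "g5 d f e c b a = - g5 c e d f a b"
    using g5_34[of d f e c b a] g5_56[of d f c e b a] g5_swap[of d f c e a b] dd by simp
  have "g2 d f e b c a - g7 e b a d f c + g5 d f e c b a = 0"
    using E3[of d e b f c a] dd by simp
  then have r5: "g2 d f b e a c + g7 a b e d c f - g5 c e d f a b = 0" using t11 t12 t13 by algebra
  have t14: "g2 d f e b a c = - g2 d f b e a c"
    using g2_34[of d f e b a c] dd by simp
  have t15: "g7 e b c d f a = - g7 c b e d a f"
    using g7_56[of e b c d f a] g7_13[of e b c d a f] dd by simp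
  have t16: "g5 d f e a b c = g5 a e d f b c"
    using g5_34[of d f e a b c] g5_swap[of d f a e b c] dd by simp
  have "g2 d f e b a c - g7 e b c d f a + g5 d f e a b c = 0"
    using E3[of d e b f a c] dd by simp
  then have r6: "- g2 d f b e a c + g7 c b e d a f + g5 a e d f b c = 0" using t14 t15 t16 by algebra
  have t17: "g2 a e b f d c = - g2 a e b f c d"
    using g2_56[of a e b f d c] dd by simp
  have t18: "g7 b f c a e d = - g7 b f c a d e"
    using g7_56[of b f c a e d] dd by simp
  have t19: "g5 a e b d f c = - g5 a e b d c f"
    using g5_56[of a e b d f c] dd by simp
  have "g2 a e b f d c - g7 b f c a e d + g5 a e b d f c = 0"
    using E3[of a b f e d c] dd by simp
  then have r7: "- g2 a e b f c d + g7 b f c a d e - g5 a e b d c f = 0" using t17 t18 t19 by algebra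
  have t20: "g2 d c e f b a = g2 c d e f a b"
    using g2_12[of d c e f b a] g2_56[of c d e f b a] dd by simp
  have t21: "g7 e f a d c b = - g7 a f e d b c"
    using g7_56[of e f a d c b] g7_13[of e f a d b c] dd by simp
  have t22: "g5 d c e b f a = g5 b e c d a f"
    using g5_12[of d c e b f a] g5_34[of c d e b f a] g5_56[of c d b e f a] g5_swap[of c d b e a f] dd by simp
  have "g2 d c e f b a - g7 e f a d c b + g5 d c e b f a = 0"
    using E3[of d e f c b a] dd by simp
  then have r8: "g2 c d e f a b + g7 a f e d b c + g5 b e c d a f = 0" using t20 t21 t22 by algebra
  have t23: "g2 d b e f c a = g2 b d e f a c"
    using g2_12[of d b e f c a] g2_56[of b d e f c a] dd by simp
  have t24: "g7 e f a d b c = g7 a f e d b c"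
    using g7_13[of e f a d b c] dd by simp
  have t25: "g5 d b e c f a = - g5 b d c e a f"
    using g5_12[of d b e c f a] g5_34[of b d e c f a] g5_56[of b d c e f a] dd by simp
  have "g2 d b e f c a - g7 e f a d b c + g5 d b e c f a = 0"
    using E3[of d e f b c a] dd by simp
  then have r9: "g2 b d e f a c - g7 a f e d b c - g5 b d c e a f = 0" using t23 t24 t25 by algebra
  have t26: "g7 b f a c d e = g7 a f b c d e"
    using g7_13[of b f a c d e] dd by simp
  have "g7 a b f c d e + g7 b a f c d e + g7 b f a c d e = 0"
    using g7_shuffle[of a b f c d e] dd by simp
  then have r10: "g7 a b f c d e + g7 b a f c d e + g7 a f b c d e = 0" using t26 by algebra
  have t27: "g2 d b e f a c = - g2 b d e f a c"
    using g2_12[of d b e f a c] dd by simp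
  have t28: "g7 e f c d b a = - g7 c f e d a b"
    using g7_56[of e f c d b a] g7_13[of e f c d a b] dd by simp
  have t29: "g5 d b e a f c = g5 a e b d c f"
    using g5_12[of d b e a f c] g5_34[of b d e a f c] g5_56[of b d a e f c] g5_swap[of b d a e c f] dd by simp
  have "g2 d b e f a c - g7 e f c d b a + g5 d b e a f c = 0"
    using E3[of d e f b a c] dd by simp
  then have r11: "- g2 b d e f a c + g7 c f e d a b + g5 a e b d c f = 0" using t27 t28 t29 by algebra
  have t30: "g7 a b f c e d = - g7 a b f c d e"
    using g7_56[of a b f c e d] dd by simp
  have t31: "g5 c e a d b f = - g5 a d c e b f"
    using g5_swap[of c e a d b f] dd by simp
  have "g2 c e a b d f - g7 a b f c e d + g5 c e a d b f = 0"
    using E3[of c a b e d f] dd by simp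
  then have r12: "g2 c e a b d f + g7 a b f c d e - g5 a d c e b f = 0" using t30 t31 by algebra
  have t32: "g2 d c f e a b = g2 c d e f a b"
    using g2_12[of d c f e a b] g2_34[of c d f e a b] dd by simp
  have t33: "g7 f e b d c a = - g7 b e f d a c"
    using g7_56[of f e b d c a] g7_13[of f e b d a c] dd by simp
  have t34: "g5 d c f a e b = g5 a f c d b e"
    using g5_12[of d c f a e b] g5_34[of c d f a e b] g5_56[of c d a f e b] g5_swap[of c d a f b e] dd by simp
  have "g2 d c f e a b - g7 f e b d c a + g5 d c f a e b = 0"
    using E3[of d f e c a b] dd by simp
  then have r13: "g2 c d e f a b + g7 b e f d a c + g5 a f c d b e = 0" using t32 t33 t34 by algebra
  have t35: "g2 d a b e c f = - g2 a d b e c f"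
    using g2_12[of d a b e c f] dd by simp
  have t36: "g5 d a b c e f = - g5 a d b c e f"
    using g5_12[of d a b c e f] dd by simp
  have "g2 d a b e c f - g7 b e f d a c + g5 d a b c e f = 0"
    using E3[of d b e a c f] dd by simp
  then have r14: "- g2 a d b e c f - g7 b e f d a c - g5 a d b c e f = 0" using t35 t36 by algebra
  have t37: "g2 d a e b f c = - g2 a d b e c f"
    using g2_12[of d a e b f c] g2_34[of a d e b f c] g2_56[of a d b e f c] dd by simp
  have t38: "g7 e b c d a f = g7 c b e d a f"
    using g7_13[of e b c d a f] dd by simp
  have t39: "g5 d a e f b c = - g5 a d e f b c"
    using g5_12[of d a e f b c] dd by simp
  have "g2 d a e b f c - g7 e b c d a f + g5 d a e f b c = 0"
    using E3[of d e b a f c] dd by simp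
  then have r15: "- g2 a d b e c f - g7 c b e d a f - g5 a d e f b c = 0" using t37 t38 t39 by algebra
  have t40: "g2 d a c f b e = - g2 a d c f b e"
    using g2_12[of d a c f b e] dd by simp
  have t41: "g5 d a c b f e = - g5 a d b c e f"
    using g5_12[of d a c b f e] g5_34[of a d c b f e] g5_56[of a d b c f e] dd by simp
  have "g2 d a c f b e - g7 c f e d a b + g5 d a c b f e = 0"
    using E3[of d c f a b e] dd by simp
  then have r16: "- g2 a d c f b e - g7 c f e d a b - g5 a d b c e f = 0" using t40 t41 by algebra
  have t42: "g2 a e f b d c = g2 a e b f c d"
    using g2_34[of a e f b d c] g2_56[of a e b f d c] dd by simp
  have t43: "g7 f b c a e d = - g7 c b f a d e"
    using g7_56[of f b c a e d] g7_13[of f b c a d e] dd by simp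
  have t44: "g5 a e f d b c = - g5 a e d f b c"
    using g5_34[of a e f d b c] dd by simp
  have "g2 a e f b d c - g7 f b c a e d + g5 a e f d b c = 0"
    using E3[of a f b e d c] dd by simp
  then have r17: "g2 a e b f c d + g7 c b f a d e - g5 a e d f b c = 0" using t42 t43 t44 by algebra
  have t45: "g2 a d f c e b = g2 a d c f b e"
    using g2_34[of a d f c e b] g2_56[of a d c f e b] dd by simp
  have t46: "g7 f c b a d e = g7 b c f a d e"
    using g7_13[of f c b a d e] dd by simp
  have t47: "g5 a d f e c b = g5 a d e f b c"
    using g5_34[of a d f e c b] g5_56[of a d e f c b] dd by simp
  have "g2 a d f c e b - g7 f c b a d e + g5 a d f e c b = 0"
    using E3[of a f c d e b] dd by simp
  then have r18: "g2 a d c f b e - g7 b c f a d e + g5 a d e f b c = 0" using t45 t46 t47 by algebra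
  have t48: "g2 c d b a e f = - g2 c d a b e f"
    using g2_34[of c d b a e f] dd by simp
  have t49: "g5 c d b e a f = - g5 b e c d a f"
    using g5_swap[of c d b e a f] dd by simp
  have "g2 c d b a e f - g7 b a f c d e + g5 c d b e a f = 0"
    using E3[of c b a d e f] dd by simp
  then have r19: "- g2 c d a b e f - g7 b a f c d e - g5 b e c d a f = 0" using t48 t49 by algebra
  \<comment> \<open>The twenty relations with multipliers 1 and - 1 add up to twice the claim, hence
    the division by 2 below.\<close>
  have "2 * (g7 b c f a d e + g7 b a f c d e) = (1) * (g7 b c f a d e + g7 c b f a d e + g7 b f c a d e) + (-1) * (- g2 c e b f a d + g7 a f b c d e + g5 b d c e a f) + (1) * (- g2 c e b f a d - g7 a b f e c d - g5 c e d f a b) + (-1) * (- g2 c e a b d f - g7 a b f e c d + g5 a d c e b f) + (-1) * (g2 c d a b e f - g7 a b e d c f + g5 a f c d b e) + (-1) * (g2 d f b e a c + g7 a b e d c f - g5 c e d f a b) + (-1) * (- g2 d f b e a c + g7 c b e d a f + g5 a e d f b c) + (-1) * (- g2 a e b f c d + g7 b f c a d e - g5 a e b d c f) + (-1) * (g2 c d e f a b + g7 a f e d b c + g5 b e c d a f) + (-1) * (g2 b d e f a c - g7 a f e d b c - g5 b d c e a f) + (1) * (g7 a b f c d e + g7 b a f c d e + g7 a f b c d e) + (-1) * (- g2 b d e f a c + g7 c f e d a b + g5 a e b d c f) + (-1) * (g2 c e a b d f + g7 a b f c d e - g5 a d c e b f) + (1) * (g2 c d e f a b + g7 b e f d a c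 + g5 a f c d b e) + (1) * (- g2 a d b e c f - g7 b e f d a c - g5 a d b c e f) + (-1) * (- g2 a d b e c f - g7 c b e d a f - g5 a d e f b c) + (-1) * (- g2 a d c f b e - g7 c f e d a b - g5 a d b c e f) + (-1) * (g2 a e b f c d + g7 c b f a d e - g5 a e d f b c) + (-1) * (g2 a d c f b e - g7 b c f a d e + g5 a d e f b c) + (-1) * (- g2 c d a b e f - g7 b a f c d e - g5 b e c d a f)"
    by algebra
  then have "2 * (g7 b c f a d e + g7 b a f c d e) = 0"
    unfolding r0 r1 r2 r3 r4 r5 r6 r7 r8 r9 r10 r11 r12 r13 r14 r15 r16 r17 r18 r19 by simp
  then have z: "g7 b c f a d e + g7 b a f c d e = 0"
    by (metis mult_eq_0_iff zero_neq_numeral)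
  show ?thesis using z  by algebra
qed

text \<open>In terms of \<open>p\<close> both sides are the sign of the arrangement times
  \<open>p e + p f - p a - p b\<close>. The certificate is of the same kind as for
  \<open>g7_24\<close>, with instances of \<open>E3\<close> alone.\<close>

lemma g2_eq:
  assumes dist: "distinct [a, b, c, d, e, f]" "{a, b, c, d, e, f} \<subseteq> V"
  shows "g2 a b c d e f = g7 a c e b d f + g7 b c f a d e"
proof -
  note dd = dist distinct_rev6[OF dist(1)]
  have t0: "g2 b d e c f a = g2 b d c e a f"
    using g2_34[of b d e c f a] g2_56[of b d c e f a] dd by simp
  have t1: "g7 e c a b d f = g7 a c e b d f"
    using g7_13[of e c a b d f] dd by simp
  have t2: "g5 b d e f c a = - g5 b d e f a c"
    using g5_56[of b d e f c a] dd by simp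
  have "g2 b d e c f a - g7 e c a b d f + g5 b d e f c a = 0"
    using E3[of b e c d f a] dd by simp
  then have r0: "g2 b d c e a f - g7 a c e b d f - g5 b d e f a c = 0" using t0 t1 t2 by algebra
  have t3: "g2 a e f c b d = - g2 a e c f b d"
    using g2_34[of a e f c b d] dd by simp
  have t4: "g7 f c d a e b = - g7 d c f a b e"
    using g7_56[of f c d a e b] g7_13[of f c d a b e] dd by simp
  have t5: "g5 a e f b c d = - g5 a e b f c d"
    using g5_34[of a e f b c d] dd by simp
  have "g2 a e f c b d - g7 f c d a e b + g5 a e f b c d = 0"
    using E3[of a f c e b d] dd by simp
  then have r1: "- g2 a e c f b d + g7 d c f a b e - g5 a e b f c d = 0" using t3 t4 t5 by algebra
  have t6: "g2 a b d c e f = - g2 a b c d e f"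
    using g2_34[of a b d c e f] dd by simp
  have "g2 a b d c e f - g7 d c f a b e + g5 a b d e c f = 0"
    using E3[of a d c b e f] dd by simp
  then have r2: "- g2 a b c d e f - g7 d c f a b e + g5 a b d e c f = 0" using t6 by algebra
  have t7: "g2 a e f c d b = g2 a e c f b d"
    using g2_34[of a e f c d b] g2_56[of a e c f d b] dd by simp
  have t8: "g7 f c b a e d = - g7 b c f a d e"
    using g7_56[of f c b a e d] g7_13[of f c b a d e] dd by simp
  have t9: "g5 a e f d c b = g5 a e d f b c"
    using g5_34[of a e f d c b] g5_56[of a e d f c b] dd by simp
  have "g2 a e f c d b - g7 f c b a e d + g5 a e f d c b = 0"
    using E3[of a f c e d b] dd by simp
  then have r3: "g2 a e c f b d + g7 b c f a d e + g5 a e d f b c = 0" using t7 t8 t9 by algebra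
  have t10: "g7 a c e d f b = - g7 a c e d b f"
    using g7_56[of a c e d f b] dd by simp
  have t11: "g5 d f a b c e = - g5 a b d f c e"
    using g5_swap[of d f a b c e] dd by simp
  have "g2 d f a c b e - g7 a c e d f b + g5 d f a b c e = 0"
    using E3[of d a c f b e] dd by simp
  then have r4: "g2 d f a c b e + g7 a c e d b f - g5 a b d f c e = 0" using t10 t11 by algebra
  have t12: "g2 b f e c a d = - g2 b f c e a d"
    using g2_34[of b f e c a d] dd by simp
  have t13: "g7 e c d b f a = - g7 d c e b a f"
    using g7_56[of e c d b f a] g7_13[of e c d b a f] dd by simp
  have t14: "g5 b f e a c d = g5 a e b f c d"
    using g5_34[of b f e a c d] g5_swap[of b f a e c d] dd by simp
  have "g2 b f e c a d - g7 e c d b f a + g5 b f e a c d = 0"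
    using E3[of b e c f a d] dd by simp
  then have r5: "- g2 b f c e a d + g7 d c e b a f + g5 a e b f c d = 0" using t12 t13 t14 by algebra
  have t15: "g2 b f e c d a = g2 b f c e a d"
    using g2_34[of b f e c d a] g2_56[of b f c e d a] dd by simp
  have t16: "g7 e c a b f d = - g7 a c e b d f"
    using g7_56[of e c a b f d] g7_13[of e c a b d f] dd by simp
  have t17: "g5 b f e d c a = g5 b f d e a c"
    using g5_34[of b f e d c a] g5_56[of b f d e c a] dd by simp
  have "g2 b f e c d a - g7 e c a b f d + g5 b f e d c a = 0"
    using E3[of b e c f d a] dd by simp
  then have r6: "g2 b f c e a d + g7 a c e b d f + g5 b f d e a c = 0" using t15 t16 t17 by algebra
  have t18: "g2 d e b c f a = - g2 d e b c a f"
    using g2_56[of d e b c f a] dd by simp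
  have t19: "g7 b c a d e f = g7 a c b d e f"
    using g7_13[of b c a d e f] dd by simp
  have t20: "g5 d e b f c a = g5 b f d e a c"
    using g5_56[of d e b f c a] g5_swap[of d e b f a c] dd by simp
  have "g2 d e b c f a - g7 b c a d e f + g5 d e b f c a = 0"
    using E3[of d b c e f a] dd by simp
  then have r7: "- g2 d e b c a f - g7 a c b d e f + g5 b f d e a c = 0" using t18 t19 t20 by algebra
  have t21: "g2 e d b c a f = - g2 d e b c a f"
    using g2_12[of e d b c a f] dd by simp
  have t22: "g7 b c f e d a = - g7 b c f e a d"
    using g7_56[of b c f e d a] dd by simp
  have t23: "g5 e d b a c f = - g5 a b d e c f"
    using g5_12[of e d b a c f] g5_34[of d e b a c f] g5_swap[of d e a b c f] dd by simp
  have "g2 e d b c a f - g7 b c f e d a + g5 e d b a c f = 0"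
    using E3[of e b c d a f] dd by simp
  then have r8: "- g2 d e b c a f + g7 b c f e a d - g5 a b d e c f = 0" using t21 t22 t23 by algebra
  have t24: "g2 d f a c e b = - g2 d f a c b e"
    using g2_56[of d f a c e b] dd by simp
  have t25: "g7 a c b d f e = - g7 a c b d e f"
    using g7_56[of a c b d f e] dd by simp
  have t26: "g5 d f a e c b = g5 a e d f b c"
    using g5_56[of d f a e c b] g5_swap[of d f a e b c] dd by simp
  have "g2 d f a c e b - g7 a c b d f e + g5 d f a e c b = 0"
    using E3[of d a c f e b] dd by simp
  then have r9: "- g2 d f a c b e + g7 a c b d e f + g5 a e d f b c = 0" using t24 t25 t26 by algebra
  have t27: "g2 e a f c d b = - g2 a e c f b d"
    using g2_12[of e a f c d b] g2_34[of a e f c d b] g2_56[of a e c f d b] dd by simp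
  have t28: "g7 f c b e a d = g7 b c f e a d"
    using g7_13[of f c b e a d] dd by simp
  have t29: "g5 e a f d c b = - g5 a e d f b c"
    using g5_12[of e a f d c b] g5_34[of a e f d c b] g5_56[of a e d f c b] dd by simp
  have "g2 e a f c d b - g7 f c b e a d + g5 e a f d c b = 0"
    using E3[of e f c a d b] dd by simp
  then have r10: "- g2 a e c f b d - g7 b c f e a d - g5 a e d f b c = 0" using t27 t28 t29 by algebra
  have t30: "g2 d b e c f a = - g2 b d c e a f"
    using g2_12[of d b e c f a] g2_34[of b d e c f a] g2_56[of b d c e f a] dd by simp
  have t31: "g7 e c a d b f = g7 a c e d b f"
    using g7_13[of e c a d b f] dd by simp
  have t32: "g5 d b e f c a = g5 b d e f a c"
    using g5_12[of d b e f c a] g5_56[of b d e f c a] dd by simp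
  have "g2 d b e c f a - g7 e c a d b f + g5 d b e f c a = 0"
    using E3[of d e c b f a] dd by simp
  then have r11: "- g2 b d c e a f - g7 a c e d b f + g5 b d e f a c = 0" using t30 t31 t32 by algebra
  have t33: "g2 b a d c f e = - g2 a b c d e f"
    using g2_12[of b a d c f e] g2_34[of a b d c f e] g2_56[of a b c d f e] dd by simp
  have t34: "g5 b a d f c e = - g5 a b d f c e"
    using g5_12[of b a d f c e] dd by simp
  have "g2 b a d c f e - g7 d c e b a f + g5 b a d f c e = 0"
    using E3[of b d c a f e] dd by simp
  then have r12: "- g2 a b c d e f - g7 d c e b a f - g5 a b d f c e = 0" using t33 t34 by algebra
  have "2 * (g2 a b c d e f - g7 a c e b d f - g7 b c f a d e) = (1) * (g2 b d c e a f - g7 a c e b d f - g5 b d e f a c) + (-1) * (- g2 a e c f b d + g7 d c f a b e - g5 a e b f c d) + (-1) * (- g2 a b c d e f - g7 d c f a b e + g5 a b d e c f) + (-2) * (g2 a e c f b d + g7 b c f a d e + g5 a e d f b c) + (1) * (g2 d f a c b e + g7 a c e d b f - g5 a b d f c e) + (-1) * (- g2 b f c e a d + g7 d c e b a f + g5 a e b f c d) + (-1) * (g2 b f c e a d + g7 a c e b d f + g5 b f d e a c) + (1) * (- g2 d e b c a f - g7 a c b d e f + g5 b f d e a c) + (-1) * (- g2 d e b c a f + g7 b c f e a d - g5 a b d e c f) + (1) * (- g2 d f a c b e + g7 a c b d e f + g5 a e d f b c) + (-1) * (- g2 a e c f b d - g7 b c f e a d - g5 a e d f b c) + (1) * (-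 g2 b d c e a f - g7 a c e d b f + g5 b d e f a c) + (-1) * (- g2 a b c d e f - g7 d c e b a f - g5 a b d f c e)"
    by algebra
  then have "2 * (g2 a b c d e f - g7 a c e b d f - g7 b c f a d e) = 0"
    unfolding r0 r1 r2 r3 r4 r5 r6 r7 r8 r9 r10 r11 r12 by simp
  then have z: "g2 a b c d e f - g7 a c e b d f - g7 b c f a d e = 0"
    by (metis mult_eq_0_iff zero_neq_numeral)
  show ?thesis using z  by algebra
qed

text \<open>With \<open>x\<close> and \<open>z\<close> fixed, \<open>g7\<close> changes sign under
  three adjacent transpositions of the other four arguments, so a single zero spreads to all 24
  arrangements.\<close>

lemma g7_alternating_zero:
  assumes dist: "distinct [x, p, z, q, r, s]" "{x, p, z, q, r, s} \<subseteq> V" and zero: "g7 x p z q r s = 0"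
    and p': "distinct [p', q', r', s']" "{p', q', r', s'} \<subseteq> {p, q, r, s}"
  shows "g7 x p' z q' r' s' = 0"
proof -
  note dd = dist distinct_rev6[OF dist(1)]
  have sw1: "g7 x a z b c d = - g7 x b z a c d" if "distinct [x, a, z, b, c, d]" "{x, a, z, b, c, d} \<subseteq> V" for a b c d
    using g7_24[of b x a c d z] that distinct_rev6[OF that(1)] by simp
  \<comment> \<open>Exchanging \<open>b\<close> and \<open>c\<close> in \<open>E3\<close> reverses
    the \<open>g2\<close> and \<open>g5\<close> terms, which are antisymmetric in their first two
    arguments, and hence the \<open>g7\<close> term.\<close>
  have sw2: "g7 x a z b c d = - g7 x a z c b d" if "distinct [x, a, z, b, c, d]" "{x, a, z, b, c, d} \<subseteq> V" for a b c d
  proof -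
    have "g2 b c x a d z - g7 x a z b c d + g5 b c x d a z = 0" "g2 c b x a d z - g7 x a z c b d + g5 c b x d a z = 0"
      using E3[of b x a c d z] E3[of c x a b d z] that distinct_rev6[OF that(1)] by auto
    then show ?thesis using g2_12[of b c x a d z] g5_12[of b c x d a z] by algebra
  qed
  have sw3: "g7 x a z b c d = - g7 x a z b d c" for a b c d
    by (rule g7_56)
  have z0: "g7 x p z q r s = 0" by (rule zero)
  have z1: "g7 x q z p r s = 0" using z0 sw1[of p q r s] dd by simp
  have z2: "g7 x p z r q s = 0" using z0 sw2[of p q r s] dd by simp
  have z3: "g7 x p z q s r = 0" using z0 sw3[of p q r s] dd by simp
  have z4: "g7 x q z r p s = 0" using z1 sw2[of q p r s] dd by simp
  have z5: "g7 x q z p s r = 0" using z1 sw3[of q p r s] dd by simp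
  have z6: "g7 x r z p q s = 0" using z2 sw1[of p r q s] dd by simp
  have z7: "g7 x p z r s q = 0" using z2 sw3[of p r q s] dd by simp
  have z8: "g7 x p z s q r = 0" using z3 sw2[of p q s r] dd by simp
  have z9: "g7 x r z q p s = 0" using z4 sw1[of q r p s] dd by simp
  have z10: "g7 x q z r s p = 0" using z4 sw3[of q r p s] dd by simp
  have z11: "g7 x q z s p r = 0" using z5 sw2[of q p s r] dd by simp
  have z12: "g7 x r z p s q = 0" using z6 sw3[of r p q s] dd by simp
  have z13: "g7 x p z s r q = 0" using z7 sw2[of p r s q] dd by simp
  have z14: "g7 x s z p q r = 0" using z8 sw1[of p s q r] dd by simp
  have z15: "g7 x r z q s p = 0" using z9 sw3[of r q p s] dd by simp
  have z16: "g7 x q z s r p = 0" using z10 sw2[of q r s p] dd by simp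
  have z17: "g7 x s z q p r = 0" using z11 sw1[of q s p r] dd by simp
  have z18: "g7 x r z s p q = 0" using z12 sw2[of r p s q] dd by simp
  have z19: "g7 x s z p r q = 0" using z13 sw1[of p s r q] dd by simp
  have z20: "g7 x r z s q p = 0" using z15 sw2[of r q s p] dd by simp
  have z21: "g7 x s z q r p = 0" using z16 sw1[of q s r p] dd by simp
  have z22: "g7 x s z r p q = 0" using z18 sw1[of r s p q] dd by simp
  have z23: "g7 x s z r q p = 0" using z20 sw1[of r s q p] dd by simp
  have "p' \<in> {p, q, r, s}" "q' \<in> {p, q, r, s}" "r' \<in> {p, q, r, s}" "s' \<in> {p, q, r, s}" using p' by auto
  then show ?thesis
    using p'(1) by (elim insertE emptyE) (simp_all add: z0 z1 z2 z3 z4 z5 z6 z7 z8 z9 z10 z11 z12 z13 z14 z15 z16 z17 z18 z19 z20 z21 z22 z23)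
qed

text \<open>The hypothesis handles \<open>z\<close> as third argument of \<open>g7\<close>, reversal
  handles the first, and the shuffle relation the second; alternation moves \<open>z\<close> there
  from the last three places. Then \<open>g2_eq\<close> and \<open>E3\<close> determine the other
  two functions.\<close>

lemma all_zero:
  assumes V: "card V = 6" and z: "z \<in> V"
    and zero: "\<And>x. x \<in> V \<Longrightarrow> x \<noteq> z \<Longrightarrow>
      \<exists>p q r s. distinct [x, p, z, q, r, s] \<and> {x, p, z, q, r, s} \<subseteq> V \<and> g7 x p z q r s = 0"
    and dist: "distinct [a, b, c, d, e, f]" "{a, b, c, d, e, f} \<subseteq> V"
  shows "g7 a b c d e f = 0" "g2 a b c d e f = 0" "g5 a b c d e f = 0"
proof -
  have V_eq: "V = {a, b, c, d, e, f}" if "distinct [a, b, c, d, e, f]" "{a, b, c, d, e, f} \<subseteq> V" for a b c d e f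
  proof -
    have "card {a, b, c, d, e, f} = card V"
      using distinct_card[OF that(1)] V by simp
    moreover have "finite V" using V by (intro card_ge_0_finite) simp
    ultimately show ?thesis using card_subset_eq[of V "{a, b, c, d, e, f}"] that by simp
  qed
  have base: "g7 x p z q r s = 0" if d: "distinct [x, p, z, q, r, s]" "{x, p, z, q, r, s} \<subseteq> V" for x p q r s
  proof -
    obtain p' q' r' s' where *: "distinct [x, p', z, q', r', s']" "{x, p', z, q', r', s'} \<subseteq> V" "g7 x p' z q' r' s' = 0"
      using zero[of x] d by auto
    have "{x, p', z, q', r', s'} = {x, p, z, q, r, s}"
      using V_eq[OF d] V_eq[OF *(1,2)] by simp
    then have "{p, q, r, s} \<subseteq> {p', q', r', s'}"
      using d(1) by auto
    then show ?thesis using g7_alternating_zero[OF *] d(1) by simp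
  qed
  have mid: "g7 x z y q r s = 0" if d: "distinct [x, z, y, q, r, s]" "{x, z, y, q, r, s} \<subseteq> V" for x y q r s
    using g7_shuffle[of y x z q r s] base[of x y q r s] base[of y x q r s] d distinct_rev6[OF d(1)] by simp
  have zero7: "g7 a b c d e f = 0" if d: "distinct [a, b, c, d, e, f]" "{a, b, c, d, e, f} \<subseteq> V" for a b c d e f
  proof -
    have "z \<in> {a, b, c, d, e, f}" using z V_eq[OF d] by simp
    then consider "z = c" | "z = a" | "z = b" | "z = d" | "z = e" | "z = f" by auto
    then show ?thesis
    proof cases
      case 1 then show ?thesis using base d by auto
    next
      case 2 then show ?thesis using base[of c b d e f] g7_13[of a b c d e f] d distinct_rev6[OF d(1)] by simp
    next
      case 3 then show ?thesis using mid d by auto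
    next
      case 4
      have "g7 a d c b e f = 0" using mid[of a c b e f] 4 d distinct_rev6[OF d(1)] by simp
      then show ?thesis using g7_alternating_zero[of a d c b e f b d e f] d distinct_rev6[OF d(1)] by simp
    next
      case 5
      have "g7 a e c b d f = 0" using mid[of a c b d f] 5 d distinct_rev6[OF d(1)] by simp
      then show ?thesis using g7_alternating_zero[of a e c b d f b d e f] d distinct_rev6[OF d(1)] by simp
    next
      case 6
      have "g7 a f c b d e = 0" using mid[of a c b d e] 6 d distinct_rev6[OF d(1)] by simp
      then show ?thesis using g7_alternating_zero[of a f c b d e b d e f] d distinct_rev6[OF d(1)] by simp
    qed
  qed
  have zero2: "g2 a b c d e f = 0" if d: "distinct [a, b, c, d, e, f]" "{a, b, c, d, e, f} \<subseteq> V" for a b c d e f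
    using g2_eq[OF d] zero7[of a c e b d f] zero7[of b c f a d e] d distinct_rev6[OF d(1)] by simp
  show "g7 a b c d e f = 0" "g2 a b c d e f = 0" using zero7 zero2 dist by auto
  show "g5 a b c d e f = 0"
    using E3[of a c e b d f] zero2[of a b c e d f] zero7[of c e f a b d] dist distinct_rev6[OF dist(1)] by simp
qed

end

section \<open>The identity of degree 6\<close>

lemma smult_minus: "smult (- c) p = - smult c p"
  by (rule poly_mapping_eqI) simp

lemma coef_add: "coef t (p + q) = coef t p + coef t q"
  and coef_diff: "coef t (p - q) = coef t p - coef t q"
  and coef_smult: "coef t (smult c p) = c * coef t p"
  by (simp_all add: coef_def lf_add lf_diff lf_smult)

lemma coef_zero [simp]: "coef t 0 = 0"
  by (simp add: coef_def)

lemma coef_sum: "coef t (sum g A) = (\<Sum>x\<in>A. coef t (g x))"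
  by (simp add: coef_def lf_sum)

lemma coef_mon [simp]: "coef t (mon m) = of_int (ec m t)"
  by (simp add: coef_def)

text \<open>Integer multiples of explicit monomials make the coefficients of \<open>id6\<close>
  computable independently of the field.\<close>

definition id6_list :: "oper \<Rightarrow> oper \<Rightarrow> nat \<Rightarrow> nat \<Rightarrow> nat \<Rightarrow> nat \<Rightarrow> (int \<times> mono) list" where
  "id6_list w u b c d e = (let x = Op w; y = Op u; A = Var 0; B = Var b; C = Var c; D = Var d; E = Var e in
    [(2, y (x A B) (x A (y C (x D E)))), (- 2, y (x A B) (x C (y A (x D E)))), (2, y (x A B) (x C (y D (x A E)))),
     (- 1, y (x B C) (x A (y D (x A E)))), (1, y (x B C) (x D (y A (x A E)))), (1, y (x A B) (x (x A C) (y D E))),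
     (2, y (x A B) (x (x C D) (y A E))), (1, y (x B C) (x (x A D) (y A E))), (1, y (x A (x A B)) (x C (y D E))),
     (- 1, y (x A (x B C)) (x D (y A E))), (1, y (x B (x A C)) (x A (y D E)))])"

lemma id6_terms_eq: "id6_terms w u b c d e = sumL mon (id6_list w u b c d e)"
  by (simp add: id6_terms_def id6_list_def Let_def gen_def smult_minus)

definition id6_terms_coef :: "oper \<Rightarrow> oper \<Rightarrow> mono \<Rightarrow> nat \<Rightarrow> nat \<Rightarrow> nat \<Rightarrow> nat \<Rightarrow> int" where
  "id6_terms_coef w u t b c d e = (\<Sum>(k, m)\<leftarrow>id6_list w u b c d e. k * ec m t)"

definition id6_coef :: "oper \<Rightarrow> oper \<Rightarrow> mono \<Rightarrow> int" where
  "id6_coef w u t = (\<Sum>\<sigma> | \<sigma> permutes {1, 2, 3, 4::nat}. sign \<sigma> * id6_terms_coef w u t (\<sigma> 1) (\<sigma> 2) (\<sigma> 3) (\<sigma> 4))"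

lemma coef_id6: "coef t (id6 w u :: 'k::field fpoly) = of_int (id6_coef w u t)"
proof -
  have "coef t (sumL mon xs :: 'k fpoly) = of_int (\<Sum>(k, m)\<leftarrow>xs. k * ec m t)" for xs
    by (induction xs) (auto simp: coef_add coef_smult)
  then show ?thesis
    by (simp add: id6_def id6_coef_def coef_sum coef_smult id6_terms_eq id6_terms_coef_def)
qed

definition signed_permutations :: "(int \<times> nat \<times> nat \<times> nat \<times> nat) list" where
  "signed_permutations = [(1, 1, 2, 3, 4), (- 1, 1, 2, 4, 3), (- 1, 1, 3, 2, 4), (1, 1, 3, 4, 2), (1, 1, 4, 2, 3), (- 1, 1, 4, 3, 2),
       (- 1, 2, 1, 3, 4), (1, 2, 1, 4, 3), (1, 2, 3, 1, 4), (- 1, 2, 3, 4, 1), (- 1, 2, 4, 1, 3), (1, 2, 4, 3, 1),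
       (1, 3, 1, 2, 4), (- 1, 3, 1, 4, 2), (- 1, 3, 2, 1, 4), (1, 3, 2, 4, 1), (1, 3, 4, 1, 2), (- 1, 3, 4, 2, 1),
       (- 1, 4, 1, 2, 3), (1, 4, 1, 3, 2), (1, 4, 2, 1, 3), (- 1, 4, 2, 3, 1), (- 1, 4, 3, 1, 2), (1, 4, 3, 2, 1)]"

lemma sum_permutes4:
  "(\<Sum>\<sigma> | \<sigma> permutes {1, 2, 3, 4::nat}. sign \<sigma> * F (\<sigma> 1) (\<sigma> 2) (\<sigma> 3) (\<sigma> 4)) =
     (\<Sum>(s, b, c, d, e)\<leftarrow>signed_permutations. s * F b c d e :: int)"
proof -
  have id: "{p. p permutes {}} = {id :: nat \<Rightarrow> nat}" by auto
  have perm: "permutation (transpose a b)" for a b :: nat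
    by (rule permutation_swap_id)
  show ?thesis
    by (simp add: signed_permutations_def sum_over_permutations_insert id sign_compose perm permutation_compose sign_swap_id transpose_def)
qed

lemma inj_relabel: "inj \<pi> \<Longrightarrow> relabel \<pi> s = relabel \<pi> t \<longleftrightarrow> s = t"
  using relabel_inj[of \<pi> UNIV s t] by auto

lemma ec_relabel: "inj \<pi> \<Longrightarrow> ec (relabel \<pi> s) (relabel \<pi> t) = ec s t"
proof (induction s arbitrary: t)
  case (Var i)
  then show ?case using inj_relabel[of \<pi> t "Var i"] by auto
next
  case (Op w s1 s2)
  then show ?case by (simp add: splits_relabel case_prod_unfold o_def)
qed

text \<open>The alternating sum is reindexed by \<open>\<tau> \<circ> \<sigma>\<close> in place of
  \<open>\<sigma>\<close>; the repeated variable 0 is fixed by \<open>\<tau>\<close>.\<close>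

lemma id6_coef_relabel:
  assumes \<tau>: "\<tau> permutes {1, 2, 3, 4::nat}"
  shows "id6_coef w u (relabel \<tau> t) = sign \<tau> * id6_coef w u t"
proof -
  have inv: "inv \<tau> permutes {1, 2, 3, 4}" by (rule permutes_inv[OF \<tau>])
  have 0: "inv \<tau> 0 = 0" using inv by (simp add: permutes_def)
  have tau: "\<tau> (inv \<tau> i) = i" "inv \<tau> (\<tau> i) = i" for i
    using permutes_inverses[OF \<tau>] by auto
  have "relabel \<tau> (relabel (inv \<tau>) m) = m" for m
    by (induction m) (auto simp: tau)
  then have ec: "ec m (relabel \<tau> t) = ec (relabel (inv \<tau>) m) t" for m
    using ec_relabel[OF permutes_inj[OF \<tau>], of "relabel (inv \<tau>) m" t] by simp
  have "id6_terms_coef w u (relabel \<tau> t) b c d e = id6_terms_coef w u t (inv \<tau> b) (inv \<tau> c) (inv \<tau> d) (inv \<tau> e)" for b c d e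
    unfolding id6_terms_coef_def ec by (simp add: id6_list_def Let_def 0 del: ec.simps)
  then have "id6_coef w u (relabel \<tau> t) = (\<Sum>\<sigma> | \<sigma> permutes {1, 2, 3, 4}. sign \<sigma> *
      id6_terms_coef w u t (inv \<tau> (\<sigma> 1)) (inv \<tau> (\<sigma> 2)) (inv \<tau> (\<sigma> 3)) (inv \<tau> (\<sigma> 4)))"
    by (simp add: id6_coef_def)
  also have "\<dots> = (\<Sum>\<sigma> | \<sigma> permutes {1, 2, 3, 4}. sign (\<tau> \<circ> \<sigma>) *
      id6_terms_coef w u t (inv \<tau> ((\<tau> \<circ> \<sigma>) 1)) (inv \<tau> ((\<tau> \<circ> \<sigma>) 2)) (inv \<tau> ((\<tau> \<circ> \<sigma>) 3)) (inv \<tau> ((\<tau> \<circ> \<sigma>) 4)))"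
    by (rule setum_permutations_compose_left[OF \<tau>, of "\<lambda>\<sigma>. sign \<sigma> *
      id6_terms_coef w u t (inv \<tau> (\<sigma> 1)) (inv \<tau> (\<sigma> 2)) (inv \<tau> (\<sigma> 3)) (inv \<tau> (\<sigma> 4))"])
  also have "\<dots> = (\<Sum>\<sigma> | \<sigma> permutes {1, 2, 3, 4}. sign \<tau> * (sign \<sigma> * id6_terms_coef w u t (\<sigma> 1) (\<sigma> 2) (\<sigma> 3) (\<sigma> 4)))"
  proof (rule sum.cong)
    fix \<sigma> :: "nat \<Rightarrow> nat" assume "\<sigma> \<in> {\<sigma>. \<sigma> permutes {1, 2, 3, 4}}"
    then have "\<sigma> permutes {1, 2, 3, 4}" by simp
    then have "permutation \<sigma>" "permutation \<tau>"
      using \<tau> by (meson finite.intros permutation_permutes)+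
    then show "sign (\<tau> \<circ> \<sigma>) * id6_terms_coef w u t (inv \<tau> ((\<tau> \<circ> \<sigma>) 1)) (inv \<tau> ((\<tau> \<circ> \<sigma>) 2)) (inv \<tau> ((\<tau> \<circ> \<sigma>) 3)) (inv \<tau> ((\<tau> \<circ> \<sigma>) 4))
        = sign \<tau> * (sign \<sigma> * id6_terms_coef w u t (\<sigma> 1) (\<sigma> 2) (\<sigma> 3) (\<sigma> 4))"
      by (simp add: sign_compose tau)
  qed simp
  finally show ?thesis by (simp add: id6_coef_def sum_distrib_left)
qed

text \<open>The three values in \<^term>\<open>no_id6_shape\<close> below are those taken on the monomials of \<^term>\<open>id6_list w u b c d e\<close>
  when \<^term>\<open>w\<close> is read as addition, the other operation as multiplication, and each variable as 10.\<close>
fun shape_value :: "oper \<Rightarrow> mono \<Rightarrow> int" where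
  "shape_value w (Var i) = 10"
| "shape_value w (Op v s t) = (if v = w then shape_value w s + shape_value w t else shape_value w s * shape_value w t)"

lemma shape_value_relabel [simp]: "shape_value w (relabel \<pi> t) = shape_value w t"
  by (induction t) auto

lemma ec_shape_value: "ec s t \<noteq> 0 \<Longrightarrow> shape_value w s = shape_value w t"
  by (rule ec_invariant[of "shape_value w" "\<lambda>v x y. if v = w then x + y else x * y"]) auto

definition no_id6_shape :: "oper \<Rightarrow> mono \<Rightarrow> bool" where
  "no_id6_shape w t \<longleftrightarrow> shape_value w t \<notin> {2400, 4200, 3300}"

lemma id6_coef_zero:
  assumes "w \<noteq> u" "no_id6_shape w t"
  shows "id6_coef w u t = 0"
proof -
  have *: "ec m t = 0" if "(k, m) \<in> set (id6_list w u b c d e)" for k m b c d e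
  proof -
    have "shape_value w m \<in> {2400, 4200, 3300}"
      using that assms(1) by (auto simp: id6_list_def Let_def)
    then show ?thesis using ec_shape_value[of m t w] assms(2) by (metis no_id6_shape_def)
  qed
  then have "id6_terms_coef w u t b c d e = 0" for b c d e
  proof -
    have "map (\<lambda>(k, m). k * ec m t) (id6_list w u b c d e) = map (\<lambda>_. 0) (id6_list w u b c d e)"
      using * by (intro map_cong) auto
    then show ?thesis unfolding id6_terms_coef_def by (simp only: sum_list_0)
  qed
  then show ?thesis by (simp add: id6_coef_def)
qed

lemma permutes4_ex:
  assumes "mset [p, q, r, s] = {#1, 2, 3, 4::nat#}"
  shows "\<exists>\<tau>. \<tau> permutes {1, 2, 3, 4} \<and> \<tau> 0 = 0 \<and> \<tau> 1 = p \<and> \<tau> 2 = q \<and> \<tau> 3 = r \<and> \<tau> 4 = s"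
proof -
  define \<tau> where "\<tau> = id(1 := p, 2 := q, 3 := r, 4 := s :: nat)"
  have set: "{p, q, r, s} = {1, 2, 3, 4}"
    using arg_cong[OF assms, of set_mset] by simp
  have "distinct [p, q, r, s]"
    by (rule card_distinct) (simp add: set)
  then have "inj_on \<tau> {1, 2, 3, 4}" by (auto simp: \<tau>_def inj_on_def)
  moreover have "\<tau> ` {1, 2, 3, 4} = {1, 2, 3, 4}" using set by (simp add: \<tau>_def)
  ultimately have "\<tau> permutes {1, 2, 3, 4}"
    by (intro bij_imp_permutes) (auto simp: bij_betw_def \<tau>_def)
  then show ?thesis by (intro exI[of _ \<tau>]) (simp add: \<tau>_def)
qed

text \<open>The 15 choices of two places for the repeated label 0, with the other labels in
  increasing order. By \<open>id6_coef_relabel\<close> all other arrangements differ from these by a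
  sign.\<close>

definition arrangements :: "(nat \<times> nat \<times> nat \<times> nat \<times> nat \<times> nat) list" where
  "arrangements = [(0, 0, 1, 2, 3, 4), (0, 1, 0, 2, 3, 4), (0, 1, 2, 0, 3, 4), (0, 1, 2, 3, 0, 4), (0, 1, 2, 3, 4, 0),
     (1, 0, 0, 2, 3, 4), (1, 0, 2, 0, 3, 4), (1, 0, 2, 3, 0, 4), (1, 0, 2, 3, 4, 0), (1, 2, 0, 0, 3, 4),
     (1, 2, 0, 3, 0, 4), (1, 2, 0, 3, 4, 0), (1, 2, 3, 0, 0, 4), (1, 2, 3, 0, 4, 0), (1, 2, 3, 4, 0, 0)]"

lemma arrangement_cases:
  assumes "mset [a, b, c, d, e, f] = {#0, 0, 1, 2, 3, 4::nat#}"
  shows "\<exists>\<tau>. \<tau> permutes {1, 2, 3, 4} \<and> (\<exists>(a', b', c', d', e', f') \<in> set arrangements.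
    a = \<tau> a' \<and> b = \<tau> b' \<and> c = \<tau> c' \<and> d = \<tau> d' \<and> e = \<tau> e' \<and> f = \<tau> f')"
proof -
  have c: "count (mset [a, b, c, d, e, f]) 0 = 2" unfolding assms by simp
  have *: "mset (filter (\<lambda>i. i \<noteq> 0) [a, b, c, d, e, f]) = {#1, 2, 3, 4#}"
    unfolding mset_filter assms by simp
  have "length (filter (\<lambda>i. i \<noteq> 0) [a, b, c, d, e, f]) = 4"
    using arg_cong[OF *, of size] by (simp only: size_mset) simp
  then obtain p q r s where nz: "filter (\<lambda>i. i \<noteq> 0) [a, b, c, d, e, f] = [p, q, r, s]"
    by (auto simp: length_Suc_conv numeral_eq_Suc simp del: filter.simps)
  obtain \<tau> where \<tau>: "\<tau> permutes {1, 2, 3, 4}" "\<tau> 0 = 0" "\<tau> 1 = p" "\<tau> 2 = q" "\<tau> 3 = r" "\<tau> 4 = s"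
    using permutes4_ex[of p q r s] * unfolding nz by auto
  have "\<exists>(a', b', c', d', e', f') \<in> set arrangements.
    a = \<tau> a' \<and> b = \<tau> b' \<and> c = \<tau> c' \<and> d = \<tau> d' \<and> e = \<tau> e' \<and> f = \<tau> f'"
    apply (insert c nz \<tau>(2-))
    apply (cases "a = 0"; cases "b = 0"; cases "c = 0"; cases "d = 0"; cases "e = 0"; cases "f = 0"; simp add: arrangements_def)
    done
  then show ?thesis using \<tau>(1) by blast
qed

text \<open>The executable form of \<open>id6_coef\<close>, with the set of permutations replaced by
  a list.\<close>

definition id6_eval :: "oper \<Rightarrow> oper \<Rightarrow> mono \<Rightarrow> int" where
  "id6_eval w u t = (\<Sum>(s, b, c, d, e)\<leftarrow>signed_permutations. s * id6_terms_coef w u t b c d e)"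

lemma id6_coef_eval: "id6_coef w u t = id6_eval w u t"
  unfolding id6_coef_def id6_eval_def by (rule sum_permutes4)

text \<open>\<open>T2\<close>, \<open>T5\<close> and \<open>T7\<close> are the combs whose
  coefficients are \<open>g2\<close>, \<open>g5\<close> and \<open>g7\<close>; \<open>T2m\<close> is
  the comb of \<open>class_mid\<close>.\<close>

definition T2 where "T2 w u a b c d e f = Op u (Op w (Var a) (Var b)) (Op w (Var c) (Op w (Var d) (Op u (Var e) (Var f))))"
definition T2m where "T2m w u a b c d e f = Op u (Op w (Var a) (Var b)) (Op w (Var c) (Op w (Op u (Var d) (Var e)) (Var f)))"
definition T5 where "T5 w u a b c d e f = Op u (Op w (Var a) (Var b)) (Op w (Var c) (Op u (Var d) (Op w (Var e) (Var f))))"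
definition T7 where "T7 w u a b c d e f = Op u (Op w (Var a) (Op w (Var b) (Var c))) (Op w (Var d) (Op u (Var e) (Var f)))"

lemma T_relabel: "T2 w u (\<tau> a) (\<tau> b) (\<tau> c) (\<tau> d) (\<tau> e) (\<tau> f) = relabel \<tau> (T2 w u a b c d e f)"
  "T2m w u (\<tau> a) (\<tau> b) (\<tau> c) (\<tau> d) (\<tau> e) (\<tau> f) = relabel \<tau> (T2m w u a b c d e f)"
  "T5 w u (\<tau> a) (\<tau> b) (\<tau> c) (\<tau> d) (\<tau> e) (\<tau> f) = relabel \<tau> (T5 w u a b c d e f)"
  "T7 w u (\<tau> a) (\<tau> b) (\<tau> c) (\<tau> d) (\<tau> e) (\<tau> f) = relabel \<tau> (T7 w u a b c d e f)"
  by (simp_all add: T2_def T2m_def T5_def T7_def)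

text \<open>The relations that an identity inherits from its class sums by \<open>rel_E3\<close>,
  \<open>g2_34\<close>, \<open>rel_E4\<close> and \<open>class_mid\<close>; for \<open>id6\<close>
  they are verified by direct evaluation.\<close>

definition id6_relations :: "oper \<Rightarrow> oper \<Rightarrow> nat \<times> nat \<times> nat \<times> nat \<times> nat \<times> nat \<Rightarrow> bool" where
  "id6_relations w u = (\<lambda>(a, b, c, d, e, f).
    id6_eval w u (T2 w u a d b c e f) - id6_eval w u (T7 w u b c f a d e) + id6_eval w u (T5 w u a d b e c f) = 0 \<and>
    id6_eval w u (T2 w u a b c d e f) + id6_eval w u (T2 w u a b d c e f) = 0 \<and>
    id6_eval w u (T5 w u a b c d e f) + id6_eval w u (T5 w u c d a b e f) = 0 \<and>
    id6_eval w u (T2m w u a b c d e f) = 0)"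

lemma id6_relations_CB: "list_all (id6_relations Circ Bull) arrangements"
  by code_simp

lemma id6_relations_BC: "list_all (id6_relations Bull Circ) arrangements"
  by code_simp

lemma id6_relations:
  assumes "w \<noteq> u" and l: "mset [a, b, c, d, e, f] = {#0, 0, 1, 2, 3, 4::nat#}"
  shows "id6_coef w u (T2 w u a d b c e f) - id6_coef w u (T7 w u b c f a d e) + id6_coef w u (T5 w u a d b e c f) = 0"
    "id6_coef w u (T2 w u a b c d e f) = - id6_coef w u (T2 w u a b d c e f)"
    "id6_coef w u (T5 w u a b c d e f) = - id6_coef w u (T5 w u c d a b e f)"
    "id6_coef w u (T2m w u a b c d e f) = 0"
proof -
  obtain \<tau> a' b' c' d' e' f' where \<tau>: "\<tau> permutes {1, 2, 3, 4}" and mem: "(a', b', c', d', e', f') \<in> set arrangements"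
    and eq: "a = \<tau> a'" "b = \<tau> b'" "c = \<tau> c'" "d = \<tau> d'" "e = \<tau> e'" "f = \<tau> f'"
    using arrangement_cases[OF l] by auto
  have "id6_relations w u (a', b', c', d', e', f')"
    using assms(1) mem id6_relations_CB id6_relations_BC by (cases w; cases u) (auto simp: list_all_iff)
  then have r: "id6_coef w u (T2 w u a' d' b' c' e' f') - id6_coef w u (T7 w u b' c' f' a' d' e') + id6_coef w u (T5 w u a' d' b' e' c' f') = 0"
    "id6_coef w u (T2 w u a' b' c' d' e' f') + id6_coef w u (T2 w u a' b' d' c' e' f') = 0"
    "id6_coef w u (T5 w u a' b' c' d' e' f') + id6_coef w u (T5 w u c' d' a' b' e' f') = 0"
    "id6_coef w u (T2m w u a' b' c' d' e' f') = 0"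
    by (auto simp: id6_relations_def id6_coef_eval)
  show "id6_coef w u (T2 w u a d b c e f) - id6_coef w u (T7 w u b c f a d e) + id6_coef w u (T5 w u a d b e c f) = 0"
    "id6_coef w u (T2 w u a b c d e f) = - id6_coef w u (T2 w u a b d c e f)"
    "id6_coef w u (T5 w u a b c d e f) = - id6_coef w u (T5 w u c d a b e f)"
    "id6_coef w u (T2m w u a b c d e f) = 0"
    unfolding eq T_relabel id6_coef_relabel[OF \<tau>] using r by algebra+
qed

section \<open>Substitution and linearisation in the repeated variable\<close>

lemma splits_leaves: "(a, b) \<in> set (splits w t) \<Longrightarrow> leaves t = leaves a + leaves b"
  by (induction t arbitrary: a b) (auto split: if_splits)

lemma lf_fun_sum_list: "lf (\<lambda>s. \<Sum>x\<leftarrow>xs. g x s) p = (\<Sum>x\<leftarrow>xs. lf (g x) p)"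
proof (induction xs)
  case Nil
  then show ?case by (simp add: lf_def)
next
  case (Cons x xs)
  have "lf (\<lambda>s. g x s + (\<Sum>x\<leftarrow>xs. g x s)) p = lf (g x) p + lf (\<lambda>s. \<Sum>x\<leftarrow>xs. g x s) p"
    by (simp add: lf_def sum.distrib distrib_left)
  then show ?case using Cons by simp
qed

lemma coef_pmult:
  "coef t (pmult w p q) = (\<Sum>(a, b)\<leftarrow>splits w t. coef a p * coef b q - coef b p * coef a q)"
proof -
  have "coef t (pmult w p q) = lf (\<lambda>s1. lf (\<lambda>s2. \<Sum>z\<leftarrow>splits w t.
      of_int (ec s1 (fst z)) * of_int (ec s2 (snd z)) - of_int (ec s1 (snd z)) * of_int (ec s2 (fst z))) q) p"
    by (simp add: coef_def lf_pmult of_int_sum_list o_def case_prod_unfold)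
  also have "\<dots> = (\<Sum>z\<leftarrow>splits w t. coef (fst z) p * coef (snd z) q - coef (snd z) p * coef (fst z) q)"
    by (simp add: lf_fun_sum_list lf_fun_diff lf_scale lf_scale_right coef_def)
  finally show ?thesis by (simp add: case_prod_unfold)
qed

lemma lookup_pmult:
  "lookup (pmult w p q) (Op v a b) = (if v = w then lookup p a * lookup q b else 0)"
proof -
  have "lookup (pmult w p q) (Op v a b)
      = lf (\<lambda>s. lf (\<lambda>t. (if w = v \<and> s = a then 1 else 0) * (if t = b then 1 else 0)) q) p"
    unfolding lookup_eq_lf lf_pmult by (intro lf_cong) simp
  also have "\<dots> = (if v = w then lookup p a * lookup q b else 0)"
    by (simp add: lf_scale lf_scale_right lookup_eq_lf) (simp add: lf_def)
  finally show ?thesis .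
qed

lemma lookup_pmult_Var: "lookup (pmult w p q) (Var i) = 0"
  unfolding lookup_eq_lf lf_pmult by (simp add: lf_def)

text \<open>A variable becomes the sum of the labels in \<open>B\<close> lying over it, so a
  monomial becomes the sum of its liftings to \<open>B\<close>, and coefficients are pulled back
  along \<open>\<rho>\<close>.\<close>

definition assign :: "nat set \<Rightarrow> (nat \<Rightarrow> nat) \<Rightarrow> nat \<Rightarrow> 'k::field fpoly" where
  "assign B \<rho> i = (\<Sum>j\<in>B. if \<rho> j = i then gen j else 0)"

lemma coef_assign:
  assumes "finite B"
  shows "coef t (eval_mono pmult (assign B \<rho>) s) = (if set_mset (leaves t) \<subseteq> B then of_int (ec s (relabel \<rho> t)) else 0 :: 'k::field)"
proof (induction s arbitrary: t)
  case (Var i)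
  have "coef t (assign B \<rho> i) = (\<Sum>j\<in>B. if \<rho> j = i \<and> t = Var j then 1 else 0 :: 'k)"
    unfolding assign_def coef_sum by (rule sum.cong) (auto simp: gen_def)
  also have "\<dots> = (if set_mset (leaves t) \<subseteq> B then of_int (ec (Var i) (relabel \<rho> t)) else 0)"
  proof (cases t)
    case (Var k)
    have *: "(\<Sum>j\<in>B. if \<rho> j = i \<and> t = Var j then 1 else 0) = (\<Sum>j\<in>B. if j = k then if \<rho> k = i then 1 else 0 else (0::'k))"
      by (rule sum.cong) (auto simp: Var)
    show ?thesis unfolding * using assms by (simp add: Var)
  qed auto
  finally show ?case by simp
next
  case (Op w s1 s2)
  show ?case
  proof (cases "set_mset (leaves t) \<subseteq> B")
    case True
    have "set_mset (leaves a) \<subseteq> B \<and> set_mset (leaves b) \<subseteq> B" if "(a, b) \<in> set (splits w t)" for a b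
      using splits_leaves[OF that] True by auto
    then have "map (\<lambda>(a, b). coef a (eval_mono pmult (assign B \<rho>) s1) * coef b (eval_mono pmult (assign B \<rho>) s2)
          - coef b (eval_mono pmult (assign B \<rho>) s1) * coef a (eval_mono pmult (assign B \<rho>) s2)) (splits w t)
        = map (\<lambda>(a, b). of_int (ec s1 (relabel \<rho> a)) * of_int (ec s2 (relabel \<rho> b)) - of_int (ec s1 (relabel \<rho> b)) * of_int (ec s2 (relabel \<rho> a)) :: 'k) (splits w t)"
      by (intro map_cong) (auto simp: Op.IH)
    from arg_cong[OF this, of sum_list] show ?thesis using True
      by (simp add: coef_pmult splits_relabel of_int_sum_list o_def case_prod_unfold)
  next
    case False
    have "\<not> set_mset (leaves a) \<subseteq> B \<or> \<not> set_mset (leaves b) \<subseteq> B" if "(a, b) \<in> set (splits w t)" for a b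
      using splits_leaves[OF that] False by auto
    then have "map (\<lambda>(a, b). coef a (eval_mono pmult (assign B \<rho>) s1) * coef b (eval_mono pmult (assign B \<rho>) s2)
          - coef b (eval_mono pmult (assign B \<rho>) s1) * coef a (eval_mono pmult (assign B \<rho>) s2)) (splits w t)
        = map (\<lambda>_. 0 :: 'k) (splits w t)"
      by (intro map_cong) (auto simp: Op.IH)
    then show ?thesis using False by (simp only: eval_mono.simps coef_pmult if_False sum_list_0)
  qed
qed

lemma lookup_assign:
  assumes "finite B"
  shows "lookup (eval_mono pmult (assign B \<rho>) s) m = (if set_mset (leaves m) \<subseteq> B \<and> relabel \<rho> m = s then 1 else 0)"
proof (induction s arbitrary: m)
  case (Var i)
  have "lookup (assign B \<rho> i) m = (\<Sum>j\<in>B. if \<rho> j = i \<and> m = Var j then 1 else 0 :: 'a)"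
    unfolding assign_def Poly_Mapping.lookup_sum by (rule sum.cong) (auto simp: gen_def lookup_single when_def)
  also have "\<dots> = (if set_mset (leaves m) \<subseteq> B \<and> relabel \<rho> m = Var i then 1 else 0)"
  proof (cases m)
    case (Var k)
    have *: "(\<Sum>j\<in>B. if \<rho> j = i \<and> m = Var j then 1 else 0) = (\<Sum>j\<in>B. if j = k then if \<rho> k = i then 1 else 0 else (0::'a))"
      by (rule sum.cong) (auto simp: Var)
    show ?thesis unfolding * using assms by (simp add: Var)
  qed auto
  finally show ?case by simp
next
  case (Op w s1 s2)
  then show ?case by (cases m) (auto simp: lookup_pmult lookup_pmult_Var)
qed

lemma coef_subst_assign:
  assumes "finite B"
  shows "coef t (subst (assign B \<rho>) p) = (if set_mset (leaves t) \<subseteq> B then coef (relabel \<rho> t) p else 0)"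
proof -
  have "coef t (subst (assign B \<rho>) p) = lf (\<lambda>s. coef t (eval_mono pmult (assign B \<rho>) s)) p"
    by (simp add: coef_def lf_subst)
  then show ?thesis by (simp add: coef_assign[OF assms]) (simp add: coef_def lf_def)
qed

lemma lookup_subst_assign:
  assumes "finite B"
  shows "lookup (subst (assign B \<rho>) p) m = (if set_mset (leaves m) \<subseteq> B then lookup p (relabel \<rho> m) else 0)"
proof -
  have "lookup (subst (assign B \<rho>) p) m = lf (\<lambda>s. lookup (eval_mono pmult (assign B \<rho>) s) m) p"
    by (simp add: lookup_eq_lf lf_subst)
  also have "\<dots> = lf (\<lambda>s. if set_mset (leaves m) \<subseteq> B \<and> s = relabel \<rho> m then 1 else 0) p"
    by (rule lf_cong) (auto simp: lookup_assign[OF assms])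
  finally show ?thesis by (simp add: lookup_eq_lf) (simp add: lf_def)
qed

lemma id6_leaves:
  assumes "lookup (id6 w u) m \<noteq> 0"
  shows "leaves m = {#0, 0, 1, 2, 3, 4#}"
proof -
  have "\<exists>\<sigma>. \<sigma> permutes {1, 2, 3, 4} \<and> lookup (sumL mon (id6_list w u (\<sigma> 1) (\<sigma> 2) (\<sigma> 3) (\<sigma> 4)) :: 'a fpoly) m \<noteq> 0"
  proof (rule ccontr)
    assume "\<not> ?thesis"
    then have "lookup (id6 w u :: 'a fpoly) m = 0"
      by (auto simp: id6_def Poly_Mapping.lookup_sum id6_terms_eq intro!: sum.neutral)
    then show False using assms by simp
  qed
  then obtain \<sigma> where \<sigma>: "\<sigma> permutes {1, 2, 3, 4}"
    "lookup (sumL mon (id6_list w u (\<sigma> 1) (\<sigma> 2) (\<sigma> 3) (\<sigma> 4)) :: 'a fpoly) m \<noteq> 0" by auto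
  have "m \<in> snd ` set xs" if "lookup (sumL mon xs :: 'a fpoly) m \<noteq> 0" for xs
    using that
  proof (induction xs)
    case (Cons x xs)
    then show ?case by (cases x) (auto simp: lookup_add lookup_single when_def split: if_splits)
  qed simp
  from this[OF \<sigma>(2)] have "leaves m = {#0, 0, \<sigma> 1, \<sigma> 2, \<sigma> 3, \<sigma> 4#}"
    by (auto simp: id6_list_def Let_def)
  moreover have "image_mset \<sigma> (mset_set {1, 2, 3, 4}) = mset_set {1, 2, 3, 4}"
    using image_mset_mset_set[OF permutes_inj_on[OF \<sigma>(1)], of "{1, 2, 3, 4}"] permutes_image[OF \<sigma>(1)] by simp
  ultimately show ?thesis by simp
qed

text \<open>The default 0 is the repeated variable, so both labels outside \<open>p\<close>,
  \<open>q\<close>, \<open>r\<close>, \<open>s\<close> land there.\<close>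

definition rho :: "nat \<Rightarrow> nat \<Rightarrow> nat \<Rightarrow> nat \<Rightarrow> nat \<Rightarrow> nat" where
  "rho p q r s v = (if v = p then 1 else if v = q then 2 else if v = r then 3 else if v = s then 4 else 0)"

lemma rho_values:
  assumes "distinct [x, z, p, q, r, s]"
  shows "rho p q r s x = 0" "rho p q r s z = 0" "rho p q r s p = 1" "rho p q r s q = 2" "rho p q r s r = 3" "rho p q r s s = 4"
  using assms by (auto simp: rho_def)

text \<open>The linearisation of \<^term>\<open>id6 w u\<close> in its repeated variable, which is replaced by x and z.\<close>
definition lin6 :: "oper \<Rightarrow> oper \<Rightarrow> nat \<Rightarrow> nat \<Rightarrow> nat \<Rightarrow> nat \<Rightarrow> nat \<Rightarrow> nat \<Rightarrow> 'k::field fpoly" where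
  "lin6 w u x z p q r s = subst (assign {x, z, p, q, r, s} (rho p q r s)) (id6 w u)
     - subst (assign {x, p, q, r, s} (rho p q r s)) (id6 w u)
     - subst (assign {z, p, q, r, s} (rho p q r s)) (id6 w u)"

lemma lin6_consequence:
  "w \<noteq> u \<Longrightarrow> lin6 w u x z p q r s \<in> consequences thm43_generators"
  unfolding lin6_def
  by (intro consequences_diff consequences.sub consequences.base)
     (cases w; cases u; simp add: thm43_generators_def)+

lemma coef_lin6:
  assumes "distinct [x, z, p, q, r, s]" "leaves t = mset_set {x, z, p, q, r, s}"
  shows "coef t (lin6 w u x z p q r s) = of_int (id6_coef w u (relabel (rho p q r s) t))"
  using assms by (auto simp: lin6_def coef_diff coef_subst_assign coef_id6)

text \<open>The labels \<open>p\<close>, \<open>q\<close>, \<open>r\<close>, \<open>s\<close> occur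
  once each, and the two places of the repeated variable carry x twice, z twice, or one of each; the
  two subtracted substitutions remove the first two cases.\<close>

lemma lin6_leaves:
  assumes d: "distinct [x, z, p, q, r, s]" and m: "lookup (lin6 w u x z p q r s) m \<noteq> 0"
  shows "leaves m = mset_set {x, z, p, q, r, s}"
proof -
  let ?c = "count (leaves m)"
  have sub: "set_mset (leaves m) \<subseteq> {x, z, p, q, r, s}"
    and l: "lookup (id6 w u :: 'a fpoly) (relabel (rho p q r s) m) \<noteq> 0"
    using m by (auto simp: lin6_def lookup_minus lookup_subst_assign split: if_splits)
  have M: "leaves m = replicate_mset (?c x) x + replicate_mset (?c z) z + replicate_mset (?c p) p
      + replicate_mset (?c q) q + replicate_mset (?c r) r + replicate_mset (?c s) s"
  proof (rule multiset_eqI)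
    fix i
    show "?c i = count (replicate_mset (?c x) x + replicate_mset (?c z) z + replicate_mset (?c p) p
      + replicate_mset (?c q) q + replicate_mset (?c r) r + replicate_mset (?c s) s) i"
    proof (cases "i \<in> {x, z, p, q, r, s}")
      case True
      then show ?thesis using d by auto
    next
      case False
      then have "?c i = 0" using sub by (auto simp: not_in_iff)
      then show ?thesis using False by simp
    qed
  qed
  have "image_mset (rho p q r s) (leaves m) = {#0, 0, 1, 2, 3, 4#}"
    using id6_leaves[OF l] by (simp add: leaves_relabel)
  then have im: "replicate_mset (?c x) 0 + replicate_mset (?c z) 0 + replicate_mset (?c p) 1
      + replicate_mset (?c q) 2 + replicate_mset (?c r) 3 + replicate_mset (?c s) 4 = {#0, 0, 1, 2, 3, 4::nat#}"
    by (subst (asm) M) (simp add: rho_values[OF d])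
  have "?c x + ?c z = 2" "?c p = 1" "?c q = 1" "?c r = 1" "?c s = 1"
    using arg_cong[OF im, of "\<lambda>M. count M 0"] arg_cong[OF im, of "\<lambda>M. count M 1"] arg_cong[OF im, of "\<lambda>M. count M 2"]
      arg_cong[OF im, of "\<lambda>M. count M 3"] arg_cong[OF im, of "\<lambda>M. count M 4"] by auto
  moreover have "?c x \<noteq> 0"
  proof
    assume "?c x = 0"
    moreover from this have "?c z \<noteq> 0" using \<open>?c x + ?c z = 2\<close> by simp
    ultimately have "x \<notin># leaves m" "z \<in># leaves m" by (auto simp: not_in_iff)
    then have "set_mset (leaves m) \<subseteq> {z, p, q, r, s}" "\<not> set_mset (leaves m) \<subseteq> {x, p, q, r, s}"
      using sub d by auto
    then show False using m sub by (simp add: lin6_def lookup_minus lookup_subst_assign)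
  qed
  moreover have "?c z \<noteq> 0"
  proof
    assume "?c z = 0"
    moreover from this have "?c x \<noteq> 0" using \<open>?c x + ?c z = 2\<close> by simp
    ultimately have "z \<notin># leaves m" "x \<in># leaves m" by (auto simp: not_in_iff)
    then have "set_mset (leaves m) \<subseteq> {x, p, q, r, s}" "\<not> set_mset (leaves m) \<subseteq> {z, p, q, r, s}"
      using sub d by auto
    then show False using m sub by (simp add: lin6_def lookup_minus lookup_subst_assign)
  qed
  ultimately have "?c x = 1" "?c z = 1" "?c p = 1" "?c q = 1" "?c r = 1" "?c s = 1" by linarith+
  then show ?thesis using d by (subst M) simp
qed

text \<open>The matrix is \<open>- 2 * (I + v v^T)\<close> with
  \<open>v = (1, - 1, 1, - 1, 1)\<close>. Since \<open>v\<close> has square length 5, the inverse is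
  \<open>- 1/2 * (I - v v^T / 6)\<close>, whence the 12 in \<open>S\<close>.\<close>

lemma solve5:
  fixes d0 :: "'k::field_char_0"
  shows "\<exists>l0 l1 l2 l3 l4. - 4 * l0 + 2 * l1 - 2 * l2 + 2 * l3 - 2 * l4 = d0 \<and> 2 * l0 - 4 * l1 + 2 * l2 - 2 * l3 + 2 * l4 = d1 \<and>
    - 2 * l0 + 2 * l1 - 4 * l2 + 2 * l3 - 2 * l4 = d2 \<and> 2 * l0 - 2 * l1 + 2 * l2 - 4 * l3 + 2 * l4 = d3 \<and>
    - 2 * l0 + 2 * l1 - 2 * l2 + 2 * l3 - 4 * l4 = d4"
proof -
  define S where "S = (d0 - d1 + d2 - d3 + d4) / 12"
  show ?thesis
    by (rule exI[of _ "S - d0 / 2"], rule exI[of _ "- S - d1 / 2"], rule exI[of _ "S - d2 / 2"],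
        rule exI[of _ "- S - d3 / 2"], rule exI[of _ "S - d4 / 2"])
       (simp add: S_def field_simps)
qed

section \<open>The kernel in degree 6\<close>

lemma leaves_revs: "t' \<in> set (revs t) \<Longrightarrow> leaves t' = leaves t"
  by (induction t arbitrary: t' rule: revs.induct) (fastforce simp: union_ac split: if_splits)+

lemma revs_relabel: "revs (relabel \<pi> t) = map (relabel \<pi>) (revs t)"
  by (induction t rule: revs.induct) (auto simp: map_concat o_def intro!: arg_cong[of _ _ concat])

definition main_families :: "oper \<Rightarrow> oper \<Rightarrow> mono list" where
  "main_families w u = [T2 w u 0 1 2 3 4 5, T2m w u 0 1 2 3 4 5, T5 w u 0 1 2 3 4 5, T7 w u 0 1 2 3 4 5]"

definition vanishing_families :: "oper \<Rightarrow> oper \<Rightarrow> mono list" where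
  "vanishing_families w u =
    [Op u (Op w (Var 0) (Var 1)) (Op w (Op u (Var 2) (Var 3)) (Op u (Var 4) (Var 5))),
     Op u (Op w (Var 0) (Var 1)) (Op w (Var 2) (Op u (Var 3) (Op u (Var 4) (Var 5)))),
     Op u (Op w (Var 0) (Op w (Var 1) (Var 2))) (Op w (Var 3) (Op w (Var 4) (Var 5))),
     Op u (Op w (Var 0) (Op u (Var 1) (Var 2))) (Op w (Var 3) (Op u (Var 4) (Var 5))),
     Op w (Op u (Var 0) (Var 1)) (Op w (Op u (Var 2) (Var 3)) (Op u (Var 4) (Var 5))),
     Op u (Var 0) (Op w (Op u (Var 1) (Var 2)) (Op u (Var 3) (Op w (Var 4) (Var 5)))),
     Op w (Var 0) (Op w (Op u (Var 1) (Var 2)) (Op u (Var 3) (Op w (Var 4) (Var 5)))),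
     Op w (Var 0) (Op w (Op u (Var 1) (Op w (Var 2) (Var 3))) (Op u (Var 4) (Var 5)))]"

definition all_families :: "mono list" where
  "all_families = main_families Circ Bull @ main_families Bull Circ @ vanishing_families Circ Bull @ vanishing_families Bull Circ"

text \<open>A shape that cannot occur in \<open>id6\<close> may be isolated, since the correction
  then leaves its zero coefficient unchanged. Every other shape must agree, up to reversals of
  products, with one of the families.\<close>

definition shape_ok :: "mono list \<Rightarrow> mono \<Rightarrow> bool" where
  "shape_ok sks s \<longleftrightarrow> (if no_id6_shape Circ s \<and> no_id6_shape Bull s then
     (if isolated s then True else list_ex (\<lambda>s'. List.member sks (skel s')) (revs s))
     else list_ex (\<lambda>s'. List.member sks (skel s')) (revs s))"

text \<open>This evaluation over all shapes of degree 6 shows that the families are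
  exhaustive.\<close>

lemma shape_cases: "list_all (shape_ok (map skel all_families)) (combs 6 0 6)"
  by code_simp

lemma families_labels: "list_all (\<lambda>t. labels t = [0, 1, 2, 3, 4, 5]) all_families"
  by code_simp

lemma no_id6_shapes:
  "list_all (\<lambda>t. no_id6_shape Circ t \<and> no_id6_shape Bull t) (vanishing_families Circ Bull @ vanishing_families Bull Circ)"
  "list_all (no_id6_shape Bull) (main_families Circ Bull)" "list_all (no_id6_shape Circ) (main_families Bull Circ)"
  by code_simp+

text \<open>The arrangements that arise, with x and z sent to 0, from the 25 entries of the matrix
  in \<open>solve5\<close>.\<close>

definition id6_values :: "(int \<times> nat \<times> nat \<times> nat \<times> nat \<times> nat \<times> nat) list" where
  "id6_values =
    [(- 2, 1, 2, 0, 0, 3, 4),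
     (- 2, 1, 2, 0, 3, 4, 0),
     (- 2, 2, 0, 0, 1, 3, 4),
     (- 2, 2, 1, 0, 3, 0, 4),
     (- 2, 3, 1, 0, 0, 2, 4),
     (- 2, 3, 1, 0, 2, 4, 0),
     (- 2, 4, 0, 0, 1, 2, 3),
     (- 2, 4, 1, 0, 2, 0, 3),
     (- 4, 0, 1, 0, 2, 3, 4),
     (2, 1, 0, 0, 2, 3, 4),
     (2, 1, 2, 0, 3, 0, 4),
     (2, 2, 1, 0, 0, 3, 4),
     (2, 2, 1, 0, 3, 4, 0),
     (2, 3, 0, 0, 1, 2, 4),
     (2, 3, 1, 0, 2, 0, 4),
     (2, 4, 1, 0, 0, 2, 3),
     (2, 4, 1, 0, 2, 3, 0)]"

lemma id6_values_correct:
  "list_all (\<lambda>(k, a, b, c, d, e, f). id6_eval Circ Bull (T7 Circ Bull a b c d e f) = k \<and> id6_eval Bull Circ (T7 Bull Circ a b c d e f) = k)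
    id6_values"
  by code_simp

lemma (in bracket_identity) vanishing_families_zero:
  assumes "t \<in> set (vanishing_families w u)" "inj_on \<pi> {..<6}"
  shows "coef (relabel \<pi> t) P = 0"
proof -
  have d: "distinct [\<pi> 0, \<pi> 1, \<pi> 2, \<pi> 3, \<pi> 4, \<pi> 5]"
  proof -
    have "inj_on \<pi> (set [0, 1, 2, 3, 4, 5])" by (rule inj_on_subset[OF assms(2)]) auto
    then have "distinct (map \<pi> [0, 1, 2, 3, 4, 5])" unfolding distinct_map by simp
    then show ?thesis by simp
  qed
  note z = g3_zero[OF d] g4_zero[OF d] g6_zero[OF d] g8_zero[OF d] g9_zero[OF d] q_zero[OF d] r_zero[OF d] r'_zero[OF d]
  show ?thesis
    using assms(1) z[unfolded g3_def g4_def g6_def g8_def g9_def q_def r_def r'_def]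
    by (auto simp: vanishing_families_def)
qed

lemma lin6_relations:
  fixes x z p q r s :: nat
  defines "L w u \<equiv> lin6 w u x z p q r s :: 'k::field fpoly"
  assumes "w \<noteq> u" and d: "distinct [x, z, p, q, r, s]" and arr: "distinct [a, b, c, d, e, f]" "{a, b, c, d, e, f} = {x, z, p, q, r, s}"
  shows "coef (T2 w u a d b c e f) (L w u) - coef (T7 w u b c f a d e) (L w u) + coef (T5 w u a d b e c f) (L w u) = 0"
    "coef (T2 w u a b c d e f) (L w u) = - coef (T2 w u a b d c e f) (L w u)"
    "coef (T5 w u a b c d e f) (L w u) = - coef (T5 w u c d a b e f) (L w u)"
    "coef (T2m w u a b c d e f) (L w u) = 0"
proof -
  let ?\<rho> = "rho p q r s"
  have m: "mset [a, b, c, d, e, f] = mset [x, z, p, q, r, s]"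
    using arr d by (subst set_eq_iff_mset_eq_distinct[symmetric]) auto
  have "mset (map ?\<rho> [a, b, c, d, e, f]) = mset (map ?\<rho> [x, z, p, q, r, s])"
    unfolding mset_map m ..
  then have \<rho>: "mset [?\<rho> a, ?\<rho> b, ?\<rho> c, ?\<rho> d, ?\<rho> e, ?\<rho> f] = {#0, 0, 1, 2, 3, 4#}"
    by (simp add: rho_values[OF d])
  have V: "mset_set {x, z, p, q, r, s} = mset [a, b, c, d, e, f]"
    unfolding m using d by simp
  have l: "coef t (L w u) = of_int (id6_coef w u (relabel ?\<rho> t))" if "leaves t = mset [a, b, c, d, e, f]" for t
    unfolding L_def using that by (intro coef_lin6[OF d]) (simp only: V)
  have lT: "leaves (T2 w u a d b c e f) = mset [a, b, c, d, e, f]" "leaves (T2 w u a b c d e f) = mset [a, b, c, d, e, f]"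
    "leaves (T2 w u a b d c e f) = mset [a, b, c, d, e, f]" "leaves (T7 w u b c f a d e) = mset [a, b, c, d, e, f]"
    "leaves (T5 w u a d b e c f) = mset [a, b, c, d, e, f]" "leaves (T5 w u a b c d e f) = mset [a, b, c, d, e, f]"
    "leaves (T5 w u c d a b e f) = mset [a, b, c, d, e, f]" "leaves (T2m w u a b c d e f) = mset [a, b, c, d, e, f]"
    by (simp_all add: T2_def T2m_def T5_def T7_def)
  note R = id6_relations[OF \<open>w \<noteq> u\<close> \<rho>, unfolded T_relabel[where \<tau> = ?\<rho>]] and c = lT[THEN l]
  show "coef (T2 w u a d b c e f) (L w u) - coef (T7 w u b c f a d e) (L w u) + coef (T5 w u a d b e c f) (L w u) = 0"
    unfolding c of_int_diff[symmetric] of_int_add[symmetric] R(1) by simp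
  show "coef (T2 w u a b c d e f) (L w u) = - coef (T2 w u a b d c e f) (L w u)"
    "coef (T5 w u a b c d e f) (L w u) = - coef (T5 w u c d a b e f) (L w u)"
    "coef (T2m w u a b c d e f) (L w u) = 0"
    unfolding c R(2-4) by simp_all
qed

lemma lin6_no_shape:
  assumes "w \<noteq> u" "distinct [x, z, p, q, r, s]" "leaves t = mset_set {x, z, p, q, r, s}" "no_id6_shape w t"
  shows "coef t (lin6 w u x z p q r s) = 0"
  using assms id6_coef_zero[of w u "relabel (rho p q r s) t"] by (simp add: coef_lin6 no_id6_shape_def)

section \<open>Correction by linearisations that pair a fixed label with each of the five
  others\<close>

locale six_labels =
  fixes x0 x1 x2 x3 x4 z :: nat and V :: "nat set"
  assumes dist: "distinct [x0, x1, x2, x3, x4, z]" and V: "V = {x0, x1, x2, x3, x4, z}"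
begin

definition lin_comb :: "oper \<Rightarrow> oper \<Rightarrow> 'k \<Rightarrow> 'k \<Rightarrow> 'k \<Rightarrow> 'k \<Rightarrow> 'k \<Rightarrow> 'k::field fpoly" where
  "lin_comb w u l0 l1 l2 l3 l4 = smult l0 (lin6 w u x0 z x1 x2 x3 x4) + smult l1 (lin6 w u x1 z x0 x2 x3 x4) + smult l2 (lin6 w u x2 z x0 x1 x3 x4) + smult l3 (lin6 w u x3 z x0 x1 x2 x4) + smult l4 (lin6 w u x4 z x0 x1 x2 x3)"

lemma d: "distinct [x0, z, x1, x2, x3, x4]" "distinct [x1, z, x0, x2, x3, x4]" "distinct [x2, z, x0, x1, x3, x4]" "distinct [x3, z, x0, x1, x2, x4]" "distinct [x4, z, x0, x1, x2, x3]"
  using dist by auto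

lemma Vs: "{x0, z, x1, x2, x3, x4} = V" "{x1, z, x0, x2, x3, x4} = V" "{x2, z, x0, x1, x3, x4} = V" "{x3, z, x0, x1, x2, x4} = V" "{x4, z, x0, x1, x2, x3} = V"
  unfolding V by auto

lemma lin_comb_consequence: "w \<noteq> u \<Longrightarrow> lin_comb w u l0 l1 l2 l3 l4 \<in> consequences thm43_generators"
  unfolding lin_comb_def by (intro consequences.add consequences.scal lin6_consequence)

lemma lin_comb_leaves:
  assumes "lookup (lin_comb w u l0 l1 l2 l3 l4) m \<noteq> 0"
  shows "leaves m = mset_set V"
proof (rule ccontr)
  assume "leaves m \<noteq> mset_set V"
  then have "lookup (lin6 w u x0 z x1 x2 x3 x4 :: 'a fpoly) m = 0" "lookup (lin6 w u x1 z x0 x2 x3 x4 :: 'a fpoly) m = 0" "lookup (lin6 w u x2 z x0 x1 x3 x4 :: 'a fpoly) m = 0" "lookup (lin6 w u x3 z x0 x1 x2 x4 :: 'a fpoly) m = 0" "lookup (lin6 w u x4 z x0 x1 x2 x3 :: 'a fpoly) m = 0"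
    using d[THEN lin6_leaves] Vs by metis+
  then show False using assms by (simp add: lin_comb_def lookup_add)
qed

lemma coef_lin_comb:
  "coef t (lin_comb w u l0 l1 l2 l3 l4) = l0 * coef t (lin6 w u x0 z x1 x2 x3 x4) + l1 * coef t (lin6 w u x1 z x0 x2 x3 x4) + l2 * coef t (lin6 w u x2 z x0 x1 x3 x4) + l3 * coef t (lin6 w u x3 z x0 x1 x2 x4) + l4 * coef t (lin6 w u x4 z x0 x1 x2 x3)"
  by (simp add: lin_comb_def coef_add coef_smult)

lemma lin_comb_no_shape:
  assumes "w \<noteq> u" "leaves t = mset_set V" "no_id6_shape w t"
  shows "coef t (lin_comb w u l0 l1 l2 l3 l4) = 0"
  unfolding coef_lin_comb using assms d Vs by (simp add: lin6_no_shape)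

lemma lin_comb_relations:
  fixes l0 l1 l2 l3 l4 :: "'k::field"
  assumes "w \<noteq> u" and arr: "distinct [a, b, c, d, e, f]" "{a, b, c, d, e, f} = V"
  defines "L \<equiv> lin_comb w u l0 l1 l2 l3 l4"
  shows "coef (T2 w u a d b c e f) L - coef (T7 w u b c f a d e) L + coef (T5 w u a d b e c f) L = 0"
    "coef (T2 w u a b c d e f) L = - coef (T2 w u a b d c e f) L"
    "coef (T5 w u a b c d e f) L = - coef (T5 w u c d a b e f) L"
    "coef (T2m w u a b c d e f) L = 0"
proof -
  note R1 = lin6_relations[where 'k='k, OF assms(1) d(1) arr(1) arr(2)[folded Vs(1)]]
  note R2 = lin6_relations[where 'k='k, OF assms(1) d(2) arr(1) arr(2)[folded Vs(2)]]
  note R3 = lin6_relations[where 'k='k, OF assms(1) d(3) arr(1) arr(2)[folded Vs(3)]]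
  note R4 = lin6_relations[where 'k='k, OF assms(1) d(4) arr(1) arr(2)[folded Vs(4)]]
  note R5 = lin6_relations[where 'k='k, OF assms(1) d(5) arr(1) arr(2)[folded Vs(5)]]
  show "coef (T2 w u a d b c e f) L - coef (T7 w u b c f a d e) L + coef (T5 w u a d b e c f) L = 0"
    unfolding L_def coef_lin_comb using R1(1) R2(1) R3(1) R4(1) R5(1) by algebra
  show "coef (T2 w u a b c d e f) L = - coef (T2 w u a b d c e f) L"
    unfolding L_def coef_lin_comb R1(2) R2(2) R3(2) R4(2) R5(2) by simp
  show "coef (T5 w u a b c d e f) L = - coef (T5 w u c d a b e f) L"
    unfolding L_def coef_lin_comb R1(3) R2(3) R3(3) R4(3) R5(3) by simp
  show "coef (T2m w u a b c d e f) L = 0"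
    unfolding L_def coef_lin_comb R1(4) R2(4) R3(4) R4(4) R5(4) by simp
qed

text \<open>By \<open>all_zero\<close> a solution of the relations is determined by one value of
  \<open>g7\<close> with x first and z third for each label x other than z.\<close>

definition agree :: "oper \<Rightarrow> oper \<Rightarrow> 'k::field fpoly \<Rightarrow> 'k fpoly \<Rightarrow> bool" where
  "agree w u P Q \<longleftrightarrow> coef (T7 w u x0 x1 z x2 x3 x4) P = coef (T7 w u x0 x1 z x2 x3 x4) Q \<and>
    coef (T7 w u x1 x0 z x2 x3 x4) P = coef (T7 w u x1 x0 z x2 x3 x4) Q \<and>
    coef (T7 w u x2 x0 z x1 x3 x4) P = coef (T7 w u x2 x0 z x1 x3 x4) Q \<and>
    coef (T7 w u x3 x0 z x1 x2 x4) P = coef (T7 w u x3 x0 z x1 x2 x4) Q \<and>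
    coef (T7 w u x4 x0 z x1 x2 x3) P = coef (T7 w u x4 x0 z x1 x2 x3) Q"

lemma lin_comb_ex:
  fixes P :: "'k::field_char_0 fpoly"
  assumes "w \<noteq> u"
  shows "\<exists>l0 l1 l2 l3 l4. agree w u P (lin_comb w u l0 l1 l2 l3 l4)"
proof -
  have val: "id6_coef w u (T7 w u a b c d e f) = k"
    if "(k, a, b, c, d, e, f) \<in> set id6_values" for k a b c d e f
    using id6_values_correct that assms unfolding id6_coef_eval list_all_iff by (cases w; cases u) fastforce+
  have lin: "coef (T7 w u a b c d e f) (lin6 w u x z p q r s :: 'k fpoly) = of_int k"
    if "distinct [x, z, p, q, r, s]" "mset [a, b, c, d, e, f] = mset [x, z, p, q, r, s]"
      "(k, rho p q r s a, rho p q r s b, rho p q r s c, rho p q r s d, rho p q r s e, rho p q r s f) \<in> set id6_values"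
    for k a b c d e f x z p q r s
  proof -
    have "leaves (T7 w u a b c d e f) = mset_set {x, z, p, q, r, s}"
    proof -
      have "leaves (T7 w u a b c d e f) = mset [a, b, c, d, e, f]"
        by (simp add: T7_def add_mset_commute)
      also have "\<dots> = mset_set {x, z, p, q, r, s}" unfolding that(2) using that(1) by simp
      finally show ?thesis .
    qed
    then have "coef (T7 w u a b c d e f) (lin6 w u x z p q r s :: 'k fpoly) = of_int (id6_coef w u (relabel (rho p q r s) (T7 w u a b c d e f)))"
      by (rule coef_lin6[OF that(1)])
    then show ?thesis unfolding T_relabel[symmetric] val[OF that(3)] .
  qed
  \<comment> \<open>The linearisation pairing a label x with z belongs to a multiple of the function
    p with value 1 at x and - 1 at z. Then \<open>p y - p z\<close> is 2 for y = x and 1 for the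
    other labels, which explains 4 against 2; the signs come from the order of the labels.\<close>
  have cv: "coef (T7 w u x0 x1 z x2 x3 x4) (lin6 w u x0 z x1 x2 x3 x4 :: 'k fpoly) = of_int (- 4)"
    "coef (T7 w u x0 x1 z x2 x3 x4) (lin6 w u x1 z x0 x2 x3 x4 :: 'k fpoly) = of_int (2)"
    "coef (T7 w u x0 x1 z x2 x3 x4) (lin6 w u x2 z x0 x1 x3 x4 :: 'k fpoly) = of_int (- 2)"
    "coef (T7 w u x0 x1 z x2 x3 x4) (lin6 w u x3 z x0 x1 x2 x4 :: 'k fpoly) = of_int (2)"
    "coef (T7 w u x0 x1 z x2 x3 x4) (lin6 w u x4 z x0 x1 x2 x3 :: 'k fpoly) = of_int (- 2)"
    "coef (T7 w u x1 x0 z x2 x3 x4) (lin6 w u x0 z x1 x2 x3 x4 :: 'k fpoly) = of_int (2)"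
    "coef (T7 w u x1 x0 z x2 x3 x4) (lin6 w u x1 z x0 x2 x3 x4 :: 'k fpoly) = of_int (- 4)"
    "coef (T7 w u x1 x0 z x2 x3 x4) (lin6 w u x2 z x0 x1 x3 x4 :: 'k fpoly) = of_int (2)"
    "coef (T7 w u x1 x0 z x2 x3 x4) (lin6 w u x3 z x0 x1 x2 x4 :: 'k fpoly) = of_int (- 2)"
    "coef (T7 w u x1 x0 z x2 x3 x4) (lin6 w u x4 z x0 x1 x2 x3 :: 'k fpoly) = of_int (2)"
    "coef (T7 w u x2 x0 z x1 x3 x4) (lin6 w u x0 z x1 x2 x3 x4 :: 'k fpoly) = of_int (- 2)"
    "coef (T7 w u x2 x0 z x1 x3 x4) (lin6 w u x1 z x0 x2 x3 x4 :: 'k fpoly) = of_int (2)"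
    "coef (T7 w u x2 x0 z x1 x3 x4) (lin6 w u x2 z x0 x1 x3 x4 :: 'k fpoly) = of_int (- 4)"
    "coef (T7 w u x2 x0 z x1 x3 x4) (lin6 w u x3 z x0 x1 x2 x4 :: 'k fpoly) = of_int (2)"
    "coef (T7 w u x2 x0 z x1 x3 x4) (lin6 w u x4 z x0 x1 x2 x3 :: 'k fpoly) = of_int (- 2)"
    "coef (T7 w u x3 x0 z x1 x2 x4) (lin6 w u x0 z x1 x2 x3 x4 :: 'k fpoly) = of_int (2)"
    "coef (T7 w u x3 x0 z x1 x2 x4) (lin6 w u x1 z x0 x2 x3 x4 :: 'k fpoly) = of_int (- 2)"
    "coef (T7 w u x3 x0 z x1 x2 x4) (lin6 w u x2 z x0 x1 x3 x4 :: 'k fpoly) = of_int (2)"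
    "coef (T7 w u x3 x0 z x1 x2 x4) (lin6 w u x3 z x0 x1 x2 x4 :: 'k fpoly) = of_int (- 4)"
    "coef (T7 w u x3 x0 z x1 x2 x4) (lin6 w u x4 z x0 x1 x2 x3 :: 'k fpoly) = of_int (2)"
    "coef (T7 w u x4 x0 z x1 x2 x3) (lin6 w u x0 z x1 x2 x3 x4 :: 'k fpoly) = of_int (- 2)"
    "coef (T7 w u x4 x0 z x1 x2 x3) (lin6 w u x1 z x0 x2 x3 x4 :: 'k fpoly) = of_int (2)"
    "coef (T7 w u x4 x0 z x1 x2 x3) (lin6 w u x2 z x0 x1 x3 x4 :: 'k fpoly) = of_int (- 2)"
    "coef (T7 w u x4 x0 z x1 x2 x3) (lin6 w u x3 z x0 x1 x2 x4 :: 'k fpoly) = of_int (2)"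
    "coef (T7 w u x4 x0 z x1 x2 x3) (lin6 w u x4 z x0 x1 x2 x3 :: 'k fpoly) = of_int (- 4)"
    by (rule lin; use dist in \<open>auto simp: rho_def id6_values_def\<close>)+
  obtain l0 l1 l2 l3 l4 where l: "- 4 * l0 + 2 * l1 - 2 * l2 + 2 * l3 - 2 * l4 = coef (T7 w u x0 x1 z x2 x3 x4) P" "2 * l0 - 4 * l1 + 2 * l2 - 2 * l3 + 2 * l4 = coef (T7 w u x1 x0 z x2 x3 x4) P" "- 2 * l0 + 2 * l1 - 4 * l2 + 2 * l3 - 2 * l4 = coef (T7 w u x2 x0 z x1 x3 x4) P" "2 * l0 - 2 * l1 + 2 * l2 - 4 * l3 + 2 * l4 = coef (T7 w u x3 x0 z x1 x2 x4) P" "- 2 * l0 + 2 * l1 - 2 * l2 + 2 * l3 - 4 * l4 = coef (T7 w u x4 x0 z x1 x2 x3) P"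
    using solve5[of "coef (T7 w u x0 x1 z x2 x3 x4) P" "coef (T7 w u x1 x0 z x2 x3 x4) P" "coef (T7 w u x2 x0 z x1 x3 x4) P" "coef (T7 w u x3 x0 z x1 x2 x4) P" "coef (T7 w u x4 x0 z x1 x2 x3) P"] that by (elim exE conjE) blast
  have "coef (T7 w u x0 x1 z x2 x3 x4) P = coef (T7 w u x0 x1 z x2 x3 x4) (lin_comb w u l0 l1 l2 l3 l4)"
    unfolding coef_lin_comb cv l(1)[symmetric] by simp
  moreover have "coef (T7 w u x1 x0 z x2 x3 x4) P = coef (T7 w u x1 x0 z x2 x3 x4) (lin_comb w u l0 l1 l2 l3 l4)"
    unfolding coef_lin_comb cv l(2)[symmetric] by simp
  moreover have "coef (T7 w u x2 x0 z x1 x3 x4) P = coef (T7 w u x2 x0 z x1 x3 x4) (lin_comb w u l0 l1 l2 l3 l4)"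
    unfolding coef_lin_comb cv l(3)[symmetric] by simp
  moreover have "coef (T7 w u x3 x0 z x1 x2 x4) P = coef (T7 w u x3 x0 z x1 x2 x4) (lin_comb w u l0 l1 l2 l3 l4)"
    unfolding coef_lin_comb cv l(4)[symmetric] by simp
  moreover have "coef (T7 w u x4 x0 z x1 x2 x3) P = coef (T7 w u x4 x0 z x1 x2 x3) (lin_comb w u l0 l1 l2 l3 l4)"
    unfolding coef_lin_comb cv l(5)[symmetric] by simp
  ultimately show ?thesis unfolding agree_def
    by (intro exI[of _ l0] exI[of _ l1] exI[of _ l2] exI[of _ l3] exI[of _ l4] conjI)
qed

lemma card_V: "card V = 6"
  using dist by (simp add: V)

lemma V_eqI:
  assumes "distinct [a, b, c, d, e, f]" "{a, b, c, d, e, f} \<subseteq> V"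
  shows "{a, b, c, d, e, f} = V"
proof (rule card_subset_eq)
  show "finite V" by (simp add: V)
  show "card {a, b, c, d, e, f} = card V" using distinct_card[OF assms(1)] by (simp add: card_V)
qed (rule assms(2))

lemma leaves_T:
  assumes "distinct [a, b, c, d, e, f]" "{a, b, c, d, e, f} = V"
  shows "leaves (T2 w u a b c d e f) = mset_set V" "leaves (T2m w u a b c d e f) = mset_set V"
    "leaves (T5 w u a b c d e f) = mset_set V" "leaves (T7 w u a b c d e f) = mset_set V"
proof -
  have "mset_set V = mset [a, b, c, d, e, f]" using assms by auto
  then show "leaves (T2 w u a b c d e f) = mset_set V" "leaves (T2m w u a b c d e f) = mset_set V"
    "leaves (T5 w u a b c d e f) = mset_set V" "leaves (T7 w u a b c d e f) = mset_set V"
    by (simp_all add: T2_def T2m_def T5_def T7_def add_mset_commute)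
qed

lemma no_id6_shape_T:
  assumes "w \<noteq> u"
  shows "no_id6_shape u (T2 w u a b c d e f)" "no_id6_shape u (T2m w u a b c d e f)"
    "no_id6_shape u (T5 w u a b c d e f)" "no_id6_shape u (T7 w u a b c d e f)"
  using assms by (simp_all add: no_id6_shape_def T2_def T2m_def T5_def T7_def)

text \<open>Symmetries and the shuffle relation hold for every polynomial. The relations from class
  sums hold for \<open>P\<close> and for the first combination, and the second one, with the
  operations exchanged, has no coefficient on these shapes. So \<open>D\<close> satisfies all the
  relations, and \<open>agree\<close> supplies the zeros that \<open>all_zero\<close> asks
  for.\<close>

lemma main_families_zero:
  fixes P :: "'k::field_char_0 fpoly" and l0 l1 l2 l3 l4 m0 m1 m2 m3 m4 :: 'k
  assumes P: "bracket_identity_in_AIA P" and wu: "w \<noteq> u" and agree: "agree w u P (lin_comb w u l0 l1 l2 l3 l4)"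
    and arr: "distinct [a, b, c, d, e, f]" "{a, b, c, d, e, f} \<subseteq> V"
  defines "D \<equiv> P - lin_comb w u l0 l1 l2 l3 l4 - lin_comb u w m0 m1 m2 m3 m4"
  shows "coef (T2 w u a b c d e f) D = 0" "coef (T2m w u a b c d e f) D = 0"
    "coef (T5 w u a b c d e f) D = 0" "coef (T7 w u a b c d e f) D = 0"
proof -
  let ?A = "lin_comb w u l0 l1 l2 l3 l4"
  interpret B: bracket_identity P w u by unfold_locales (rule wu, rule P)
  interpret E: two_operations D w u by unfold_locales (rule wu)
  have noB: "coef t (lin_comb u w m0 m1 m2 m3 m4) = 0" if "leaves t = mset_set V" "no_id6_shape u t" for t
    by (rule lin_comb_no_shape[OF wu[symmetric] that])
  have D: "coef (T2 w u a b c d e f) D = coef (T2 w u a b c d e f) P - coef (T2 w u a b c d e f) ?A"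
    "coef (T2m w u a b c d e f) D = coef (T2m w u a b c d e f) P - coef (T2m w u a b c d e f) ?A"
    "coef (T5 w u a b c d e f) D = coef (T5 w u a b c d e f) P - coef (T5 w u a b c d e f) ?A"
    "coef (T7 w u a b c d e f) D = coef (T7 w u a b c d e f) P - coef (T7 w u a b c d e f) ?A"
    if "distinct [a, b, c, d, e, f]" "{a, b, c, d, e, f} \<subseteq> V" for a b c d e f
    unfolding D_def coef_diff noB[OF leaves_T(1)[OF that(1) V_eqI[OF that]] no_id6_shape_T(1)[OF wu]]
      noB[OF leaves_T(2)[OF that(1) V_eqI[OF that]] no_id6_shape_T(2)[OF wu]]
      noB[OF leaves_T(3)[OF that(1) V_eqI[OF that]] no_id6_shape_T(3)[OF wu]]
      noB[OF leaves_T(4)[OF that(1) V_eqI[OF that]] no_id6_shape_T(4)[OF wu]]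
    by (rule diff_zero)+
  interpret R: alternating_relations V "\<lambda>a b c d e f. coef (T2 w u a b c d e f) D"
    "\<lambda>a b c d e f. coef (T5 w u a b c d e f) D" "\<lambda>a b c d e f. coef (T7 w u a b c d e f) D"
  proof
    fix a b c d e f
    show "coef (T2 w u a b c d e f) D = - coef (T2 w u b a c d e f) D"
      "coef (T2 w u a b c d e f) D = - coef (T2 w u a b c d f e) D"
      unfolding T2_def by (rule E.g2_12[unfolded E.g2_def] E.g2_56[unfolded E.g2_def])+
    show "coef (T5 w u a b c d e f) D = - coef (T5 w u b a c d e f) D"
      "coef (T5 w u a b c d e f) D = - coef (T5 w u a b c d f e) D"
      unfolding T5_def by (rule E.g5_12[unfolded E.g5_def] E.g5_56[unfolded E.g5_def])+
    show "coef (T7 w u a b c d e f) D = coef (T7 w u c b a d e f) D"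
      "coef (T7 w u a b c d e f) D = - coef (T7 w u a b c d f e) D"
      "coef (T7 w u a b c d e f) D + coef (T7 w u b a c d e f) D + coef (T7 w u b c a d e f) D = 0"
      unfolding T7_def by (rule E.g7_13[unfolded E.g7_def] E.g7_56[unfolded E.g7_def] E.g7_shuffle[unfolded E.g7_def])+
    assume d: "distinct [a, b, c, d, e, f]" "{a, b, c, d, e, f} \<subseteq> V"
    note d' = d(1) V_eqI[OF d]
    note rel = lin_comb_relations[OF wu d', of l0 l1 l2 l3 l4]
    have arrs: "distinct [a, b, d, c, e, f]" "{a, b, d, c, e, f} \<subseteq> V" "distinct [c, d, a, b, e, f]" "{c, d, a, b, e, f} \<subseteq> V"
      "distinct [a, d, b, c, e, f]" "{a, d, b, c, e, f} \<subseteq> V" "distinct [b, c, f, a, d, e]" "{b, c, f, a, d, e} \<subseteq> V"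
      "distinct [a, d, b, e, c, f]" "{a, d, b, e, c, f} \<subseteq> V"
      using d distinct_rev6[OF d(1)] by auto
    show "coef (T2 w u a b c d e f) D = - coef (T2 w u a b d c e f) D"
      unfolding D(1)[OF d] D(1)[OF arrs(1,2)] rel(2)
      unfolding T2_def B.g2_34[OF d(1), unfolded B.g2_def] by simp
    show "coef (T5 w u a b c d e f) D = - coef (T5 w u c d a b e f) D"
    proof -
      have "coef (T5 w u a b c d e f) P = - coef (T5 w u c d a b e f) P"
        unfolding T5_def
        by (rule B.rel_E4[of a c b e f d, unfolded B.g5_def]) (use d distinct_rev6[OF d(1)] in auto)
      then show ?thesis unfolding D(3)[OF d] D(3)[OF arrs(3,4)] rel(3) by simp
    qed
    show "coef (T2 w u a d b c e f) D - coef (T7 w u b c f a d e) D + coef (T5 w u a d b e c f) D = 0"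
    proof -
      have "coef (T2 w u a d b c e f) P - coef (T7 w u b c f a d e) P + coef (T5 w u a d b e c f) P = 0"
        using B.rel_E3[OF d(1)] unfolding B.g2_def B.g5_def B.g7_def T2_def T5_def T7_def .
      then show ?thesis unfolding D(1)[OF arrs(5,6)] D(4)[OF arrs(7,8)] D(3)[OF arrs(9,10)] using rel(1) by algebra
    qed
  qed
  have zero: "\<exists>p q r s. distinct [x, p, z, q, r, s] \<and> {x, p, z, q, r, s} \<subseteq> V \<and> coef (T7 w u x p z q r s) D = 0"
    if "x \<in> V" "x \<noteq> z" for x
  proof -
    from that consider "x = x0" | "x = x1" | "x = x2" | "x = x3" | "x = x4" by (auto simp: V)
    then show ?thesis
    proof cases
      case 1
      have "distinct [x0, x1, z, x2, x3, x4]" "{x0, x1, z, x2, x3, x4} \<subseteq> V" using dist by (auto simp: V)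
      then show ?thesis unfolding 1 using agree[unfolded agree_def] D(4)
        by (intro exI[of _ x1] exI[of _ x2] exI[of _ x3] exI[of _ x4]) simp
    next
      case 2
      have "distinct [x1, x0, z, x2, x3, x4]" "{x1, x0, z, x2, x3, x4} \<subseteq> V" using dist by (auto simp: V)
      then show ?thesis unfolding 2 using agree[unfolded agree_def] D(4)
        by (intro exI[of _ x0] exI[of _ x2] exI[of _ x3] exI[of _ x4]) simp
    next
      case 3
      have "distinct [x2, x0, z, x1, x3, x4]" "{x2, x0, z, x1, x3, x4} \<subseteq> V" using dist by (auto simp: V)
      then show ?thesis unfolding 3 using agree[unfolded agree_def] D(4)
        by (intro exI[of _ x0] exI[of _ x1] exI[of _ x3] exI[of _ x4]) simp
    next
      case 4
      have "distinct [x3, x0, z, x1, x2, x4]" "{x3, x0, z, x1, x2, x4} \<subseteq> V" using dist by (auto simp: V)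
      then show ?thesis unfolding 4 using agree[unfolded agree_def] D(4)
        by (intro exI[of _ x0] exI[of _ x1] exI[of _ x2] exI[of _ x4]) simp
    next
      case 5
      have "distinct [x4, x0, z, x1, x2, x3]" "{x4, x0, z, x1, x2, x3} \<subseteq> V" using dist by (auto simp: V)
      then show ?thesis unfolding 5 using agree[unfolded agree_def] D(4)
        by (intro exI[of _ x0] exI[of _ x1] exI[of _ x2] exI[of _ x3]) simp
    qed
  qed
  have z: "z \<in> V" by (simp add: V)
  show "coef (T7 w u a b c d e f) D = 0" "coef (T2 w u a b c d e f) D = 0" "coef (T5 w u a b c d e f) D = 0"
    by (rule R.all_zero[OF card_V z zero arr]; assumption)+
  have "coef (T2m w u a b c d e f) P = 0"
    using class_mid[OF P wu arr(1)] unfolding T2m_def .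
  then show "coef (T2m w u a b c d e f) D = 0"
    unfolding D(2)[OF arr] lin_comb_relations(4)[OF wu arr(1) V_eqI[OF arr]] by simp
qed

lemma identity_is_consequence:
  fixes P :: "'k::field_char_0 fpoly"
  assumes P: "bracket_identity_in_AIA P" and ml: "\<And>s. s \<in> keys P \<Longrightarrow> leaves s = mset_set V"
  shows "P \<in> consequences thm43_generators"
proof -
  interpret lie_identities "thm43_generators :: 'k fpoly set"
  proof
    fix w :: oper
    show "anticomm_id w \<in> (thm43_generators :: 'k fpoly set)" "jacobi_id w \<in> (thm43_generators :: 'k fpoly set)"
      by (cases w; simp add: thm43_generators_def)+
  qed
  obtain l0 l1 l2 l3 l4 where l: "agree Circ Bull P (lin_comb Circ Bull l0 l1 l2 l3 l4)"
    using lin_comb_ex[of Circ Bull P] by auto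
  obtain m0 m1 m2 m3 m4 where m: "agree Bull Circ P (lin_comb Bull Circ m0 m1 m2 m3 m4)"
    using lin_comb_ex[of Bull Circ P] by auto
  define A where "A = lin_comb Circ Bull l0 l1 l2 l3 l4"
  define B where "B = lin_comb Bull Circ m0 m1 m2 m3 m4"
  define D where "D = P - A - B"
  \<comment> \<open>The two combinations enter symmetrically, so \<open>main_families_zero\<close>
    applies to \<open>D\<close> for either outer operation.\<close>
  have D': "D = P - B - A" by (simp add: D_def)
  have fin: "finite V" by (simp add: V)
  have no_shape: "coef t D = coef t P" if "leaves t = mset_set V" "no_id6_shape Circ t" "no_id6_shape Bull t" for t
    using lin_comb_no_shape[of Circ Bull t l0 l1 l2 l3 l4] lin_comb_no_shape[of Bull Circ t m0 m1 m2 m3 m4] that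
    by (simp add: D_def A_def B_def coef_diff)
  have family: "coef (relabel \<pi> F) D = 0"
    if F: "F \<in> set all_families" and \<pi>: "inj_on \<pi> {..<6}" "leaves (relabel \<pi> F) = mset_set V" for F \<pi>
  proof -
    have labels: "labels F = [0, 1, 2, 3, 4, 5]" using F families_labels by (auto simp: list_all_iff)
    have mV: "mset_set V = mset [\<pi> 0, \<pi> 1, \<pi> 2, \<pi> 3, \<pi> 4, \<pi> 5]"
      unfolding \<pi>(2)[symmetric] mset_labels[symmetric] labels_relabel labels by simp
    have set: "{\<pi> 0, \<pi> 1, \<pi> 2, \<pi> 3, \<pi> 4, \<pi> 5} \<subseteq> V"
      using arg_cong[OF mV, of set_mset] fin by simp
    have "card (set [\<pi> 0, \<pi> 1, \<pi> 2, \<pi> 3, \<pi> 4, \<pi> 5]) = card V"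
      using arg_cong[OF mV, of set_mset] fin by simp
    then have dis: "distinct [\<pi> 0, \<pi> 1, \<pi> 2, \<pi> 3, \<pi> 4, \<pi> 5]"
      by (intro card_distinct) (simp add: card_V)
    have CB: "Circ \<noteq> Bull" and BC: "Bull \<noteq> Circ" by auto
    note z1 = main_families_zero[OF P CB l dis set, of m0 m1 m2 m3 m4, folded A_def B_def, folded D_def]
    note z2 = main_families_zero[OF P BC m dis set, of l0 l1 l2 l3 l4, folded A_def B_def, folded D']
    from F consider "F \<in> set (main_families Circ Bull)" | "F \<in> set (main_families Bull Circ)"
      | "F \<in> set (vanishing_families Circ Bull)" | "F \<in> set (vanishing_families Bull Circ)"
      by (auto simp: all_families_def)
    then show ?thesis
    proof cases
      case 1
      then show ?thesis using z1 by (auto simp: main_families_def T_relabel[symmetric])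
    next
      case 2
      then show ?thesis using z2 by (auto simp: main_families_def T_relabel[symmetric])
    next
      case 3
      interpret I: bracket_identity P Circ Bull by unfold_locales (simp, rule P)
      have "no_id6_shape Circ F \<and> no_id6_shape Bull F" using no_id6_shapes(1) 3 by (auto simp: list_all_iff)
      then show ?thesis
        using no_shape[OF \<pi>(2)] I.vanishing_families_zero[OF 3 \<pi>(1)] by (simp add: no_id6_shape_def)
    next
      case 4
      interpret I: bracket_identity P Bull Circ by unfold_locales (simp, rule P)
      have "no_id6_shape Circ F \<and> no_id6_shape Bull F" using no_id6_shapes(1) 4 by (auto simp: list_all_iff)
      then show ?thesis
        using no_shape[OF \<pi>(2)] I.vanishing_families_zero[OF 4 \<pi>(1)] by (simp add: no_id6_shape_def)
    qed
  qed
  have inj: "inj_on ((!) (labels t)) {..<6}" and deg: "deg t = 6" if "leaves t = mset_set V" for t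
  proof -
    have m: "mset (labels t) = mset_set V" using that by (simp add: mset_labels)
    have "size (mset (labels t)) = 6" unfolding m by (simp add: card_V)
    then show "deg t = 6" by (simp add: length_labels)
    have "card (set (labels t)) = length (labels t)"
      using arg_cong[OF m, of set_mset] \<open>size (mset (labels t)) = 6\<close> fin by (simp add: card_V)
    then have "distinct (labels t)" by (rule card_distinct)
    then show "inj_on ((!) (labels t)) {..<6}"
      by (rule inj_on_nth) (simp add: length_labels \<open>deg t = 6\<close>)
  qed
  have zero: "coef t D = 0" if t: "right_comb t" "leaves t = mset_set V" for t
  proof -
    \<comment> \<open>The enumerated comb of the same shape as \<open>t\<close>; reading the labels
      of \<open>t\<close> from left to right gives the relabelling that turns \<open>s\<close> into
      \<open>t\<close>.\<close>
    obtain s where s: "s \<in> set (combs 6 0 6)" "labels s = [0..<6]" "skel s = skel t"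
      using combs_complete[OF t(1), of 6 0] deg[OF t(2)] by auto
    have ts: "t = relabel ((!) (labels t)) s"
      by (rule skel_relabel[OF s(3)[symmetric] s(2)])
    have "shape_ok (map skel all_families) s"
      using shape_cases s(1) by (auto simp: list_all_iff)
    then consider "isolated s" "no_id6_shape Circ s" "no_id6_shape Bull s"
      | s' where "s' \<in> set (revs s)" "skel s' \<in> skel ` set all_families"
      by (auto simp: shape_ok_def list_ex_iff split: if_splits)
    then show ?thesis
    proof cases
      case 1
      have "coef t P = 0"
        using isolated_coef[OF P 1(1) inj[OF t(2)]] ts by simp
      moreover have "no_id6_shape w t = no_id6_shape w s" for w
        by (subst ts) (simp add: no_id6_shape_def)
      ultimately show ?thesis using no_shape[OF t(2)] 1 by simp
    next
      case 2
      then obtain F where F: "F \<in> set all_families" "skel s' = skel F" by auto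
      have lvF: "labels F = [0..<6]" using F(1) families_labels by (auto simp: list_all_iff upt_rec)
      let ?t = "relabel ((!) (labels t)) s'"
      have r: "?t \<in> set (revs t)"
        by (subst (2) ts) (simp add: revs_relabel 2(1))
      have lt: "leaves ?t = mset_set V" using leaves_revs[OF r] t(2) by simp
      have "skel ?t = skel F" using F(2) by simp
      from skel_relabel[OF this lvF] have tF: "?t = relabel ((!) (labels ?t)) F" .
      have "coef (relabel ((!) (labels ?t)) F) D = 0"
        using family[OF F(1) inj[OF lt]] lt tF by metis
      then have "coef ?t D = 0" using tF by metis
      then show ?thesis by (rule coef_revs[OF t(1) r])
    qed
  qed
  have "D \<in> consequences thm43_generators"
  proof (rule consequence_if_coef_zero[of D V, OF _ zero])
    fix s assume "s \<in> keys D"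
    then have "lookup P s \<noteq> 0 \<or> lookup A s \<noteq> 0 \<or> lookup B s \<noteq> 0"
      by (auto simp: D_def in_keys_iff lookup_minus)
    then show "leaves s = mset_set V"
      using ml[of s] lin_comb_leaves unfolding A_def B_def in_keys_iff by blast
  qed
  moreover have "A \<in> consequences thm43_generators" "B \<in> consequences thm43_generators"
    unfolding A_def B_def by (rule lin_comb_consequence, simp)+
  ultimately have "D + A + B \<in> consequences thm43_generators"
    by (intro consequences.add)
  then show ?thesis by (simp add: D_def)
qed

end

theorem theorem4p3:
  fixes f :: "'k::field_char_0 fpoly"
  assumes "multilinear_deg 6 f"
    and "bracket_identity_in_AIA f"
  shows "f \<in> consequences thm43_generators"
proof -
  obtain V where ml: "finite V" "card V = 6" "\<And>s. s \<in> keys f \<Longrightarrow> leaves s = mset_set V"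
    using assms(1) by (auto simp: multilinear_deg_def)
  obtain xs where xs: "set xs = V" "distinct xs"
    using finite_distinct_list[OF ml(1)] by auto
  then have "length xs = 6" using distinct_card[of xs] ml(2) by simp
  \<comment> \<open>Any of the six labels may serve as \<open>z\<close>.\<close>
  then obtain x0 x1 x2 x3 x4 z where l: "xs = [x0, x1, x2, x3, x4, z]"
    by (auto simp: length_Suc_conv numeral_eq_Suc)
  interpret six_labels x0 x1 x2 x3 x4 z V
    by unfold_locales (use xs l in auto)
  show ?thesis by (rule identity_is_consequence[OF assms(2) ml(3)])
qed

end
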